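(* Consider a PCA on $\Omega_S=\{-1,+1\}^{\mathbb{Z}^d}$ with transition operator $P$, and let $\mathcal{I}_\tau$ be the set of its stationary translation-invariant probability measures. Assume that the (two-sided) path-space measures $\mathbb{P}_{\nu}$, $\nu\in\mathcal{I}_\tau$, are Gibbs measures on $\{-1,+1\}^{\mathbb{Z}^{d+1}}$ for one common translation-invariant absolutely summable potential. 1. Assume $P$ is non-degenerate. Let $\mu\neq\mu'$ be two translation-invariant probability measures on $\Omega_S$ with relative entropy density $s(\mu|\mu')=0$. Then for all $n\in\mathbb{N}$, $\mu'P^n$ does not satisfy $\mathrm{GCB}(C)$ for any $C\ge0$. 2. Let $\nu,\nu'\in\mathcal{I}_\tau$ with $\nu'\ne\nu$. If $\nu$ satisfies $\mathrm{GCB}(C)$ for some $C>0$, then $s_*(\nu'|\nu)>0$. In particular, $\nu$ and $\nu'$ cannot be Gibbs measures for the same translation-invariant potential. 3. Let $\mu$ be a translation-invariant Gibbs measure on $\Omega_S$ with respect to a translation-invariant potential, which is also stationary for the PCA. Assume $\mu$ satisfies $\mathrm{GCB}(C)$ for some $C>0$. Let $\nu$ be a translation-invariant probability measure on $\Omega_S$ with zero relative entropy production with respect to $\mu$, i.e. such that $$s(\nu|\mu)=s(\nu P|\mu).$$ Then $\nu=\mu$. As a consequence, $\mathcal{I}_\tau=\{\mu\}$.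
   Context: $\mathbb{N}=\{0,1,2,\dots\}$. $\Lambda\Subset\mathbb{Z}^d$ means $\Lambda$ is a finite subset of $\mathbb{Z}^d$. $C_n=[-n,n]^d\cap\mathbb{Z}^d$. Configuration spaces have the product topology and Borel $\sigma$-algebra. Potentials are absolutely summable. PCA: real coefficients $(r_A)_{A\Subset\mathbb{Z}^d}$ with $\sum_A|r_A|<\infty$ are given; for $\eta\in\Omega_S$ and $x\in\mathbb{Z}^d$ set $h_x(\eta)=\sum_{A\Subset\mathbb{Z}^d} r_A\,\eta_{A+x}$, where $\eta_B=\prod_{y\in B}\eta_y$, and assume $|h_x(\eta)|\le 1$ for all $\eta$ and $x$. Given $\eta$, $p(d\sigma|\eta)$ is the product probability measure on $\Omega_S$ with marginals $p(\sigma_x=s\,|\,\eta)=\frac12(1+s\,h_x(\eta))$, $s\in\{-1,+1\}$. $Pf(\eta)=\int f(\sigma)\,p(d\sigma|\eta)$ and $\mu P(d\sigma)=\int p(d\sigma|\eta)\,\mu(d\eta)$; $\mu$ is stationary if $\mu P=\mu$. For $\nu\in\mathcal{I}_\tau$, $\mathbb{P}_\nu$ is the law of the stationary Markov chain with kernel $p$ and marginal $\nu$, extended to negative times, viewed as a measure on $\{-1,+1\}^{\mathbb{Z}^{d+1}}$. Non-degenerate: $P$ is non-degenerate if for all probability measures $\mu,\nu$ on $\Omega_S$, $\mu\neq\nu$ implies $\mu P^n\neq\nu P^n$ for all $n\in\mathbb{N}$. GCB: a function is local if it depends on finitely many coordinates. $\delta_x f=\sup_{\sigma}\big(f(\sigma^{(x)})-f(\sigma)\big)$,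 where $\sigma^{(x)}$ is $\sigma$ with the spin at $x$ flipped, and $\|\delta f\|_2^2=\sum_{x\in\mathbb{Z}^d}(\delta_x f)^2$. $\mu$ satisfies $\mathrm{GCB}(C)$ if $\log\int e^{f-\int f\,d\mu}\,d\mu\le\frac{C}{2}\|\delta f\|_2^2$ for every local $f:\Omega_S\to\mathbb{R}$. Relative entropy: $s_\Lambda(\mu|\nu)=\sum_{\sigma_\Lambda\in\{-1,+1\}^\Lambda}\mu(\sigma_\Lambda)\log\frac{\mu(\sigma_\Lambda)}{\nu(\sigma_\Lambda)}$ if the restriction of $\mu$ to $\Lambda$ is absolutely continuous with respect to that of $\nu$, and $+\infty$ otherwise, where $\mu(\sigma_\Lambda)$ is the probability of the cylinder $\sigma_\Lambda$. The lower relative entropy density is $s_*(\mu|\nu)=\liminf_{n\to\infty}s_{C_n}(\mu|\nu)/|C_n|$, and when the limit exists the relative entropy density is $s(\mu|\nu)=\lim_{n\to\infty}s_{C_n}(\mu|\nu)/|C_n|$ (it exists for $\mu$ translation invariant when $\nu$ is a translation-invariant Gibbs measure for a translation-invariant absolutely summable potential). *)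

theory Defs
  imports "HOL-Probability.Probability"
begin

text \<open>
  Spin configurations on a lattice are functions into \<^typ>\<open>bool\<close>, with \<^const>\<open>True\<close>
  standing for the spin \<open>+1\<close> and \<^const>\<open>False\<close> for \<open>-1\<close>. Function types carry the product
  topology and \<^typ>\<open>bool\<close> is discrete, so \<^const>\<open>borel\<close> is the Borel sigma-algebra
  of \<open>{-1,+1}^G\<close>. The lattice \<open>Z^d\<close> is \<^typ>\<open>int^'d\<close> and the space-time lattice \<open>Z^(d+1)\<close> is
  \<^typ>\<open>(int^'d) \<times> int\<close>, the second component being time. Notions needed on both lattices
  are stated for an arbitrary group \<open>'g\<close>.
\<close>

type_synonym 'g config = "'g \<Rightarrow> bool"

definition spin :: "bool \<Rightarrow> real" where
  "spin b = (if b then 1 else -1)"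

definition config_measures :: "'g config measure set" where
  "config_measures = {\<mu>. prob_space \<mu> \<and> sets \<mu> = sets borel}"

definition shift :: "'g::ab_group_add \<Rightarrow> 'g config \<Rightarrow> 'g config" where
  "shift x \<sigma> = (\<lambda>y. \<sigma> (y + x))"

definition translation_invariant :: "'g::ab_group_add config measure \<Rightarrow> bool" where
  "translation_invariant \<mu> \<longleftrightarrow> (\<forall>x. distr \<mu> borel (shift x) = \<mu>)"

definition translate :: "'g::ab_group_add \<Rightarrow> 'g set \<Rightarrow> 'g set" where
  "translate x A = (\<lambda>a. a + x) ` A"

definition depends_only_on :: "'g set \<Rightarrow> ('g config \<Rightarrow> 'b) \<Rightarrow> bool" where
  "depends_only_on A f \<longleftrightarrow> (\<forall>\<sigma> \<sigma>'. (\<forall>x\<in>A. \<sigma> x = \<sigma>' x) \<longrightarrow> f \<sigma> = f \<sigma>')"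

definition local_function :: "('g config \<Rightarrow> 'b) \<Rightarrow> bool" where
  "local_function f \<longleftrightarrow> (\<exists>A. finite A \<and> depends_only_on A f)"


section \<open>Potentials and Gibbs measures\<close>

type_synonym 'g potential = "'g set \<Rightarrow> 'g config \<Rightarrow> real"

text \<open>The values of a potential at infinite sets are never used.\<close>

definition ti_summable_potential :: "'g::ab_group_add potential \<Rightarrow> bool" where
  "ti_summable_potential \<Phi> \<longleftrightarrow>
     (\<forall>A. finite A \<longrightarrow> depends_only_on A (\<Phi> A)) \<and>
     (\<forall>A x \<sigma>. finite A \<longrightarrow> \<Phi> (translate x A) \<sigma> = \<Phi> A (shift x \<sigma>)) \<and>
     (\<forall>x. (\<lambda>A. SUP \<sigma>. \<bar>\<Phi> A \<sigma>\<bar>) summable_on {A. finite A \<and> x \<in> A})"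

definition hamiltonian :: "'g potential \<Rightarrow> 'g set \<Rightarrow> 'g config \<Rightarrow> real" where
  "hamiltonian \<Phi> \<Lambda> \<sigma> = (\<Sum>\<^sub>\<infinity>A\<in>{A. finite A \<and> A \<inter> \<Lambda> \<noteq> {}}. \<Phi> A \<sigma>)"

text \<open>
  The Gibbsian specification in the finite volume \<open>\<Lambda>\<close> with boundary condition \<open>\<eta>\<close>;
  \<^term>\<open>override_on \<eta> \<xi> \<Lambda>\<close> is the configuration equal to \<open>\<xi>\<close> in \<open>\<Lambda>\<close> and to \<open>\<eta>\<close> outside.
\<close>

definition gibbs_weight :: "'g potential \<Rightarrow> 'g set \<Rightarrow> 'g config \<Rightarrow> 'g config \<Rightarrow> real" where
  "gibbs_weight \<Phi> \<Lambda> \<eta> \<xi> = exp (- hamiltonian \<Phi> \<Lambda> (override_on \<eta> \<xi> \<Lambda>))"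

definition gibbs_specification ::
    "'g potential \<Rightarrow> 'g set \<Rightarrow> 'g config \<Rightarrow> 'g config set \<Rightarrow> real" where
  "gibbs_specification \<Phi> \<Lambda> \<eta> B =
     (\<Sum>\<xi>\<in>\<Lambda> \<rightarrow>\<^sub>E UNIV. gibbs_weight \<Phi> \<Lambda> \<eta> \<xi> * indicator B (override_on \<eta> \<xi> \<Lambda>)) /
     (\<Sum>\<xi>\<in>\<Lambda> \<rightarrow>\<^sub>E UNIV. gibbs_weight \<Phi> \<Lambda> \<eta> \<xi>)"

text \<open>Gibbs measures are defined by the DLR equations.\<close>

definition gibbs_measure :: "'g potential \<Rightarrow> 'g config measure \<Rightarrow> bool" where
  "gibbs_measure \<Phi> \<mu> \<longleftrightarrow> \<mu> \<in> config_measures \<and>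
     (\<forall>\<Lambda>. finite \<Lambda> \<longrightarrow> (\<forall>B\<in>sets borel.
        measure \<mu> B = (\<integral>\<eta>. gibbs_specification \<Phi> \<Lambda> \<eta> B \<partial>\<mu>)))"


section \<open>Probabilistic cellular automata\<close>

definition local_field :: "('g::ab_group_add set \<Rightarrow> real) \<Rightarrow> 'g \<Rightarrow> 'g config \<Rightarrow> real" where
  "local_field r x \<eta> = (\<Sum>\<^sub>\<infinity>A\<in>{A. finite A}. r A * (\<Prod>y\<in>translate x A. spin (\<eta> y)))"

definition pca_coefficients :: "('g::ab_group_add set \<Rightarrow> real) \<Rightarrow> bool" where
  "pca_coefficients r \<longleftrightarrow>
     (\<lambda>A. \<bar>r A\<bar>) summable_on {A. finite A} \<and> (\<forall>x \<eta>. \<bar>local_field r x \<eta>\<bar> \<le> 1)"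

definition pca_kernel :: "('g::ab_group_add set \<Rightarrow> real) \<Rightarrow> 'g config \<Rightarrow> 'g config measure" where
  "pca_kernel r \<eta> =
     PiM UNIV (\<lambda>x. measure_pmf (bernoulli_pmf ((1 + local_field r x \<eta>) / 2)))"

text \<open>The action \<open>\<mu> \<mapsto> \<mu>P\<close> on measures.\<close>

definition pca_step ::
    "('g::ab_group_add set \<Rightarrow> real) \<Rightarrow> 'g config measure \<Rightarrow> 'g config measure" where
  "pca_step r \<mu> = \<mu> \<bind> pca_kernel r"

definition stationary_ti_measures ::
    "('g::ab_group_add set \<Rightarrow> real) \<Rightarrow> 'g config measure set" where
  "stationary_ti_measures r =
     {\<nu>\<in>config_measures. pca_step r \<nu> = \<nu> \<and> translation_invariant \<nu>}"

definition non_degenerate :: "('g::ab_group_add set \<Rightarrow> real) \<Rightarrow> bool" where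
  "non_degenerate r \<longleftrightarrow>
     (\<forall>\<mu>\<in>config_measures. \<forall>\<nu>\<in>config_measures. \<mu> \<noteq> \<nu> \<longrightarrow>
        (\<forall>n. (pca_step r ^^ n) \<mu> \<noteq> (pca_step r ^^ n) \<nu>))"

definition time_slice :: "int \<Rightarrow> ('g \<times> int) config \<Rightarrow> 'g config" where
  "time_slice t \<omega> = (\<lambda>x. \<omega> (x, t))"

definition past_algebra :: "int \<Rightarrow> ('g \<times> int) config measure" where
  "past_algebra t = vimage_algebra UNIV (\<lambda>\<omega>. restrict \<omega> (UNIV \<times> {..t}))
     (PiM (UNIV \<times> {..t}) (\<lambda>_. count_space UNIV))"

text \<open>
  \<open>M\<close> is the law of the two-sided stationary Markov chain with kernel \<^term>\<open>pca_kernel r\<close> and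
  marginal \<open>\<nu>\<close>: every time slice has law \<open>\<nu>\<close>, and conditionally on the past up to time \<open>t\<close>
  the slice at time \<open>t + 1\<close> has law \<open>pca_kernel r (time_slice t \<omega>)\<close>. These conditions fix all
  finite-dimensional distributions and hence determine \<open>M\<close>.
\<close>

definition path_space_law ::
    "('g::ab_group_add set \<Rightarrow> real) \<Rightarrow> 'g config measure \<Rightarrow> ('g \<times> int) config measure \<Rightarrow> bool" where
  "path_space_law r \<nu> M \<longleftrightarrow> M \<in> config_measures \<and>
     (\<forall>t. distr M borel (time_slice t) = \<nu>) \<and>
     (\<forall>t. \<forall>E\<in>sets (past_algebra t). \<forall>B\<in>sets borel.
        measure M (E \<inter> time_slice (t + 1) -` B) =
          (\<integral>\<omega>. indicator E \<omega> * measure (pca_kernel r (time_slice t \<omega>)) B \<partial>M))"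


section \<open>Gaussian concentration and relative entropy\<close>

definition oscillation :: "'g \<Rightarrow> ('g config \<Rightarrow> real) \<Rightarrow> real" where
  "oscillation x f = (SUP \<sigma>. f (\<sigma>(x := \<not> \<sigma> x)) - f \<sigma>)"

definition GCB :: "real \<Rightarrow> 'g config measure \<Rightarrow> bool" where
  "GCB C \<mu> \<longleftrightarrow> (\<forall>f :: 'g config \<Rightarrow> real. local_function f \<longrightarrow>
     ln (\<integral>\<sigma>. exp (f \<sigma> - (\<integral>\<sigma>'. f \<sigma>' \<partial>\<mu>)) \<partial>\<mu>) \<le> C / 2 * (\<Sum>\<^sub>\<infinity>x. (oscillation x f)\<^sup>2))"

definition cylinder :: "'g set \<Rightarrow> 'g config \<Rightarrow> 'g config set" where
  "cylinder \<Lambda> \<xi> = {\<sigma>. \<forall>x\<in>\<Lambda>. \<sigma> x = \<xi> x}"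

definition relative_entropy ::
    "'g set \<Rightarrow> 'g config measure \<Rightarrow> 'g config measure \<Rightarrow> ereal" where
  "relative_entropy \<Lambda> \<mu> \<nu> =
     (if \<forall>\<xi>. measure \<nu> (cylinder \<Lambda> \<xi>) = 0 \<longrightarrow> measure \<mu> (cylinder \<Lambda> \<xi>) = 0
      then ereal (\<Sum>\<xi>\<in>\<Lambda> \<rightarrow>\<^sub>E UNIV. measure \<mu> (cylinder \<Lambda> \<xi>) *
             ln (measure \<mu> (cylinder \<Lambda> \<xi>) / measure \<nu> (cylinder \<Lambda> \<xi>)))
      else \<infinity>)"

definition cube :: "nat \<Rightarrow> (int^'d) set" where
  "cube n = {x. \<forall>i. \<bar>x $ i\<bar> \<le> int n}"

definition entropy_per_site ::
    "(int^'d) config measure \<Rightarrow> (int^'d) config measure \<Rightarrow> nat \<Rightarrow> ereal" where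
  "entropy_per_site \<mu> \<nu> n =
     relative_entropy (cube n) \<mu> \<nu> / ereal (real (card (cube n :: (int^'d) set)))"

definition lower_relative_entropy_density ::
    "(int^'d) config measure \<Rightarrow> (int^'d) config measure \<Rightarrow> ereal" where
  "lower_relative_entropy_density \<mu> \<nu> = liminf (entropy_per_site \<mu> \<nu>)"

text \<open>Meaningful only if \<^term>\<open>convergent (entropy_per_site \<mu> \<nu>)\<close>.\<close>

definition relative_entropy_density ::
    "(int^'d) config measure \<Rightarrow> (int^'d) config measure \<Rightarrow> ereal" where
  "relative_entropy_density \<mu> \<nu> = lim (entropy_per_site \<mu> \<nu>)"

end

theory Submission
  imports Defs
begin

text \<open>
  If \<open>\<mu>\<close> satisfies \<open>GCB(C)\<close> and \<open>s\<^sub>*(\<nu>|\<mu>) = 0\<close>, the variational principle applied to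
  \<open>\<lambda>\<close> times a sum of translates of a local \<open>f\<close> gives \<open>\<lambda>(\<nu>(f) - \<mu>(f)) \<le> const \<sqdot> \<lambda>\<^sup>2\<close>, hence
  \<open>\<nu> = \<mu>\<close>. For part 1 this is applied to \<open>\<nu>P\<^sup>n\<close> and \<open>\<mu>P\<^sup>n\<close>: a test function \<open>g\<close> with bounded
  spin-flip oscillations is pulled back to \<open>log P(e\<^sup>g)\<close>, which is again almost such a function.
  For part 2, two Gibbs measures for the same potential differ on cubes by boundary terms only.

  For part 3, let \<open>Q\<^sub>\<nu>(d\<eta> d\<sigma>) = \<nu>(d\<eta>) p(d\<sigma>|\<eta>)\<close>. Zero entropy production says that the relative
  entropy of \<open>\<eta>\<close> given \<open>\<sigma>\<close> under \<open>Q\<^sub>\<nu>\<close> with respect to \<open>Q\<^sub>\<mu>\<close> has density zero. If, on a large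
  cube, \<open>\<nu>\<close> and \<open>\<mu>\<close> differed by more than a boundary term, a product over disjoint translates of
  that cube of functions of \<open>(\<eta>, \<sigma>)\<close> with conditional \<open>Q\<^sub>\<mu>\<close>-mean at most 1 would have
  \<open>Q\<^sub>\<nu>\<close>-expected logarithm proportional to the volume, a contradiction; so \<open>s(\<nu>|\<mu>) = 0\<close>. To
  treat the translates separately one needs rates bounded away from zero and a uniformly small total
  influence of a spin on far-away transition probabilities; both follow from the Gibbs property of
  the path measure.
\<close>

section \<open>Configurations and local functions\<close>

text \<open>Two obstacles shape the proof. First, \<open>pca_coefficients\<close> bounds the sum of
  |r_A|, not the sum of |A| |r_A|, so the total influence of one spin on all transition rates may
  diverge. For part 1 the rates are therefore truncated at a fixed radius, at a cost that is small
  per site; test functions with bounded flips are exactly those for which this cost stays under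
  control. In part 3 whole patterns are exchanged tile by tile, and there the Gibbs property of the
  path measure supplies a uniform bound on far influence. Second, the potential of the path measure
  couples a spin to the future as well as to the past, so the two-sided DLR equation has to be
  reconciled with the one-sided Markov property.

  The use of GCB and the tile argument rest on the same trade: a gain linear in a small parameter
  against a loss that is quadratic in it.

  The term \<open>relative_entropy_density\<close> is a \<open>lim\<close>, so the equality assumed
  in part 3 carries information only after both limits are shown to exist; this is the purpose of
  the tilings and of the almost superadditivity of entropy.\<close>

instance bool :: second_countable_topology
proof
  show "\<exists>B :: bool set set. countable B \<and> open = generate_topology B"
  proof (intro exI conjI)
    show "countable (UNIV :: bool set set)" by (simp add: countable_finite)
    have "open x \<longleftrightarrow> generate_topology UNIV x" for x :: "bool set"
      using Topological_Spaces.open_discrete[of x] generate_topology.Basis[of x UNIV] by simp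
    then show "open = generate_topology (UNIV :: bool set set)" by (intro ext) simp
  qed
qed

text \<open>Countability of the lattice makes the two sigma-algebras coincide, so that measurability
  of a map into configurations can be checked one spin at a time.\<close>

lemma sets_borel_config:
  "sets (borel :: ('g::countable) config measure) = sets (PiM UNIV (\<lambda>_. count_space UNIV))"
proof -
  have "sets (PiM UNIV (\<lambda>_::'g. count_space (UNIV::bool set))) = sets (PiM UNIV (\<lambda>_::'g. (borel::bool measure)))"
    by (intro sets_PiM_cong) (auto simp: sets_borel_eq_count_space)
  then show ?thesis using sets_PiM_equal_borel by metis
qed

lemma measurable_configI:
  fixes f :: "'a \<Rightarrow> ('g::countable) config"
  assumes "\<And>x. (\<lambda>\<omega>. f \<omega> x) \<in> M \<rightarrow>\<^sub>M count_space UNIV"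
  shows "f \<in> M \<rightarrow>\<^sub>M borel"
proof -
  have "(\<lambda>\<omega>. \<lambda>x\<in>UNIV. f \<omega> x) \<in> M \<rightarrow>\<^sub>M PiM UNIV (\<lambda>_. count_space UNIV)"
    by (rule measurable_restrict) (use assms in auto)
  then show ?thesis
    using measurable_cong_sets[OF refl sets_borel_config] by (auto simp: restrict_def)
qed

lemma measurable_spin_at [measurable]:
  "(\<lambda>\<sigma>. \<sigma> x) \<in> (borel :: ('g::countable) config measure) \<rightarrow>\<^sub>M count_space UNIV"
proof -
  have "(\<lambda>\<sigma>. \<sigma> x) \<in> PiM UNIV (\<lambda>_::'g. count_space (UNIV::bool set)) \<rightarrow>\<^sub>M count_space UNIV"
    by (rule measurable_component_singleton) simp
  then show ?thesis
    by (subst measurable_cong_sets[OF sets_borel_config refl])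
qed

lemma cylinder_sets [measurable, simp]:
  fixes \<Lambda> :: "('g::countable) set"
  assumes "finite \<Lambda>"
  shows "cylinder \<Lambda> \<xi> \<in> sets borel"
proof -
  have "{\<sigma> \<in> space borel. \<forall>x\<in>\<Lambda>. \<sigma> x = \<xi> x} \<in> sets (borel :: 'g config measure)"
    using assms by measurable
  then show ?thesis by (simp add: cylinder_def)
qed

lemma in_cylinder_iff: "\<sigma> \<in> cylinder \<Lambda> \<xi> \<longleftrightarrow> (\<forall>x\<in>\<Lambda>. \<sigma> x = \<xi> x)"
  by (simp add: cylinder_def)

lemma finite_patterns [simp]: "finite \<Lambda> \<Longrightarrow> finite (\<Lambda> \<rightarrow>\<^sub>E (UNIV :: bool set))"
  by (rule finite_PiE) auto

text \<open>Patterns are extensional, so exactly one of them,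
  \<open>restrict \<sigma> \<Lambda>\<close>, has \<sigma> in its cylinder.\<close>

lemma sum_over_patterns:
  fixes f :: "'g config \<Rightarrow> 'b::semiring_1"
  assumes "finite \<Lambda>"
  shows "(\<Sum>\<xi>\<in>\<Lambda> \<rightarrow>\<^sub>E UNIV. indicator (cylinder \<Lambda> \<xi>) \<sigma> * f \<xi>) = f (restrict \<sigma> \<Lambda>)"
proof -
  have eq: "\<sigma> \<in> cylinder \<Lambda> \<xi> \<longleftrightarrow> \<xi> = restrict \<sigma> \<Lambda>" if "\<xi> \<in> \<Lambda> \<rightarrow>\<^sub>E UNIV" for \<xi>
    using that by (auto simp: in_cylinder_iff fun_eq_iff PiE_def extensional_def)
  have "(\<Sum>\<xi>\<in>\<Lambda> \<rightarrow>\<^sub>E UNIV. indicator (cylinder \<Lambda> \<xi>) \<sigma> * f \<xi>) =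
        (\<Sum>\<xi>\<in>\<Lambda> \<rightarrow>\<^sub>E UNIV. if \<xi> = restrict \<sigma> \<Lambda> then f \<xi> else 0)"
    by (intro sum.cong refl) (auto simp: eq indicator_def)
  also have "\<dots> = f (restrict \<sigma> \<Lambda>)"
    using assms by (subst sum.delta) (auto)
  finally show ?thesis .
qed

lemma depends_only_onD:
  "depends_only_on A f \<Longrightarrow> (\<And>x. x \<in> A \<Longrightarrow> \<sigma> x = \<sigma>' x) \<Longrightarrow> f \<sigma> = f \<sigma>'"
  unfolding depends_only_on_def by blast

lemma depends_only_on_mono: "depends_only_on A f \<Longrightarrow> A \<subseteq> B \<Longrightarrow> depends_only_on B f"
  unfolding depends_only_on_def by blast

lemma depends_only_on_restrict: "depends_only_on A f \<Longrightarrow> f (restrict \<sigma> A) = f \<sigma>"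
  by (rule depends_only_onD) auto

lemma local_expansion:
  fixes f :: "'g config \<Rightarrow> 'b::semiring_1"
  assumes "finite A" "depends_only_on A f"
  shows "f \<sigma> = (\<Sum>\<xi>\<in>A \<rightarrow>\<^sub>E UNIV. indicator (cylinder A \<xi>) \<sigma> * f \<xi>)"
  using sum_over_patterns[OF assms(1), of \<sigma> f] depends_only_on_restrict[OF assms(2), of \<sigma>] by simp

lemma local_finite_range:
  assumes "finite A" "depends_only_on A f"
  shows "finite (range f)"
proof -
  have "range f \<subseteq> f ` (A \<rightarrow>\<^sub>E UNIV)"
  proof
    fix y assume "y \<in> range f"
    then obtain \<sigma> where "y = f \<sigma>" by auto
    then have "y = f (restrict \<sigma> A)" by (simp add: depends_only_on_restrict[OF assms(2)])
    moreover have "restrict \<sigma> A \<in> A \<rightarrow>\<^sub>E UNIV" by auto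
    ultimately show "y \<in> f ` (A \<rightarrow>\<^sub>E UNIV)" by blast
  qed
  then show ?thesis by (rule finite_subset) (use assms in auto)
qed

lemma local_measurable:
  fixes f :: "('g::countable) config \<Rightarrow> real"
  assumes "finite A" "depends_only_on A f"
  shows "f \<in> borel_measurable borel"
proof -
  have "(\<lambda>\<sigma>. \<Sum>\<xi>\<in>A \<rightarrow>\<^sub>E UNIV. indicator (cylinder A \<xi>) \<sigma> * f \<xi>) \<in> borel_measurable borel"
    using assms by measurable
  then show ?thesis
    by (subst local_expansion[OF assms, abs_def])
qed

lemma local_bounded:
  fixes f :: "'g config \<Rightarrow> real"
  assumes "finite A" "depends_only_on A f"
  obtains B where "\<And>\<sigma>. \<bar>f \<sigma>\<bar> \<le> B"
proof -
  have "finite (range (\<lambda>\<sigma>. \<bar>f \<sigma>\<bar>))"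
    using finite_imageI[OF local_finite_range[OF assms], of abs] by (simp add: image_image)
  then show ?thesis using that[of "Max (range (\<lambda>\<sigma>. \<bar>f \<sigma>\<bar>))"] by auto
qed

section \<open>Integration of local functions\<close>

lemma config_measuresD:
  assumes "\<mu> \<in> config_measures"
  shows "prob_space \<mu>" "sets \<mu> = sets borel" "space \<mu> = UNIV"
    "borel_measurable \<mu> = (borel_measurable borel :: ('g config \<Rightarrow> 'b::topological_space) set)"
  using assms sets_eq_imp_space_eq[of \<mu> borel] measurable_cong_sets[of \<mu> borel borel borel]
  by (auto simp: config_measures_def cong: measurable_cong_sets)

lemma bounded_integrable:
  fixes f :: "'g config \<Rightarrow> real"
  assumes "\<mu> \<in> config_measures" "f \<in> borel_measurable borel" "\<And>\<sigma>. \<bar>f \<sigma>\<bar> \<le> B"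
  shows "integrable \<mu> f"
proof -
  interpret prob_space \<mu> by (rule config_measuresD[OF assms(1)])
  show ?thesis
    by (rule integrable_const_bound[of _ B]) (use assms config_measuresD[OF assms(1)] in auto)
qed

lemma local_integrable:
  fixes f :: "('g::countable) config \<Rightarrow> real"
  assumes "\<mu> \<in> config_measures" "finite A" "depends_only_on A f"
  shows "integrable \<mu> f"
  using local_bounded[OF assms(2,3)] bounded_integrable[OF assms(1) local_measurable[OF assms(2,3)]]
  by metis

lemma integral_indicator_config:
  assumes "\<mu> \<in> config_measures" "A \<in> sets borel"
  shows "(\<integral>\<sigma>. indicator A \<sigma> \<partial>\<mu>) = measure \<mu> A"
  using config_measuresD[OF assms(1)] assms(2) by simp

lemma integral_local:
  fixes f :: "('g::countable) config \<Rightarrow> real"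
  assumes \<mu>: "\<mu> \<in> config_measures" and A: "finite A" and f: "depends_only_on A f"
  shows "(\<integral>\<sigma>. f \<sigma> \<partial>\<mu>) = (\<Sum>\<xi>\<in>A \<rightarrow>\<^sub>E UNIV. measure \<mu> (cylinder A \<xi>) * f \<xi>)"
proof -
  interpret prob_space \<mu> by (rule config_measuresD[OF \<mu>])
  have "(\<integral>\<sigma>. f \<sigma> \<partial>\<mu>) = (\<integral>\<sigma>. (\<Sum>\<xi>\<in>A \<rightarrow>\<^sub>E UNIV. indicator (cylinder A \<xi>) \<sigma> * f \<xi>) \<partial>\<mu>)"
    by (intro Bochner_Integration.integral_cong refl local_expansion[OF A f])
  also have "\<dots> = (\<Sum>\<xi>\<in>A \<rightarrow>\<^sub>E UNIV. (\<integral>\<sigma>. indicator (cylinder A \<xi>) \<sigma> * f \<xi> \<partial>\<mu>))"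
    by (intro Bochner_Integration.integral_sum bounded_integrable[OF \<mu>, where B="\<bar>f _\<bar>"])
       (use A in \<open>auto simp: indicator_def\<close>)
  also have "\<dots> = (\<Sum>\<xi>\<in>A \<rightarrow>\<^sub>E UNIV. measure \<mu> (cylinder A \<xi>) * f \<xi>)"
    using A by (intro sum.cong refl) (simp add: config_measuresD(3)[OF \<mu>])
  finally show ?thesis .
qed

lemma sum_cylinder_measure:
  fixes \<mu> :: "('g::countable) config measure"
  assumes "\<mu> \<in> config_measures" "finite A"
  shows "(\<Sum>\<xi>\<in>A \<rightarrow>\<^sub>E UNIV. measure \<mu> (cylinder A \<xi>)) = 1"
proof -
  interpret prob_space \<mu> by (rule config_measuresD[OF assms(1)])
  show ?thesis
    using integral_local[OF assms, of "\<lambda>_. 1"] prob_space by (simp add: depends_only_on_def)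
qed

text \<open>Indicators of finite-dimensional product sets are local, and these sets form a generator
  stable under intersection.\<close>

lemma config_measure_eqI:
  fixes \<mu> \<nu> :: "('g::countable) config measure"
  assumes \<mu>: "\<mu> \<in> config_measures" and \<nu>: "\<nu> \<in> config_measures"
    and eq: "\<And>A (f :: 'g config \<Rightarrow> real). finite A \<Longrightarrow> depends_only_on A f \<Longrightarrow> (\<integral>\<sigma>. f \<sigma> \<partial>\<mu>) = (\<integral>\<sigma>. f \<sigma> \<partial>\<nu>)"
  shows "\<mu> = \<nu>"
proof (rule measure_eqI_PiM_infinite)
  interpret \<mu>: prob_space \<mu> by (rule config_measuresD[OF \<mu>])
  interpret \<nu>: prob_space \<nu> by (rule config_measuresD[OF \<nu>])
  show "finite_measure \<mu>" by unfold_locales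
  show "sets \<mu> = sets (PiM UNIV (\<lambda>_. count_space UNIV))" "sets \<nu> = sets (PiM UNIV (\<lambda>_. count_space UNIV))"
    by (simp_all add: config_measuresD[OF \<mu>] config_measuresD[OF \<nu>] sets_borel_config)
  fix A :: "'g \<Rightarrow> bool set" and J :: "'g set"
  assume J: "finite J"
  let ?X = "prod_emb UNIV (\<lambda>_. count_space UNIV) J (Pi\<^sub>E J A)"
  have X: "?X = {\<sigma>. \<forall>x\<in>J. \<sigma> x \<in> A x}"
    by (auto simp: prod_emb_def PiE_iff)
  have "?X \<in> sets borel"
    unfolding sets_borel_config by (rule sets_PiM_I) (use J in auto)
  then have meas: "?X \<in> sets (borel :: 'g config measure)" .
  have "depends_only_on J (indicator ?X :: _ \<Rightarrow> real)"
    by (auto simp: X depends_only_on_def indicator_def)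
  from eq[OF J this] have "measure \<mu> ?X = measure \<nu> ?X"
    using meas by (simp only: integral_indicator_config[OF \<mu>] integral_indicator_config[OF \<nu>])
  then show "emeasure \<mu> ?X = emeasure \<nu> ?X"
    by (simp add: \<mu>.emeasure_eq_measure \<nu>.emeasure_eq_measure)
qed

text \<open>Equivalently, \<open>f\<close> is continuous for the product topology.\<close>

definition quasilocal :: "('g config \<Rightarrow> real) \<Rightarrow> bool" where
  "quasilocal f \<longleftrightarrow>
     (\<forall>e>0. \<exists>A. finite A \<and> (\<forall>\<sigma> \<sigma>'. (\<forall>x\<in>A. \<sigma> x = \<sigma>' x) \<longrightarrow> \<bar>f \<sigma> - f \<sigma>'\<bar> \<le> e))"

lemma quasilocalD:
  assumes "quasilocal f" "e > 0"
  shows "\<exists>A. finite A \<and> (\<forall>\<sigma> \<sigma>'. (\<forall>x\<in>A. \<sigma> x = \<sigma>' x) \<longrightarrow> \<bar>f \<sigma> - f \<sigma>'\<bar> \<le> e)"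
  using assms unfolding quasilocal_def by blast

text \<open>Freezing all spins outside a finite set gives a local, hence measurable, function. Along
  the exhaustion by \<open>to_nat\<close> these functions converge pointwise to
  \<open>f\<close>.\<close>

lemma quasilocal_measurable:
  fixes f :: "('g::countable) config \<Rightarrow> real"
  assumes "quasilocal f"
  shows "f \<in> borel_measurable borel"
proof (rule borel_measurable_LIMSEQ_real)
  define A where "A n = {x::'g. to_nat x \<le> n}" for n
  have finA: "finite (A n)" for n
  proof -
    have "finite (to_nat -` {..n} :: 'g set)" by (rule finite_vimageI) auto
    then show ?thesis by (simp add: A_def vimage_def)
  qed
  let ?F = "\<lambda>n \<sigma>. f (override_on (\<lambda>_. True) \<sigma> (A n))"
  show "(\<lambda>n. ?F n \<sigma>) \<longlonglongrightarrow> f \<sigma>" for \<sigma>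
  proof (rule LIMSEQ_I)
    fix e :: real assume "e > 0"
    then have "e / 2 > 0" by simp
    from quasilocalD[OF assms this] obtain B where
      B: "finite B" "\<forall>\<sigma> \<sigma>'. (\<forall>x\<in>B. \<sigma> x = \<sigma>' x) \<longrightarrow> \<bar>f \<sigma> - f \<sigma>'\<bar> \<le> e / 2"
      by blast
    have "\<bar>?F n \<sigma> - f \<sigma>\<bar> \<le> e/2" if "n \<ge> Max (insert 0 (to_nat ` B))" for n
    proof (intro B(2)[rule_format])
      fix x assume "x \<in> B"
      then have "to_nat x \<le> n" using that B(1) by (auto simp: Max_ge_iff)
      then show "override_on (\<lambda>_. True) \<sigma> (A n) x = \<sigma> x" by (simp add: A_def override_on_def)
    qed
    then have "\<forall>n\<ge>Max (insert 0 (to_nat ` B)). norm (?F n \<sigma> - f \<sigma>) < e"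
      using \<open>e > 0\<close> by fastforce
    then show "\<exists>N. \<forall>n\<ge>N. norm (?F n \<sigma> - f \<sigma>) < e" by blast
  qed
  show "?F n \<in> borel_measurable borel" for n
  proof (rule local_measurable[OF finA[of n]])
    have "override_on (\<lambda>_. True) \<sigma> (A n) = override_on (\<lambda>_. True) \<sigma>' (A n)"
      if "\<forall>x\<in>A n. \<sigma> x = \<sigma>' x" for \<sigma> \<sigma>'
      using that by (auto simp: override_on_def)
    then show "depends_only_on (A n) (?F n)"
      unfolding depends_only_on_def by metis
  qed
qed

section \<open>The finite-volume variational principle\<close>

text \<open>The Gibbs variational inequality. It is \<open>ln_le_minus_one\<close> at the ratio of q
  exp(f) / Z to p, averaged over p; points with p = 0 are treated apart because the ratio is
  undefined there.\<close>

lemma finite_variational: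
  fixes p q f :: "'a \<Rightarrow> real"
  assumes "finite S" and p: "\<And>x. x \<in> S \<Longrightarrow> p x \<ge> 0" and q: "\<And>x. x \<in> S \<Longrightarrow> q x \<ge> 0"
    and ac: "\<And>x. x \<in> S \<Longrightarrow> q x = 0 \<Longrightarrow> p x = 0" and "sum p S = 1"
  shows "(\<Sum>x\<in>S. p x * f x) \<le> (\<Sum>x\<in>S. p x * ln (p x / q x)) + ln (\<Sum>x\<in>S. q x * exp (f x))"
proof -
  define Z where "Z = (\<Sum>x\<in>S. q x * exp (f x))"
  have "\<exists>x\<in>S. p x > 0"
    using assms(5) p by (metis less_eq_real_def sum.neutral zero_neq_one)
  then obtain x0 where x0: "x0 \<in> S" "p x0 > 0" by blast
  have "q x0 > 0" using ac[OF x0(1)] q[OF x0(1)] x0(2) by linarith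
  then have Z: "Z > 0" unfolding Z_def
    by (intro sum_pos2[OF assms(1) x0(1)]) (use q in auto)
  have "p x * f x - p x * ln (p x / q x) - p x * ln Z \<le> q x * exp (f x) / Z - p x" if "x \<in> S" for x
  proof (cases "p x = 0")
    case True then show ?thesis using q[OF that] Z by simp
  next
    case False
    then have px: "p x > 0" and qx: "q x > 0"
      using p[OF that] q[OF that] ac[OF that] by (auto simp: less_le)
    have "f x - ln (p x / q x) - ln Z = ln (q x * exp (f x) / (Z * p x))"
      using px qx Z by (simp add: ln_div ln_mult)
    also have "\<dots> \<le> q x * exp (f x) / (Z * p x) - 1"
      using px qx Z by (intro ln_le_minus_one) auto
    finally have "p x * (f x - ln (p x / q x) - ln Z) \<le> p x * (q x * exp (f x) / (Z * p x) - 1)"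
      using px by (intro mult_left_mono) auto
    also have "\<dots> = q x * exp (f x) / Z - p x" using px by (simp add: field_simps)
    finally show ?thesis by (simp add: algebra_simps)
  qed
  then have "(\<Sum>x\<in>S. p x * f x - p x * ln (p x / q x) - p x * ln Z) \<le> (\<Sum>x\<in>S. q x * exp (f x) / Z - p x)"
    by (rule sum_mono)
  also have "\<dots> = Z / Z - 1"
    by (simp add: sum_subtractf assms(5) Z_def sum_divide_distrib[symmetric])
  also have "\<dots> = 0" using Z by simp
  finally have "(\<Sum>x\<in>S. p x * f x) - (\<Sum>x\<in>S. p x * ln (p x / q x)) - sum p S * ln Z \<le> 0"
    by (simp add: sum_subtractf sum_distrib_right)
  then show ?thesis using assms(5) by (simp add: Z_def)
qed

text \<open>The finite branch of \<open>relative_entropy\<close> as a real number. It is used only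
  where null cylinders of the second measure are null for the first; Gibbs measures charge every
  cylinder, so there the condition is automatic.\<close>

definition pattern_entropy :: "'g set \<Rightarrow> 'g config measure \<Rightarrow> 'g config measure \<Rightarrow> real" where
  "pattern_entropy \<Lambda> \<mu> \<nu> = (\<Sum>\<xi>\<in>\<Lambda> \<rightarrow>\<^sub>E UNIV. measure \<mu> (cylinder \<Lambda> \<xi>) *
             ln (measure \<mu> (cylinder \<Lambda> \<xi>) / measure \<nu> (cylinder \<Lambda> \<xi>)))"

lemma variational_bound_real:
  fixes \<mu> \<nu> :: "('g::countable) config measure"
  assumes \<mu>: "\<mu> \<in> config_measures" and \<nu>: "\<nu> \<in> config_measures" and A: "finite A"
    and f: "depends_only_on A f"
    and ac: "\<And>\<xi>. measure \<mu> (cylinder A \<xi>) = 0 \<Longrightarrow> measure \<nu> (cylinder A \<xi>) = 0"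
  shows "(\<integral>\<sigma>. f \<sigma> \<partial>\<nu>) \<le> pattern_entropy A \<nu> \<mu> + ln (\<integral>\<sigma>. exp (f \<sigma>) \<partial>\<mu>)"
proof -
  have e: "depends_only_on A (\<lambda>\<sigma>. exp (f \<sigma>))"
    using f by (auto simp: depends_only_on_def)
  show ?thesis
    unfolding integral_local[OF \<nu> A f] integral_local[OF \<mu> A e] pattern_entropy_def
    by (rule finite_variational)
       (use A ac sum_cylinder_measure[OF \<nu> A] in auto)
qed

lemma variational_bound:
  fixes \<mu> \<nu> :: "('g::countable) config measure"
  assumes "\<mu> \<in> config_measures" "\<nu> \<in> config_measures" "finite A" "depends_only_on A f"
  shows "ereal (\<integral>\<sigma>. f \<sigma> \<partial>\<nu>) \<le> relative_entropy A \<nu> \<mu> + ereal (ln (\<integral>\<sigma>. exp (f \<sigma>) \<partial>\<mu>))"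
  using variational_bound_real[OF assms]
  by (auto simp: relative_entropy_def pattern_entropy_def)

text \<open>The variational bound for the test function 0.\<close>

lemma relative_entropy_nonneg:
  fixes \<mu> \<nu> :: "('g::countable) config measure"
  assumes "\<mu> \<in> config_measures" "\<nu> \<in> config_measures" "finite A"
  shows "0 \<le> relative_entropy A \<nu> \<mu>"
proof -
  interpret prob_space \<mu> by (rule config_measuresD[OF assms(1)])
  show ?thesis
    using variational_bound[OF assms, of "\<lambda>_. 0"] prob_space
    by (simp add: depends_only_on_def zero_ereal_def)
qed

section \<open>Cubes and translations\<close>

lemma shift_measurable [measurable]:
  "shift x \<in> (borel :: ('g::{ab_group_add,countable}) config measure) \<rightarrow>\<^sub>M borel"
  by (rule measurable_configI) (simp add: shift_def)

lemma shift_shift: "shift x (shift y \<sigma>) = shift (x + y) \<sigma>"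
  by (simp add: shift_def fun_eq_iff add.assoc)

lemma shift_0 [simp]: "shift 0 \<sigma> = \<sigma>"
  by (simp add: shift_def)

lemma shift_minus [simp]: "shift (- x) (shift x \<sigma>) = \<sigma>" "shift x (shift (- x) \<sigma>) = \<sigma>"
  by (simp_all add: shift_shift)

lemma integral_shift:
  fixes \<mu> :: "('g::{ab_group_add,countable}) config measure" and f :: "'g config \<Rightarrow> real"
  assumes "\<mu> \<in> config_measures" "translation_invariant \<mu>" "f \<in> borel_measurable borel"
  shows "(\<integral>\<sigma>. f (shift x \<sigma>) \<partial>\<mu>) = (\<integral>\<sigma>. f \<sigma> \<partial>\<mu>)"
proof -
  have m: "shift x \<in> \<mu> \<rightarrow>\<^sub>M borel"
    by (subst measurable_cong_sets[OF config_measuresD(2)[OF assms(1)] refl]) simp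
  have "(\<integral>\<sigma>. f \<sigma> \<partial>\<mu>) = (\<integral>\<sigma>. f \<sigma> \<partial>(distr \<mu> borel (shift x)))"
    using assms(2) by (simp add: translation_invariant_def)
  also have "\<dots> = (\<integral>\<sigma>. f (shift x \<sigma>) \<partial>\<mu>)"
    by (rule integral_distr[OF m assms(3)])
  finally show ?thesis by simp
qed

lemma vec_range_eq: "{x :: int^'d::finite. \<forall>i. x $ i \<in> S} = vec_lambda ` (UNIV \<rightarrow>\<^sub>E S)"
  by (auto simp: image_iff PiE_UNIV_domain intro!: bexI[where x="vec_nth _"])

lemma finite_cube [simp]: "finite (cube n :: (int^'d::finite) set)"
proof -
  have "cube n = {x :: int^'d. \<forall>i. x $ i \<in> {- int n..int n}}"
    by (auto simp: cube_def abs_le_iff) (metis minus_le_iff)+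
  then show ?thesis by (simp only: vec_range_eq) (simp add: finite_PiE)
qed

lemma card_cube: "card (cube n :: (int^'d::finite) set) = (2 * n + 1) ^ CARD('d)"
proof -
  have "cube n = {x :: int^'d. \<forall>i. x $ i \<in> {- int n..int n}}"
    by (auto simp: cube_def abs_le_iff) (metis minus_le_iff)+
  then have "card (cube n :: (int^'d) set) = card ((UNIV :: 'd set) \<rightarrow>\<^sub>E {- int n..int n})"
    by (simp only: vec_range_eq) (rule card_image, auto simp: inj_on_def)
  also have "\<dots> = (\<Prod>i\<in>(UNIV::'d set). card {- int n..int n})"
    by (rule card_PiE) simp
  also have "\<dots> = (2 * n + 1) ^ CARD('d)"
    by (simp add: nat_add_distrib nat_mult_distrib)
  finally show ?thesis .
qed

abbreviation cube_size :: "'d::finite itself \<Rightarrow> nat \<Rightarrow> real" where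
  "cube_size T n \<equiv> real (card (cube n :: (int^'d) set))"

lemma cube_size_pos: "cube_size TYPE('d::finite) n > 0"
  unfolding card_cube by (simp add: add_pos_nonneg)

lemma cube_mono: "m \<le> n \<Longrightarrow> cube m \<subseteq> cube n"
  unfolding cube_def by (auto intro: order_trans)

lemma cube_0 [simp]: "0 \<in> cube n"
  by (simp add: cube_def)

lemma cube_uminus: "x \<in> cube n \<Longrightarrow> - x \<in> cube n"
  by (simp add: cube_def)

lemma cube_add:
  assumes "x \<in> cube m" "y \<in> cube n"
  shows "x + y \<in> cube (m + n)"
proof -
  have "\<bar>x $ i + y $ i\<bar> \<le> int (m + n)" for i
    using assms abs_triangle_ineq[of "x $ i" "y $ i"]
    by (auto simp: cube_def) (metis (mono_tags, opaque_lifting) add_mono order_trans)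
  then show ?thesis by (simp add: cube_def)
qed

lemma finite_subset_cube:
  assumes "finite (A :: (int^'d::finite) set)"
  obtains k where "A \<subseteq> cube k"
proof -
  define k where "k = (\<Sum>x\<in>A. \<Sum>i\<in>UNIV. nat \<bar>x $ i\<bar>)"
  have "x \<in> cube k" if "x \<in> A" for x
  proof -
    have "nat \<bar>x $ i\<bar> \<le> k" for i
    proof -
      have "nat \<bar>x $ i\<bar> \<le> (\<Sum>i\<in>UNIV. nat \<bar>x $ i\<bar>)" by (rule member_le_sum) auto
      also have "\<dots> \<le> k" unfolding k_def
        by (rule member_le_sum[OF that, of "\<lambda>x. \<Sum>i\<in>UNIV. nat \<bar>x $ i\<bar>"]) (use assms in auto)
      finally show ?thesis .
    qed
    then have "\<bar>x $ i\<bar> \<le> int k" for i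
      by (metis abs_ge_zero nat_le_iff)
    then show ?thesis by (simp add: cube_def)
  qed
  then show ?thesis using that by blast
qed

text \<open>The ratio is a fixed power of 1 + 2m/(2n+1). Every later claim that a shell of fixed
  width is negligible against the volume comes from this limit.\<close>

lemma cube_size_ratio:
  "(\<lambda>n. cube_size TYPE('d::finite) (n + m) / cube_size TYPE('d) n) \<longlonglongrightarrow> 1"
proof -
  have z: "(\<lambda>n. 2 * real m * inverse (real (Suc n))) \<longlonglongrightarrow> 2 * real m * 0"
    by (intro tendsto_mult tendsto_const LIMSEQ_inverse_real_of_nat)
  have "(\<lambda>n. 2 * real m / (2 * real n + 1)) \<longlonglongrightarrow> 0"
    by (rule tendsto_sandwich[OF _ _ tendsto_const z[simplified]])
       (auto simp: divide_simps intro!: always_eventually mult_left_mono)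
  then have "(\<lambda>n. (1 + 2 * real m / (2 * real n + 1)) ^ CARD('d)) \<longlonglongrightarrow> (1 + 0) ^ CARD('d)"
    by (intro tendsto_power tendsto_add tendsto_const)
  moreover have "(1 + 2 * real m / (2 * real n + 1)) ^ CARD('d) =
      cube_size TYPE('d) (n + m) / cube_size TYPE('d) n" for n
  proof -
    have "1 + 2 * real m / (2 * real n + 1) = (2 * real (n + m) + 1) / (2 * real n + 1)"
      by (simp add: field_simps)
    then show ?thesis by (simp add: card_cube power_divide add.commute)
  qed
  ultimately show ?thesis by simp
qed

lemma cube_size_le_twice:
  "eventually (\<lambda>n. cube_size TYPE('d::finite) (n + m) \<le> 2 * cube_size TYPE('d) n) sequentially"
proof -
  have "eventually (\<lambda>n. cube_size TYPE('d) (n + m) / cube_size TYPE('d) n < 2) sequentially"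
    by (rule order_tendstoD[OF cube_size_ratio]) simp
  then show ?thesis
    by eventually_elim (use cube_size_pos[where 'd='d] in \<open>simp add: field_simps\<close>)
qed

section \<open>Gaussian concentration determines the measure\<close>

definition flip_bounded :: "real \<Rightarrow> ('g config \<Rightarrow> real) \<Rightarrow> bool" where
  "flip_bounded K g \<longleftrightarrow> (\<forall>x \<sigma>. \<bar>g (\<sigma>(x := \<not> \<sigma> x)) - g \<sigma>\<bar> \<le> K)"

text \<open>
  A consequence of vanishing lower relative entropy density which, unlike the latter, is easily
  seen to be inherited by \<open>\<nu>P\<close> and \<open>\<mu>P\<close> even when the rates have infinite range.
\<close>

definition variationally_close ::
    "(int^'d::finite) config measure \<Rightarrow> (int^'d) config measure \<Rightarrow> bool" where
  "variationally_close \<nu> \<mu> \<longleftrightarrow>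
     (\<forall>K>0. \<forall>d>0. \<exists>\<^sub>F N in sequentially. \<forall>g. depends_only_on (cube N) g \<and> flip_bounded K g \<longrightarrow>
        (\<integral>\<sigma>. g \<sigma> \<partial>\<nu>) \<le> ln (\<integral>\<sigma>. exp (g \<sigma>) \<partial>\<mu>) + d * cube_size TYPE('d) N)"

text \<open>A liminf at most 0 yields cubes with entropy below d per site, but only infinitely many
  of them; this is why the notion is stated with a frequently quantifier.\<close>

lemma variationally_closeI:
  fixes \<mu> \<nu> :: "(int^'d::finite) config measure"
  assumes \<mu>: "\<mu> \<in> config_measures" and \<nu>: "\<nu> \<in> config_measures"
    and s: "liminf (entropy_per_site \<nu> \<mu>) \<le> 0"
  shows "variationally_close \<nu> \<mu>"
  unfolding variationally_close_def
proof (intro allI impI)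
  fix K d :: real assume "d > 0"
  have "\<exists>\<^sub>F N in sequentially. entropy_per_site \<nu> \<mu> N < ereal d"
  proof (rule ccontr)
    assume "\<not> ?thesis"
    then have "ereal d \<le> liminf (entropy_per_site \<nu> \<mu>)"
      by (intro Liminf_bounded) (simp add: not_frequently not_less)
    with s \<open>d > 0\<close> show False by (metis ereal_less(2) less_le_trans not_le)
  qed
  then show "\<exists>\<^sub>F N in sequentially. \<forall>g. depends_only_on (cube N) g \<and> flip_bounded K g \<longrightarrow>
        (\<integral>\<sigma>. g \<sigma> \<partial>\<nu>) \<le> ln (\<integral>\<sigma>. exp (g \<sigma>) \<partial>\<mu>) + d * cube_size TYPE('d) N"
  proof (rule frequently_elim1, intro allI impI, elim conjE)
    fix N and g :: "(int^'d) config \<Rightarrow> real"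
    assume less: "entropy_per_site \<nu> \<mu> N < ereal d" and g: "depends_only_on (cube N) g"
    let ?s = "relative_entropy (cube N) \<nu> \<mu>"
    obtain a where a: "?s = ereal a"
      using less relative_entropy_nonneg[OF \<mu> \<nu> finite_cube, of N] cube_size_pos[where 'd='d, of N]
      by (cases ?s) (auto simp: entropy_per_site_def)
    have "(cube N :: (int^'d) set) \<noteq> {}" using cube_0 by blast
    with less have "a / cube_size TYPE('d) N < d"
      by (simp add: entropy_per_site_def a)
    then have "a \<le> d * cube_size TYPE('d) N"
      using cube_size_pos[where 'd='d, of N] by (simp add: field_simps)
    with variational_bound[OF \<mu> \<nu> finite_cube g] a
    show "(\<integral>\<sigma>. g \<sigma> \<partial>\<nu>) \<le> ln (\<integral>\<sigma>. exp (g \<sigma>) \<partial>\<mu>) + d * cube_size TYPE('d) N"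
      by simp
  qed
qed

lemma flip_boundedD: "flip_bounded K g \<Longrightarrow> \<bar>g (\<sigma>(x := \<not> \<sigma> x)) - g \<sigma>\<bar> \<le> K"
  by (simp add: flip_bounded_def)

lemma abs_oscillation_le:
  assumes "flip_bounded K g"
  shows "\<bar>oscillation x g\<bar> \<le> K"
proof -
  have b: "bdd_above (range (\<lambda>\<sigma>. g (\<sigma>(x := \<not> \<sigma> x)) - g \<sigma>))"
    using flip_boundedD[OF assms] by (intro bdd_aboveI2[of _ _ K]) (meson abs_le_D1)
  have "oscillation x g \<le> K" unfolding oscillation_def
    using flip_boundedD[OF assms] by (intro cSUP_least) (auto dest: abs_le_D1)
  moreover have "- K \<le> oscillation x g"
    unfolding oscillation_def
    by (intro cSUP_upper2[OF b UNIV_I, of _ "\<lambda>_. True"]) (use flip_boundedD[OF assms, of "\<lambda>_. True" x] in linarith)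
  ultimately show ?thesis by simp
qed

lemma infsum_oscillation_le:
  assumes "flip_bounded K g" "finite A" "depends_only_on A g"
  shows "(\<Sum>\<^sub>\<infinity>x. (oscillation x g)\<^sup>2) \<le> real (card A) * K\<^sup>2"
proof -
  have "oscillation x g = 0" if "x \<notin> A" for x
  proof -
    have "g (\<sigma>(x := \<not> \<sigma> x)) = g \<sigma>" for \<sigma>
      by (rule depends_only_onD[OF assms(3)]) (use that in auto)
    then show ?thesis by (simp add: oscillation_def)
  qed
  then have "(\<Sum>\<^sub>\<infinity>x. (oscillation x g)\<^sup>2) = (\<Sum>\<^sub>\<infinity>x\<in>A. (oscillation x g)\<^sup>2)"
    by (intro infsum_cong_neutral) auto
  also have "\<dots> = (\<Sum>x\<in>A. (oscillation x g)\<^sup>2)" using assms(2) by simp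
  also have "\<dots> \<le> (\<Sum>x\<in>A. K\<^sup>2)"
    by (intro sum_mono) (use abs_oscillation_le[OF assms(1)] in \<open>metis abs_ge_zero power2_abs power_mono\<close>)
  finally show ?thesis by simp
qed

lemma ln_integral_exp_centered:
  fixes \<mu> :: "('g::countable) config measure" and g :: "'g config \<Rightarrow> real"
  assumes \<mu>: "\<mu> \<in> config_measures" and "finite A" "depends_only_on A g"
  shows "ln (\<integral>\<sigma>. exp (g \<sigma> - c) \<partial>\<mu>) = ln (\<integral>\<sigma>. exp (g \<sigma>) \<partial>\<mu>) - c"
proof -
  interpret prob_space \<mu> by (rule config_measuresD[OF \<mu>])
  obtain B where B: "\<And>\<sigma>. \<bar>g \<sigma>\<bar> \<le> B" using local_bounded[OF assms(2,3)] by blast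
  have "(\<integral>\<sigma>. exp (- B) \<partial>\<mu>) \<le> (\<integral>\<sigma>. exp (g \<sigma>) \<partial>\<mu>)"
  proof (rule integral_mono)
    show "integrable \<mu> (\<lambda>\<sigma>. exp (g \<sigma>))"
      by (rule local_integrable[OF \<mu> assms(2)]) (use assms(3) in \<open>auto simp: depends_only_on_def\<close>)
    show "exp (- B) \<le> exp (g \<sigma>)" for \<sigma> using B[of \<sigma>] by simp
  qed simp
  then have "(\<integral>\<sigma>. exp (g \<sigma>) \<partial>\<mu>) > 0"
    using prob_space by simp (meson exp_gt_zero less_le_trans)
  then show ?thesis
    by (simp add: exp_diff ln_div)
qed

text \<open>A flip at x is felt by the translate along y only if x - y lies in A. So at most card A
  summands change, each by at most 2B, however large Y is.\<close>

lemma flip_bounded_sum_shifts: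
  fixes f :: "('g::ab_group_add) config \<Rightarrow> real"
  assumes "finite A" "depends_only_on A f" "\<And>\<sigma>. \<bar>f \<sigma>\<bar> \<le> B" "finite Y"
  shows "flip_bounded (2 * B * card A) (\<lambda>\<sigma>. \<Sum>y\<in>Y. f (shift y \<sigma>))"
  unfolding flip_bounded_def
proof (intro allI)
  fix x and \<sigma> :: "'g config"
  let ?\<sigma> = "\<sigma>(x := \<not> \<sigma> x)"
  have B0: "B \<ge> 0" using assms(3)[of \<sigma>] abs_ge_zero order_trans by blast
  have eq: "f (shift y ?\<sigma>) = f (shift y \<sigma>)" if "y \<notin> (\<lambda>a. x - a) ` A" for y
    by (rule depends_only_onD[OF assms(2)])
       (use that in \<open>auto simp: shift_def image_iff algebra_simps\<close>)
  have "\<bar>(\<Sum>y\<in>Y. f (shift y ?\<sigma>)) - (\<Sum>y\<in>Y. f (shift y \<sigma>))\<bar> = \<bar>\<Sum>y\<in>Y. f (shift y ?\<sigma>) - f (shift y \<sigma>)\<bar>"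
    by (simp add: sum_subtractf)
  also have "\<dots> = \<bar>\<Sum>y\<in>Y \<inter> (\<lambda>a. x - a) ` A. f (shift y ?\<sigma>) - f (shift y \<sigma>)\<bar>"
    by (subst sum.mono_neutral_right[of Y "Y \<inter> (\<lambda>a. x - a) ` A"]) (use assms(4) eq in auto)
  also have "\<dots> \<le> (\<Sum>y\<in>Y \<inter> (\<lambda>a. x - a) ` A. \<bar>f (shift y ?\<sigma>) - f (shift y \<sigma>)\<bar>)"
    by (rule sum_abs)
  also have "\<dots> \<le> (\<Sum>y\<in>Y \<inter> (\<lambda>a. x - a) ` A. 2 * B)"
  proof (rule sum_mono)
    fix y
    show "\<bar>f (shift y ?\<sigma>) - f (shift y \<sigma>)\<bar> \<le> 2 * B"
      using assms(3)[of "shift y ?\<sigma>"] assms(3)[of "shift y \<sigma>"] by linarith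
  qed
  also have "\<dots> = 2 * B * card (Y \<inter> (\<lambda>a. x - a) ` A)" by simp
  also have "\<dots> \<le> 2 * B * card A"
  proof -
    have "card (Y \<inter> (\<lambda>a. x - a) ` A) \<le> card ((\<lambda>a. x - a) ` A)"
      by (rule card_mono) (use assms in auto)
    also have "\<dots> \<le> card A" by (rule card_image_le[OF assms(1)])
    finally show ?thesis using B0 by (intro mult_left_mono) auto
  qed
  finally show "\<bar>(\<Sum>y\<in>Y. f (shift y ?\<sigma>)) - (\<Sum>y\<in>Y. f (shift y \<sigma>))\<bar> \<le> 2 * B * card A" .
qed

lemma GCB_integral_le:
  fixes \<mu> \<nu> :: "(int^'d::finite) config measure" and f :: "(int^'d) config \<Rightarrow> real"
  assumes \<mu>: "\<mu> \<in> config_measures" "translation_invariant \<mu>"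
    and \<nu>: "\<nu> \<in> config_measures" "translation_invariant \<nu>"
    and gcb: "GCB C \<mu>" "C \<ge> 0" and close: "variationally_close \<nu> \<mu>"
    and f: "finite A" "depends_only_on A f"
  shows "(\<integral>\<sigma>. f \<sigma> \<partial>\<nu>) \<le> (\<integral>\<sigma>. f \<sigma> \<partial>\<mu>)"
proof (rule ccontr)
  define t where "t = (\<integral>\<sigma>. f \<sigma> \<partial>\<nu>) - (\<integral>\<sigma>. f \<sigma> \<partial>\<mu>)"
  assume "\<not> ?thesis"
  then have t: "t > 0" unfolding t_def by linarith
  obtain B where B: "\<And>\<sigma>. \<bar>f \<sigma>\<bar> \<le> B" using local_bounded[OF f] by blast
  then have B0: "B \<ge> 0" by (meson abs_ge_zero order_trans)
  obtain k where k: "A \<subseteq> cube k" using finite_subset_cube[OF f(1)] by blast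
  define K where "K = 2 * B * card A"
  have K0: "K \<ge> 0" using B0 by (simp add: K_def)
  define l where "l = t / (2 * (C * K\<^sup>2 + 1))"
  have l: "l > 0" using t gcb(2) by (simp add: l_def add_nonneg_pos)
  have lCK: "l * (C * K\<^sup>2) \<le> t / 2"
  proof -
    have "l * (C * K\<^sup>2) \<le> l * (C * K\<^sup>2 + 1)" using l by simp
    also have "\<dots> = t / 2" unfolding l_def using gcb(2)
      by (simp add: divide_simps) (smt (verit) mult_nonneg_nonneg zero_le_power2)
    finally show ?thesis .
  qed
  \<comment> \<open>The outer volume is at most twice the inner one, so charge and entropy together
    cost at most 2 (l t / 4 + l t / 8) = 3 l t / 4 per inner site, strictly less than the
    gain.\<close>
  define d where "d = l * t / 8"
  have d: "d > 0" using l t by (simp add: d_def)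
  \<comment> \<open>The definition of \<open>variationally_close\<close> asks for a strictly
    positive flip bound, while K may vanish; hence the added 1.\<close>
  have "l * K + 1 > 0" using l K0 by (simp add: add_nonneg_pos)
  then have "\<exists>\<^sub>F N in sequentially. \<forall>g. depends_only_on (cube N) g \<and> flip_bounded (l * K + 1) g \<longrightarrow>
        (\<integral>\<sigma>. g \<sigma> \<partial>\<nu>) \<le> ln (\<integral>\<sigma>. exp (g \<sigma>) \<partial>\<mu>) + d * cube_size TYPE('d) N"
    using close d unfolding variationally_close_def by blast
  moreover have "eventually (\<lambda>N. N \<ge> k \<and> cube_size TYPE('d) N \<le> 2 * cube_size TYPE('d) (N - k)) sequentially"
  proof -
    have "eventually (\<lambda>N. cube_size TYPE('d) ((N - k) + k) \<le> 2 * cube_size TYPE('d) (N - k)) sequentially"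
      using cube_size_le_twice[where 'd='d and m=k]
      by (rule eventually_compose_filterlim) (rule filterlim_minus_const_nat_at_top)
    then show ?thesis using eventually_ge_at_top[of k] by eventually_elim auto
  qed
  ultimately have "\<exists>N. (\<forall>g. depends_only_on (cube N) g \<and> flip_bounded (l * K + 1) g \<longrightarrow>
        (\<integral>\<sigma>. g \<sigma> \<partial>\<nu>) \<le> ln (\<integral>\<sigma>. exp (g \<sigma>) \<partial>\<mu>) + d * cube_size TYPE('d) N) \<and>
        N \<ge> k \<and> cube_size TYPE('d) N \<le> 2 * cube_size TYPE('d) (N - k)"
    by (rule frequently_ex[OF frequently_eventually_frequently])
  then obtain N where "N \<ge> k \<and> cube_size TYPE('d) N \<le> 2 * cube_size TYPE('d) (N - k)"
      "\<forall>g. depends_only_on (cube N) g \<and> flip_bounded (l * K + 1) g \<longrightarrow>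
        (\<integral>\<sigma>. g \<sigma> \<partial>\<nu>) \<le> ln (\<integral>\<sigma>. exp (g \<sigma>) \<partial>\<mu>) + d * cube_size TYPE('d) N"
    by blast
  then have N: "N \<ge> k" "cube_size TYPE('d) N \<le> 2 * cube_size TYPE('d) (N - k)"
      "\<And>g. depends_only_on (cube N) g \<Longrightarrow> flip_bounded (l * K + 1) g \<Longrightarrow>
        (\<integral>\<sigma>. g \<sigma> \<partial>\<nu>) \<le> ln (\<integral>\<sigma>. exp (g \<sigma>) \<partial>\<mu>) + d * cube_size TYPE('d) N"
    by blast+
  \<comment> \<open>Translates of \<open>f\<close> along the inner cube of radius N - k still depend
    on spins of the cube of radius N only, because A lies in \<open>cube k\<close>.\<close>
  define n where "n = N - k"
  let ?c = "cube_size TYPE('d) n" and ?cN = "cube_size TYPE('d) N"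
  define F where "F \<sigma> = (\<Sum>y\<in>cube n. f (shift y \<sigma>))" for \<sigma>
  define g where "g \<sigma> = l * F \<sigma>" for \<sigma>
  have depf: "depends_only_on (cube N) (\<lambda>\<sigma>. f (shift y \<sigma>))" if "y \<in> cube n" for y
    unfolding depends_only_on_def
  proof (intro allI impI)
    fix \<sigma> \<sigma>' :: "(int^'d) config" assume eq: "\<forall>x\<in>cube N. \<sigma> x = \<sigma>' x"
    show "f (shift y \<sigma>) = f (shift y \<sigma>')"
    proof (rule depends_only_onD[OF f(2)])
      fix x assume "x \<in> A"
      then have "x + y \<in> cube N" using cube_add[of x k y n] that k N(1) by (auto simp: n_def)
      then show "shift y \<sigma> x = shift y \<sigma>' x" using eq by (simp add: shift_def)
    qed
  qed
  have depF: "depends_only_on (cube N) F"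
    unfolding depends_only_on_def F_def
    by (intro allI impI sum.cong refl) (use depf in \<open>auto simp: depends_only_on_def\<close>)
  then have depg: "depends_only_on (cube N) g"
    unfolding depends_only_on_def g_def by metis
  have "flip_bounded K F"
    unfolding F_def K_def by (rule flip_bounded_sum_shifts[OF f B]) simp
  then have fg: "flip_bounded (l * K) g"
    unfolding flip_bounded_def g_def using l
    by (simp add: right_diff_distrib[symmetric] abs_mult)
  then have fg': "flip_bounded (l * K + 1) g"
    unfolding flip_bounded_def by (meson add_increasing2 order_trans zero_le_one order_refl)
  have int: "(\<integral>\<sigma>. g \<sigma> \<partial>\<rho>) = l * (?c * (\<integral>\<sigma>. f \<sigma> \<partial>\<rho>))"
    if \<rho>: "\<rho> \<in> config_measures" "translation_invariant \<rho>" for \<rho>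
  proof -
    have "(\<integral>\<sigma>. F \<sigma> \<partial>\<rho>) = (\<Sum>y\<in>cube n. \<integral>\<sigma>. f (shift y \<sigma>) \<partial>\<rho>)"
      unfolding F_def
      by (intro Bochner_Integration.integral_sum local_integrable[OF \<rho>(1) finite_cube depf])
    also have "\<dots> = ?c * (\<integral>\<sigma>. f \<sigma> \<partial>\<rho>)"
      by (simp add: integral_shift[OF \<rho> local_measurable[OF f]])
    finally show ?thesis by (simp add: g_def)
  qed
  have "ln (\<integral>\<sigma>. exp (g \<sigma> - (\<integral>\<sigma>. g \<sigma> \<partial>\<mu>)) \<partial>\<mu>) \<le> C / 2 * (\<Sum>\<^sub>\<infinity>x. (oscillation x g)\<^sup>2)"
    using gcb(1) depg unfolding GCB_def local_function_def by (meson finite_cube)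
  also have "\<dots> \<le> C / 2 * (?cN * (l * K)\<^sup>2)"
    by (intro mult_left_mono infsum_oscillation_le[OF fg finite_cube depg]) (use gcb(2) in auto)
  finally have "ln (\<integral>\<sigma>. exp (g \<sigma>) \<partial>\<mu>) \<le> (\<integral>\<sigma>. g \<sigma> \<partial>\<mu>) + C / 2 * (?cN * (l * K)\<^sup>2)"
    using ln_integral_exp_centered[OF \<mu>(1) finite_cube depg] by simp
  with N(3)[OF depg fg'] have "l * ?c * t \<le> C / 2 * (?cN * (l * K)\<^sup>2) + d * ?cN"
    unfolding int[OF \<mu>] int[OF \<nu>] t_def by (simp add: algebra_simps)
  also have "\<dots> = (l * (l * (C * K\<^sup>2)) / 2 + d) * ?cN"
    by (simp add: power2_eq_square algebra_simps)
  also have "\<dots> \<le> (l * (t / 2) / 2 + d) * ?cN"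
    using lCK l by (intro mult_right_mono add_mono divide_right_mono mult_left_mono) auto
  also have "\<dots> \<le> (l * (t / 2) / 2 + d) * (2 * ?c)"
    using N(2) l t d by (intro mult_left_mono) (auto simp: n_def)
  also have "\<dots> = l * ?c * t * (3 / 4)" by (simp add: d_def field_simps)
  finally have "l * ?c * t \<le> 0" by (simp add: algebra_simps)
  moreover have "l * ?c * t > 0" using l t cube_size_pos[where 'd='d, of n] by simp
  ultimately show False by simp
qed

theorem GCB_unique:
  fixes \<mu> \<nu> :: "(int^'d::finite) config measure"
  assumes \<mu>: "\<mu> \<in> config_measures" "translation_invariant \<mu>"
    and \<nu>: "\<nu> \<in> config_measures" "translation_invariant \<nu>"
    and gcb: "GCB C \<mu>" "C \<ge> 0" and close: "variationally_close \<nu> \<mu>"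
  shows "\<nu> = \<mu>"
proof (rule config_measure_eqI[OF \<nu>(1) \<mu>(1)])
  fix A and f :: "(int^'d) config \<Rightarrow> real"
  assume f: "finite A" "depends_only_on A f"
  then have f': "depends_only_on A (\<lambda>\<sigma>. - f \<sigma>)" by (simp add: depends_only_on_def)
  from GCB_integral_le[OF \<mu> \<nu> gcb close f] GCB_integral_le[OF \<mu> \<nu> gcb close f(1) f']
  show "(\<integral>\<sigma>. f \<sigma> \<partial>\<nu>) = (\<integral>\<sigma>. f \<sigma> \<partial>\<mu>)" by simp
qed

section \<open>Transition probabilities of the automaton\<close>

definition site_prob :: "('g::ab_group_add set \<Rightarrow> real) \<Rightarrow> 'g \<Rightarrow> bool \<Rightarrow> 'g config \<Rightarrow> real" where
  "site_prob r x b \<eta> = (1 + spin b * local_field r x \<eta>) / 2"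

definition pattern_prob ::
    "('g::ab_group_add set \<Rightarrow> real) \<Rightarrow> 'g set \<Rightarrow> 'g config \<Rightarrow> 'g config \<Rightarrow> real" where
  "pattern_prob r W s \<eta> = (\<Prod>y\<in>W. site_prob r y (s y) \<eta>)"

lemma summable_tail:
  fixes f :: "'a \<Rightarrow> real"
  assumes "f summable_on A" "\<And>x. x \<in> A \<Longrightarrow> f x \<ge> 0" "e > 0"
  obtains F where "finite F" "F \<subseteq> A" "infsum f (A - F) \<le> e"
proof -
  obtain F where F: "finite F" "F \<subseteq> A" "dist (sum f F) (infsum f A) \<le> e"
    using infsum_finite_approximation[OF assms(1,3)] by blast
  have "infsum f A = infsum f (F \<union> (A - F))" using F(2) by (simp add: Un_absorb1)
  also have "\<dots> = sum f F + infsum f (A - F)"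
    using F(1) summable_on_subset_banach[OF assms(1)]
    by (subst infsum_Un_disjoint) auto
  finally have "infsum f (A - F) \<le> e" using F(3) by (simp add: dist_real_def)
  then show ?thesis using F that by blast
qed

text \<open>The sums cancel off B, and on B each is dominated by b, which gives the factor 2. Serves
  both the local field and the Hamiltonian, whose terms far from an agreement region are controlled
  only in norm.\<close>

lemma abs_infsum_diff_le:
  fixes f g b :: "'a \<Rightarrow> real"
  assumes b: "b summable_on A" and f: "\<And>x. x \<in> A \<Longrightarrow> \<bar>f x\<bar> \<le> b x" and g: "\<And>x. x \<in> A \<Longrightarrow> \<bar>g x\<bar> \<le> b x"
    and B: "B \<subseteq> A" and eq: "\<And>x. x \<in> A - B \<Longrightarrow> f x = g x"
  shows "\<bar>infsum f A - infsum g A\<bar> \<le> 2 * infsum b B"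
proof -
  have sub: "b summable_on B" "b summable_on (A - B)"
    using summable_on_subset_banach[OF b] B by auto
  have abs: "(\<lambda>x. norm (h x)) summable_on C" if "C \<subseteq> A" "\<And>x. x \<in> A \<Longrightarrow> \<bar>h x\<bar> \<le> b x" for h C
    by (rule Infinite_Sum.abs_summable_on_comparison_test'[OF summable_on_subset_banach[OF b that(1)]])
       (use that in auto)
  have split: "infsum h A = infsum h B + infsum h (A - B)" if "\<And>x. x \<in> A \<Longrightarrow> \<bar>h x\<bar> \<le> b x" for h
  proof -
    have "A = B \<union> (A - B)" using B by auto
    then have "infsum h A = infsum h (B \<union> (A - B))" by simp
    also have "\<dots> = infsum h B + infsum h (A - B)"
    proof (rule infsum_Un_disjoint)
      show "h summable_on B"
        by (rule abs_summable_summable, rule abs[OF B]) (rule that)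
      show "h summable_on (A - B)"
        by (rule abs_summable_summable, rule abs[OF Diff_subset]) (rule that)
    qed auto
    finally show ?thesis .
  qed
  have bd: "\<bar>infsum h B\<bar> \<le> infsum b B" if "\<And>x. x \<in> A \<Longrightarrow> \<bar>h x\<bar> \<le> b x" for h
  proof -
    have "norm (infsum h B) \<le> infsum (\<lambda>x. norm (h x)) B"
      by (rule norm_infsum_bound, rule abs[OF B]) (rule that)
    also have "\<dots> \<le> infsum b B"
    proof (rule infsum_mono[OF _ sub(1)])
      show "(\<lambda>x. norm (h x)) summable_on B" by (rule abs[OF B]) (rule that)
    qed (use that B in auto)
    finally show ?thesis by simp
  qed
  have "infsum f (A - B) = infsum g (A - B)" by (rule infsum_cong) (use eq in auto)
  then show ?thesis using split[of f, OF f] split[of g, OF g] bd[of f, OF f] bd[of g, OF g] by linarith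
qed

lemma abs_spin_prod [simp]: "\<bar>\<Prod>y\<in>A. spin (\<eta> y)\<bar> = 1"
  by (simp add: abs_prod spin_def) (rule prod.neutral, auto)

text \<open>Finitely many sets A carry all but e/2 of the sum of |r_A|, and their union is the
  window. The window is relative to x, so the modulus is uniform over the lattice.\<close>

lemma local_field_modulus:
  fixes r :: "('g::ab_group_add) set \<Rightarrow> real"
  assumes r: "pca_coefficients r" and e: "e > 0"
  obtains D where "finite D"
    "\<And>x \<eta> \<eta>'. (\<And>a. a \<in> D \<Longrightarrow> \<eta> (a + x) = \<eta>' (a + x)) \<Longrightarrow> \<bar>local_field r x \<eta> - local_field r x \<eta>'\<bar> \<le> e"
proof -
  have sm: "(\<lambda>A. \<bar>r A\<bar>) summable_on {A. finite A}" using r by (simp add: pca_coefficients_def)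
  obtain F where F: "finite F" "F \<subseteq> {A. finite A}" "infsum (\<lambda>A. \<bar>r A\<bar>) ({A. finite A} - F) \<le> e / 2"
    using summable_tail[OF sm, of "e/2"] e by auto
  show ?thesis
  proof (rule that[of "\<Union>F"])
    show "finite (\<Union>F)" using F by auto
    fix x and \<eta> \<eta>' :: "'g config"
    assume eq: "\<And>a. a \<in> \<Union>F \<Longrightarrow> \<eta> (a + x) = \<eta>' (a + x)"
    have "\<bar>local_field r x \<eta> - local_field r x \<eta>'\<bar> \<le> 2 * infsum (\<lambda>A. \<bar>r A\<bar>) ({A. finite A} - F)"
      unfolding local_field_def
    proof (rule abs_infsum_diff_le[OF sm])
      fix A assume "A \<in> {A. finite A} - ({A. finite A} - F)"
      then have "A \<in> F" by auto
      then have "spin (\<eta> y) = spin (\<eta>' y)" if "y \<in> translate x A" for y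
      proof -
        from that obtain a where "a \<in> A" "y = a + x" by (auto simp: translate_def)
        moreover have "\<eta> (a + x) = \<eta>' (a + x)" by (rule eq) (use \<open>a \<in> A\<close> \<open>A \<in> F\<close> in blast)
        ultimately show ?thesis by simp
      qed
      then show "r A * (\<Prod>y\<in>translate x A. spin (\<eta> y)) = r A * (\<Prod>y\<in>translate x A. spin (\<eta>' y))"
        by simp
    qed (auto simp: abs_mult)
    then show "\<bar>local_field r x \<eta> - local_field r x \<eta>'\<bar> \<le> e" using F(3) by simp
  qed
qed

lemma site_prob_modulus:
  fixes r :: "('g::ab_group_add) set \<Rightarrow> real"
  assumes r: "pca_coefficients r" and e: "e > 0"
  obtains D where "finite D"
    "\<And>x b \<eta> \<eta>'. (\<And>a. a \<in> D \<Longrightarrow> \<eta> (a + x) = \<eta>' (a + x)) \<Longrightarrow> \<bar>site_prob r x b \<eta> - site_prob r x b \<eta>'\<bar> \<le> e"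
proof -
  obtain D where D: "finite D"
    "\<And>x \<eta> \<eta>'. (\<And>a. a \<in> D \<Longrightarrow> \<eta> (a + x) = \<eta>' (a + x)) \<Longrightarrow> \<bar>local_field r x \<eta> - local_field r x \<eta>'\<bar> \<le> e"
    using local_field_modulus[OF assms] by metis
  have "\<bar>site_prob r x b \<eta> - site_prob r x b \<eta>'\<bar> \<le> e"
    if "\<And>a. a \<in> D \<Longrightarrow> \<eta> (a + x) = \<eta>' (a + x)" for x b \<eta> \<eta>'
  proof -
    have "\<bar>local_field r x \<eta> - local_field r x \<eta>'\<bar> \<le> e" by (rule D(2)) (rule that)
    then show ?thesis using e by (auto simp: site_prob_def spin_def field_simps abs_le_iff)
  qed
  with D(1) show thesis by (rule that)
qed

lemma site_prob_cube_modulus: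
  fixes r :: "(int^'d::finite) set \<Rightarrow> real"
  assumes r: "pca_coefficients r" and e: "e > 0"
  obtains m where
    "\<And>x b \<eta> \<eta>'. (\<And>a. a \<in> cube m \<Longrightarrow> \<eta> (a + x) = \<eta>' (a + x)) \<Longrightarrow> \<bar>site_prob r x b \<eta> - site_prob r x b \<eta>'\<bar> \<le> e"
proof -
  obtain D where D: "finite D"
    "\<And>x b \<eta> \<eta>'. (\<And>a. a \<in> D \<Longrightarrow> \<eta> (a + x) = \<eta>' (a + x)) \<Longrightarrow> \<bar>site_prob r x b \<eta> - site_prob r x b \<eta>'\<bar> \<le> e"
    using site_prob_modulus[OF assms] by metis
  obtain m where "D \<subseteq> cube m" using finite_subset_cube[OF D(1)] by blast
  then have "\<bar>site_prob r x b \<eta> - site_prob r x b \<eta>'\<bar> \<le> e"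
    if "\<And>a. a \<in> cube m \<Longrightarrow> \<eta> (a + x) = \<eta>' (a + x)" for x b \<eta> \<eta>'
    by (intro D(2) that) auto
  then show thesis by (rule that)
qed

lemma local_field_bounds:
  assumes "pca_coefficients r"
  shows "\<bar>local_field r x \<eta>\<bar> \<le> 1"
  using assms by (simp add: pca_coefficients_def)

lemma site_prob_nonneg: "pca_coefficients r \<Longrightarrow> 0 \<le> site_prob r x b \<eta>"
  using local_field_bounds[of r x \<eta>] by (auto simp: site_prob_def spin_def abs_le_iff)

lemma site_prob_le_1: "pca_coefficients r \<Longrightarrow> site_prob r x b \<eta> \<le> 1"
  using local_field_bounds[of r x \<eta>] by (auto simp: site_prob_def spin_def abs_le_iff)

lemma site_prob_total: "site_prob r x True \<eta> + site_prob r x False \<eta> = 1"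
  by (simp add: site_prob_def spin_def field_simps)

lemma pattern_prob_nonneg: "pca_coefficients r \<Longrightarrow> 0 \<le> pattern_prob r W s \<eta>"
  unfolding pattern_prob_def by (intro prod_nonneg) (simp add: site_prob_nonneg)

lemma pattern_prob_le_1: "pca_coefficients r \<Longrightarrow> pattern_prob r W s \<eta> \<le> 1"
  unfolding pattern_prob_def by (intro prod_le_1) (simp add: site_prob_nonneg site_prob_le_1)

lemma pattern_prob_union:
  "finite A \<Longrightarrow> finite B \<Longrightarrow> A \<inter> B = {} \<Longrightarrow>
    pattern_prob r (A \<union> B) s \<eta> = pattern_prob r A s \<eta> * pattern_prob r B s \<eta>"
  unfolding pattern_prob_def by (rule prod.union_disjoint)

lemma translate_iff: "y \<in> translate x A \<longleftrightarrow> y - x \<in> A"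
  by (auto simp: translate_def intro!: image_eqI[of _ _ "y - x"])

lemma finite_translate [simp]: "finite A \<Longrightarrow> finite (translate x A)"
  by (simp add: translate_def)

lemma inj_on_translate: "inj_on (\<lambda>a::'g::ab_group_add. a + x) A"
  by (simp add: inj_on_def)

lemma local_field_shift: "local_field r (x + z) \<eta> = local_field r x (shift z \<eta>)"
  by (simp add: local_field_def translate_def prod.reindex inj_on_translate shift_def add.assoc)

lemma site_prob_shift: "site_prob r (x + z) b \<eta> = site_prob r x b (shift z \<eta>)"
  by (simp add: site_prob_def local_field_shift)

lemma pattern_prob_translate:
  "pattern_prob r (translate z W) s \<eta> = pattern_prob r W (shift z s) (shift z \<eta>)"
  by (simp add: pattern_prob_def translate_def prod.reindex inj_on_translate site_prob_shift shift_def)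

lemma site_prob_quasilocal:
  assumes "pca_coefficients r"
  shows "quasilocal (site_prob r x b)"
  unfolding quasilocal_def
proof (intro allI impI)
  fix e :: real assume "e > 0"
  then obtain D where D: "finite D"
    "\<And>x b \<eta> \<eta>'. (\<And>a. a \<in> D \<Longrightarrow> \<eta> (a + x) = \<eta>' (a + x)) \<Longrightarrow> \<bar>site_prob r x b \<eta> - site_prob r x b \<eta>'\<bar> \<le> e"
    using site_prob_modulus[OF assms] by metis
  have "\<bar>site_prob r x b \<sigma> - site_prob r x b \<sigma>'\<bar> \<le> e" if "\<forall>x\<in>translate x D. \<sigma> x = \<sigma>' x" for \<sigma> \<sigma>'
    by (rule D(2)) (use that in \<open>auto simp: translate_def\<close>)
  then show "\<exists>A. finite A \<and> (\<forall>\<sigma> \<sigma>'. (\<forall>x\<in>A. \<sigma> x = \<sigma>' x) \<longrightarrow> \<bar>site_prob r x b \<sigma> - site_prob r x b \<sigma>'\<bar> \<le> e)"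
    using D(1) by (intro exI[of _ "translate x D"]) auto
qed

lemma site_prob_measurable:
  fixes r :: "('g::{ab_group_add,countable}) set \<Rightarrow> real"
  shows "pca_coefficients r \<Longrightarrow> site_prob r x b \<in> borel_measurable borel"
  by (intro quasilocal_measurable site_prob_quasilocal)

lemma pattern_prob_measurable:
  fixes r :: "('g::{ab_group_add,countable}) set \<Rightarrow> real"
  assumes "pca_coefficients r"
  shows "pattern_prob r W s \<in> borel_measurable borel"
  unfolding pattern_prob_def[abs_def]
  by (intro borel_measurable_prod site_prob_measurable assms)

section \<open>The kernel and its action on measures\<close>

lemma config_measures_eq: "config_measures = space (prob_algebra borel)"
  by (auto simp: config_measures_def space_prob_algebra)

lemma prod_emb_config:
  "prod_emb UNIV (\<lambda>_. count_space UNIV) J (Pi\<^sub>E J E) = {\<sigma>. \<forall>x\<in>J. \<sigma> x \<in> E x}"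
  by (auto simp: prod_emb_def PiE_iff)

lemma bernoulli_site_prob:
  assumes "pca_coefficients r"
  shows "pmf (bernoulli_pmf ((1 + local_field r x \<eta>) / 2)) b = site_prob r x b \<eta>"
  using local_field_bounds[OF assms, of x \<eta>]
  by (cases b) (auto simp: site_prob_def spin_def abs_le_iff field_simps)

lemma emeasure_pca_kernel:
  assumes "pca_coefficients r" "finite J"
  shows "emeasure (pca_kernel r \<eta>) {\<sigma>. \<forall>x\<in>J. \<sigma> x \<in> E x} = (\<Prod>x\<in>J. ennreal (\<Sum>b\<in>E x. site_prob r x b \<eta>))"
proof -
  have "emeasure (pca_kernel r \<eta>) {\<sigma>. \<forall>x\<in>J. \<sigma> x \<in> E x} =
      emeasure (pca_kernel r \<eta>) (prod_emb UNIV (\<lambda>x. measure_pmf (bernoulli_pmf ((1 + local_field r x \<eta>) / 2))) J (Pi\<^sub>E J E))"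
    by (rule arg_cong2[where f=emeasure]) (auto simp: prod_emb_def PiE_iff)
  also have "\<dots> = (\<Prod>x\<in>J. emeasure (measure_pmf (bernoulli_pmf ((1 + local_field r x \<eta>) / 2))) (E x))"
    unfolding pca_kernel_def
    by (rule emeasure_PiM_emb) (use assms(2) in \<open>auto intro: measure_pmf.prob_space_axioms\<close>)
  also have "\<dots> = (\<Prod>x\<in>J. ennreal (\<Sum>b\<in>E x. site_prob r x b \<eta>))"
    by (intro prod.cong refl)
       (simp add: emeasure_measure_pmf_finite finite_subset[OF subset_UNIV] bernoulli_site_prob[OF assms(1)])
  finally show ?thesis .
qed

lemma sets_pca_kernel:
  fixes r :: "('g::{ab_group_add,countable}) set \<Rightarrow> real"
  shows "sets (pca_kernel r \<eta>) = sets borel"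
  unfolding pca_kernel_def sets_borel_config by (rule sets_PiM_cong) auto

lemma pca_kernel_config:
  fixes r :: "('g::{ab_group_add,countable}) set \<Rightarrow> real"
  shows "pca_kernel r \<eta> \<in> config_measures"
proof -
  have "prob_space (pca_kernel r \<eta>)"
    unfolding pca_kernel_def by (intro prob_space_PiM measure_pmf.prob_space_axioms)
  then show ?thesis by (simp add: config_measures_def sets_pca_kernel)
qed

lemma measure_pca_kernel_cylinder:
  fixes r :: "('g::{ab_group_add,countable}) set \<Rightarrow> real"
  assumes "pca_coefficients r" "finite W"
  shows "measure (pca_kernel r \<eta>) (cylinder W s) = pattern_prob r W s \<eta>"
proof -
  interpret prob_space "pca_kernel r \<eta>" by (rule config_measuresD[OF pca_kernel_config])
  have "emeasure (pca_kernel r \<eta>) (cylinder W s) = ennreal (pattern_prob r W s \<eta>)"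
    using emeasure_pca_kernel[OF assms, of \<eta> "\<lambda>x. {s x}"]
    by (simp add: cylinder_def pattern_prob_def prod_ennreal site_prob_nonneg[OF assms(1)])
  then show ?thesis
    by (simp add: emeasure_eq_measure pattern_prob_nonneg[OF assms(1)])
qed

text \<open>It is enough to check product cylinders, whose probabilities are finite products of sums
  of quasilocal functions.\<close>

lemma pca_kernel_measurable:
  fixes r :: "('g::{ab_group_add,countable}) set \<Rightarrow> real"
  assumes r: "pca_coefficients r"
  shows "pca_kernel r \<in> borel \<rightarrow>\<^sub>M prob_algebra borel"
proof (rule measurable_prob_algebra_generated[OF _ Int_stable_prod_algebra prod_algebra_sets_into_space])
  show "sets (borel :: 'g config measure) =
      sigma_sets (\<Pi>\<^sub>E i\<in>UNIV. space (count_space UNIV)) (prod_algebra UNIV (\<lambda>_. count_space UNIV))"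
    unfolding sets_borel_config by (rule sets_PiM)
  show "prob_space (pca_kernel r \<eta>)" for \<eta> by (rule config_measuresD[OF pca_kernel_config])
  show "sets (pca_kernel r \<eta>) = sets borel" for \<eta> by (rule sets_pca_kernel)
  fix A :: "'g config set" assume "A \<in> prod_algebra UNIV (\<lambda>_. count_space UNIV)"
  then obtain J E where A: "A = prod_emb UNIV (\<lambda>_. count_space UNIV) J (\<Pi>\<^sub>E j\<in>J. E j)" and J: "finite J"
    by (rule prod_algebraE) auto
  have "(\<lambda>\<eta>. \<Prod>x\<in>J. ennreal (\<Sum>b\<in>E x. site_prob r x b \<eta>)) \<in> borel_measurable borel"
    by (intro borel_measurable_prod_ennreal measurable_compose[OF _ measurable_ennreal] borel_measurable_sum
        site_prob_measurable r)
  then show "(\<lambda>\<eta>. emeasure (pca_kernel r \<eta>) A) \<in> borel_measurable borel"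
    unfolding A prod_emb_config emeasure_pca_kernel[OF r J] .
qed

lemma pca_step_config:
  fixes r :: "('g::{ab_group_add,countable}) set \<Rightarrow> real"
  assumes "pca_coefficients r" "\<mu> \<in> config_measures"
  shows "pca_step r \<mu> \<in> config_measures"
  using prob_space_bind'[OF _ pca_kernel_measurable[OF assms(1)], of \<mu>]
    sets_bind'[OF _ pca_kernel_measurable[OF assms(1)], of \<mu>] assms(2)
  unfolding config_measures_eq pca_step_def by (simp add: space_prob_algebra)

lemma measure_pca_step_cylinder:
  fixes r :: "('g::{ab_group_add,countable}) set \<Rightarrow> real"
  assumes r: "pca_coefficients r" and \<mu>: "\<mu> \<in> config_measures" and W: "finite W"
  shows "measure (pca_step r \<mu>) (cylinder W s) = (\<integral>\<eta>. pattern_prob r W s \<eta> \<partial>\<mu>)"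
proof -
  interpret k: prob_space "pca_kernel r \<eta>" for \<eta> by (rule config_measuresD[OF pca_kernel_config])
  interpret p: prob_space "pca_step r \<mu>" by (rule config_measuresD[OF pca_step_config[OF r \<mu>]])
  have "emeasure (pca_step r \<mu>) (cylinder W s) = (\<integral>\<^sup>+\<eta>. emeasure (pca_kernel r \<eta>) (cylinder W s) \<partial>\<mu>)"
    unfolding pca_step_def
    by (rule emeasure_bind_prob_algebra[OF _ pca_kernel_measurable[OF r]]) (use \<mu> W in \<open>auto simp: config_measures_eq\<close>)
  also have "\<dots> = (\<integral>\<^sup>+\<eta>. ennreal (pattern_prob r W s \<eta>) \<partial>\<mu>)"
    by (simp add: k.emeasure_eq_measure measure_pca_kernel_cylinder[OF r W])
  also have "\<dots> = ennreal (\<integral>\<eta>. pattern_prob r W s \<eta> \<partial>\<mu>)"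
    using pattern_prob_le_1[OF r] pattern_prob_nonneg[OF r]
    by (intro nn_integral_eq_integral bounded_integrable[OF \<mu> pattern_prob_measurable[OF r], of _ _ 1]) auto
  finally show ?thesis
    using pattern_prob_nonneg[OF r] by (simp add: p.emeasure_eq_measure Bochner_Integration.integral_nonneg)
qed

lemma pattern_prob_integrable:
  fixes r :: "('g::{ab_group_add,countable}) set \<Rightarrow> real"
  assumes r: "pca_coefficients r" and \<mu>: "\<mu> \<in> config_measures"
  shows "integrable \<mu> (pattern_prob r W s)"
  using pattern_prob_le_1[OF r] pattern_prob_nonneg[OF r]
  by (intro bounded_integrable[OF \<mu> pattern_prob_measurable[OF r], of _ _ 1]) auto

lemma integral_pca_step:
  fixes r :: "('g::{ab_group_add,countable}) set \<Rightarrow> real"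
  assumes r: "pca_coefficients r" and \<mu>: "\<mu> \<in> config_measures" and W: "finite W" and f: "depends_only_on W f"
  shows "(\<integral>\<sigma>. f \<sigma> \<partial>pca_step r \<mu>) = (\<integral>\<eta>. (\<Sum>s\<in>W \<rightarrow>\<^sub>E UNIV. pattern_prob r W s \<eta> * f s) \<partial>\<mu>)"
proof -
  have "(\<integral>\<eta>. (\<Sum>s\<in>W \<rightarrow>\<^sub>E UNIV. pattern_prob r W s \<eta> * f s) \<partial>\<mu>) =
      (\<Sum>s\<in>W \<rightarrow>\<^sub>E UNIV. (\<integral>\<eta>. pattern_prob r W s \<eta> \<partial>\<mu>) * f s)"
    by (simp add: Bochner_Integration.integral_sum pattern_prob_integrable[OF r \<mu>])
  then show ?thesis
    by (simp add: integral_local[OF pca_step_config[OF r \<mu>] W f] measure_pca_step_cylinder[OF r \<mu> W])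
qed

lemma sum_pattern_prob:
  fixes r :: "('g::{ab_group_add,countable}) set \<Rightarrow> real"
  assumes r: "pca_coefficients r" and W: "finite W"
  shows "(\<Sum>s\<in>W \<rightarrow>\<^sub>E UNIV. pattern_prob r W s \<eta>) = 1"
  using sum_cylinder_measure[OF pca_kernel_config W, of r \<eta>] by (simp add: measure_pca_kernel_cylinder[OF r W])

text \<open>Both sides are the integral of \<open>f\<close> against
  \<open>pca_kernel r \<eta>\<close>, expanded over two different windows.\<close>

lemma pattern_prob_marginal:
  fixes r :: "('g::{ab_group_add,countable}) set \<Rightarrow> real" and f :: "'g config \<Rightarrow> real"
  assumes r: "pca_coefficients r" and W: "finite W" and V: "V \<subseteq> W" and f: "depends_only_on V f"
  shows "(\<Sum>s\<in>W \<rightarrow>\<^sub>E UNIV. pattern_prob r W s \<eta> * f s) = (\<Sum>s\<in>V \<rightarrow>\<^sub>E UNIV. pattern_prob r V s \<eta> * f s)"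
  using integral_local[OF pca_kernel_config W depends_only_on_mono[OF f V], of r \<eta>]
    integral_local[OF pca_kernel_config finite_subset[OF V W] f, of r \<eta>]
  by (simp add: measure_pca_kernel_cylinder[OF r W] measure_pca_kernel_cylinder[OF r finite_subset[OF V W]])

lemma config_measure_eqI_cylinder:
  fixes \<mu> \<nu> :: "('g::countable) config measure"
  assumes "\<mu> \<in> config_measures" "\<nu> \<in> config_measures"
    and "\<And>A \<xi>. finite A \<Longrightarrow> measure \<mu> (cylinder A \<xi>) = measure \<nu> (cylinder A \<xi>)"
  shows "\<mu> = \<nu>"
  by (rule config_measure_eqI[OF assms(1,2)]) (simp add: integral_local assms)

lemma shift_in_cylinder: "shift z \<sigma> \<in> cylinder A \<xi> \<longleftrightarrow> \<sigma> \<in> cylinder (translate z A) (shift (- z) \<xi>)"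
  by (auto simp: in_cylinder_iff shift_def translate_def)

lemma pca_step_translation_invariant:
  fixes r :: "('g::{ab_group_add,countable}) set \<Rightarrow> real"
  assumes r: "pca_coefficients r" and \<mu>: "\<mu> \<in> config_measures" "translation_invariant \<mu>"
  shows "translation_invariant (pca_step r \<mu>)"
  unfolding translation_invariant_def
proof (intro allI)
  fix z
  let ?\<nu> = "pca_step r \<mu>"
  have \<nu>: "?\<nu> \<in> config_measures" by (rule pca_step_config[OF r \<mu>(1)])
  interpret prob_space ?\<nu> by (rule config_measuresD[OF \<nu>])
  have m: "shift z \<in> ?\<nu> \<rightarrow>\<^sub>M borel"
    by (subst measurable_cong_sets[OF config_measuresD(2)[OF \<nu>] refl]) simp
  show "distr ?\<nu> borel (shift z) = ?\<nu>"
  proof (rule config_measure_eqI_cylinder[OF _ \<nu>])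
    show "distr ?\<nu> borel (shift z) \<in> config_measures"
      using prob_space_distr[OF m] by (simp add: config_measures_def)
    fix A :: "'g set" and \<xi> assume A: "finite A"
    have "measure (distr ?\<nu> borel (shift z)) (cylinder A \<xi>) = measure ?\<nu> (cylinder (translate z A) (shift (- z) \<xi>))"
      using A config_measuresD(3)[OF \<nu>]
      by (subst measure_distr[OF m]) (auto simp: shift_in_cylinder intro!: arg_cong[where f="measure ?\<nu>"])
    also have "\<dots> = (\<integral>\<eta>. pattern_prob r A \<xi> (shift z \<eta>) \<partial>\<mu>)"
      using A by (simp add: measure_pca_step_cylinder[OF r \<mu>(1)] pattern_prob_translate)
    also have "\<dots> = measure ?\<nu> (cylinder A \<xi>)"
      using A by (simp add: measure_pca_step_cylinder[OF r \<mu>(1)] integral_shift[OF \<mu> pattern_prob_measurable[OF r]])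
    finally show "measure (distr ?\<nu> borel (shift z)) (cylinder A \<xi>) = measure ?\<nu> (cylinder A \<xi>)" .
  qed
qed

section \<open>Inheritance of variational closeness\<close>

definition product_mean :: "'g set \<Rightarrow> ('g \<Rightarrow> bool \<Rightarrow> real) \<Rightarrow> ('g config \<Rightarrow> real) \<Rightarrow> real" where
  "product_mean W p F = (\<Sum>s\<in>W \<rightarrow>\<^sub>E UNIV. (\<Prod>y\<in>W. p y (s y)) * F s)"

lemma product_mean_insert:
  assumes "finite W" "x \<notin> W"
  shows "product_mean (insert x W) p F =
    product_mean W p (\<lambda>s. p x True * F (s(x := True)) + p x False * F (s(x := False)))"
proof -
  let ?E = "W \<rightarrow>\<^sub>E (UNIV :: bool set)"
  have P: "(\<Prod>y\<in>insert x W. p y ((s(x := b)) y)) = p x b * (\<Prod>y\<in>W. p y (s y))" for s b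
  proof -
    have "(\<Prod>y\<in>W. p y ((s(x := b)) y)) = (\<Prod>y\<in>W. p y (s y))"
      using assms(2) by (intro prod.cong) auto
    then show ?thesis using assms by simp
  qed
  have "product_mean (insert x W) p F =
      (\<Sum>(b, s)\<in>UNIV \<times> ?E. (\<Prod>y\<in>insert x W. p y ((s(x := b)) y)) * F (s(x := b)))"
    unfolding product_mean_def PiE_insert_eq
    by (subst sum.reindex) (use inj_combinator[OF assms(2)] in \<open>auto simp: case_prod_unfold comp_def\<close>)
  also have "\<dots> = (\<Sum>b\<in>UNIV. \<Sum>s\<in>?E. p x b * (\<Prod>y\<in>W. p y (s y)) * F (s(x := b)))"
    unfolding P by (subst sum.cartesian_product) simp
  also have "\<dots> = product_mean W p (\<lambda>s. p x True * F (s(x := True)) + p x False * F (s(x := False)))"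
    by (simp add: UNIV_bool product_mean_def sum.distrib[symmetric] algebra_simps)
  finally show ?thesis .
qed

lemma product_mean_mono:
  assumes "finite W" "\<And>y b. p y b \<ge> 0" "\<And>s. F s \<le> G s"
  shows "product_mean W p F \<le> product_mean W p G"
  unfolding product_mean_def using assms by (intro sum_mono mult_left_mono prod_nonneg) auto

lemma product_mean_cmult: "product_mean W p (\<lambda>s. c * F s) = c * product_mean W p F"
  by (simp add: product_mean_def sum_distrib_left mult.assoc mult.left_commute)

text \<open>The single-site laws are exchanged one at a time. Exchanging p for q at x changes the
  average over that spin by at most |p - q| |F1 - F0|. The larger of F1 and F0 is at most E times
  the smaller, and the smaller is at most the q-average, so the relative change is at most 1 + E |p
  - q|, hence at most exp(E |p - q|). The flip condition survives averaging over x, which keeps the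
  induction going.\<close>

lemma product_mean_compare:
  assumes "finite W"
    and p: "\<And>y b. p y b \<ge> 0" "\<And>y. p y True + p y False = 1"
    and q: "\<And>y b. q y b \<ge> 0" "\<And>y. q y True + q y False = 1"
    and F: "\<And>s. F s \<ge> 0" "\<And>s y. F (s(y := \<not> s y)) \<le> E * F s" and E: "E \<ge> 1"
  shows "product_mean W p F \<le> exp (E * (\<Sum>y\<in>W. \<bar>p y True - q y True\<bar>)) * product_mean W q F"
  using assms(1) F
proof (induction W arbitrary: F rule: finite_induct)
  case empty
  then show ?case by (simp add: product_mean_def)
next
  case (insert x W)
  let ?T = "\<lambda>p s. p x True * F (s(x := True)) + p x False * F (s(x := False))"
  let ?e = "\<bar>p x True - q x True\<bar>"
  have flip: "F (s(x := b)) \<le> E * F (s(x := \<not> b))" for s b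
  proof -
    have "(s(x := \<not> b))(x := \<not> (s(x := \<not> b)) x) = s(x := b)" by auto
    then show ?thesis using insert.prems(2)[of "s(x := \<not> b)" x] by metis
  qed
  have nn: "?T p s \<ge> 0" for s using p(1) insert.prems(1) by (intro add_nonneg_nonneg mult_nonneg_nonneg) auto
  have step: "?T p s \<le> exp (E * ?e) * ?T q s" for s
  proof -
    let ?F1 = "F (s(x := True))" and ?F0 = "F (s(x := False))"
    have qF: "q x False = 1 - q x True" and pF: "p x False = 1 - p x True"
      using p(2)[of x] q(2)[of x] by linarith+
    have m: "\<bar>?F1 - ?F0\<bar> \<le> E * ?T q s"
    proof (cases "?F1 \<ge> ?F0")
      case True
      have "?F0 = q x True * ?F0 + q x False * ?F0" by (simp add: qF algebra_simps)
      also have "\<dots> \<le> ?T q s" using True q(1) by (intro add_right_mono mult_left_mono) auto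
      finally have "E * ?F0 \<le> E * ?T q s" using E by (intro mult_left_mono) auto
      moreover have "\<bar>?F1 - ?F0\<bar> \<le> ?F1" using True insert.prems(1)[of "s(x := False)"] by linarith
      ultimately show ?thesis using flip[of s True] by simp
    next
      case False
      have "?F1 = q x True * ?F1 + q x False * ?F1" by (simp add: qF algebra_simps)
      also have "\<dots> \<le> ?T q s" using False q(1) by (intro add_left_mono mult_left_mono) auto
      finally have "E * ?F1 \<le> E * ?T q s" using E by (intro mult_left_mono) auto
      moreover have "\<bar>?F1 - ?F0\<bar> \<le> ?F0" using False insert.prems(1)[of "s(x := True)"] by linarith
      ultimately show ?thesis using flip[of s False] by simp
    qed
    have "?T p s = ?T q s + (p x True - q x True) * (?F1 - ?F0)"
      by (simp add: qF pF algebra_simps)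
    also have "\<dots> \<le> ?T q s + ?e * \<bar>?F1 - ?F0\<bar>"
      using abs_ge_self[of "(p x True - q x True) * (?F1 - ?F0)"] by (simp add: abs_mult)
    also have "\<dots> \<le> ?T q s + ?e * (E * ?T q s)" by (intro add_left_mono mult_left_mono m) auto
    also have "\<dots> = (1 + E * ?e) * ?T q s" by (simp add: algebra_simps)
    also have "\<dots> \<le> exp (E * ?e) * ?T q s"
      using q(1) insert.prems(1)
      by (intro mult_right_mono exp_ge_add_one_self add_nonneg_nonneg mult_nonneg_nonneg) auto
    finally show ?thesis .
  qed
  have flipT: "?T p (s(y := \<not> s y)) \<le> E * ?T p s" for s y
  proof (cases "y = x")
    case True
    then show ?thesis using nn[of s] E mult_right_mono[of 1 E "?T p s"] by simp
  next
    case False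
    have "F ((s(y := \<not> s y))(x := b)) \<le> E * F (s(x := b))" for b
    proof -
      have "(s(y := \<not> s y))(x := b) = (s(x := b))(y := \<not> (s(x := b)) y)" using False by (simp add: fun_eq_iff)
      then show ?thesis using insert.prems(2)[of "s(x := b)" y] by metis
    qed
    then have "?T p (s(y := \<not> s y)) \<le> p x True * (E * F (s(x := True))) + p x False * (E * F (s(x := False)))"
      using p(1) by (intro add_mono mult_left_mono) auto
    also have "\<dots> = E * ?T p s" by (simp add: algebra_simps)
    finally show ?thesis .
  qed
  have "product_mean (insert x W) p F = product_mean W p (?T p)"
    by (rule product_mean_insert[OF insert.hyps])
  also have "\<dots> \<le> exp (E * (\<Sum>y\<in>W. \<bar>p y True - q y True\<bar>)) * product_mean W q (?T p)"
    by (rule insert.IH[OF nn flipT])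
  also have "\<dots> \<le> exp (E * (\<Sum>y\<in>W. \<bar>p y True - q y True\<bar>)) * product_mean W q (\<lambda>s. exp (E * ?e) * ?T q s)"
    by (intro mult_left_mono product_mean_mono insert.hyps q(1) step) auto
  also have "\<dots> = exp (E * (\<Sum>y\<in>insert x W. \<bar>p y True - q y True\<bar>)) * product_mean (insert x W) q F"
    unfolding product_mean_insert[OF insert.hyps] product_mean_cmult
    using insert.hyps by (simp add: exp_add distrib_left)
  finally show ?case .
qed

lemma product_mean_pos:
  assumes "finite W" "\<And>y b. p y b \<ge> 0" "\<And>y. p y True + p y False = 1" "\<And>s. F s > 0"
  shows "product_mean W p F > 0"
  using assms(1,4)
proof (induction W arbitrary: F rule: finite_induct)
  case (insert x W)
  have "p x True * F (s(x := True)) + p x False * F (s(x := False)) > 0" for s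
  proof (cases "p x True > 0")
    case True
    then show ?thesis using assms(2)[of x False] insert.prems
      by (intro add_pos_nonneg mult_pos_pos) (auto simp: less_imp_le)
  next
    case False
    then have "p x True = 0" "p x False = 1" using assms(2)[of x True] assms(3)[of x] by auto
    then show ?thesis using insert.prems by simp
  qed
  then show ?case
    unfolding product_mean_insert[OF insert.hyps] by (rule insert.IH)
qed (simp add: product_mean_def)

text \<open>Jensen's inequality, as the variational inequality for equal measures, whose relative
  entropy vanishes.\<close>

lemma jensen_exp_sum:
  fixes w g :: "'a \<Rightarrow> real"
  assumes "finite S" "\<And>x. x \<in> S \<Longrightarrow> w x \<ge> 0" "sum w S = 1"
  shows "(\<Sum>x\<in>S. w x * g x) \<le> ln (\<Sum>x\<in>S. w x * exp (g x))"
proof -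
  have "(\<Sum>x\<in>S. w x * ln (w x / w x)) = 0"
    by (rule sum.neutral) simp
  then show ?thesis using finite_variational[of S w w g] assms by simp
qed

lemma pattern_sum_eq_product_mean:
  "(\<Sum>s\<in>W \<rightarrow>\<^sub>E UNIV. pattern_prob r W s \<eta> * F s) = product_mean W (\<lambda>y b. site_prob r y b \<eta>) F"
  by (simp add: product_mean_def pattern_prob_def)

text \<open>Spins farther than m from y are frozen to +1, so rates evaluated here have range
  m.\<close>

definition truncate_at :: "nat \<Rightarrow> int^'d::finite \<Rightarrow> (int^'d) config \<Rightarrow> (int^'d) config" where
  "truncate_at m y \<eta> = override_on (\<lambda>_. True) \<eta> (translate y (cube m))"

text \<open>Only sites within distance m of x notice the change, each by at most 1. Without
  truncation the sum need not be bounded uniformly in W.\<close>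

lemma truncated_influence:
  fixes r :: "(int^'d::finite) set \<Rightarrow> real"
  assumes r: "pca_coefficients r" and W: "finite W"
  shows "(\<Sum>y\<in>W. \<bar>site_prob r y True (truncate_at m y (\<eta>(x := b))) - site_prob r y True (truncate_at m y \<eta>)\<bar>)
         \<le> cube_size TYPE('d) m"
proof -
  let ?t = "\<lambda>y. \<bar>site_prob r y True (truncate_at m y (\<eta>(x := b))) - site_prob r y True (truncate_at m y \<eta>)\<bar>"
  let ?I = "W \<inter> translate x (cube m)"
  have "?t y = 0" if "y \<notin> translate x (cube m)" for y
  proof -
    have "x \<notin> translate y (cube m)"
      using that cube_uminus[of "x - y" m] by (auto simp: translate_iff)
    then have "truncate_at m y (\<eta>(x := b)) = truncate_at m y \<eta>"
      by (auto simp: truncate_at_def override_on_def)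
    then show ?thesis by simp
  qed
  then have "sum ?t W = sum ?t ?I"
    by (intro sum.mono_neutral_right) (use W in auto)
  also have "\<dots> \<le> (\<Sum>y\<in>?I. 1)"
  proof (rule sum_mono)
    fix y show "?t y \<le> 1"
      using site_prob_nonneg[OF r, of y True] site_prob_le_1[OF r, of y True]
      by (smt (verit))
  qed
  also have "\<dots> = real (card ?I)" by simp
  also have "\<dots> \<le> real (card (translate x (cube m)))" by (intro of_nat_mono card_mono) auto
  also have "\<dots> \<le> cube_size TYPE('d) m"
    unfolding translate_def by (intro of_nat_mono card_image_le) auto
  finally show ?thesis .
qed

lemma frequently_offset:
  assumes "\<exists>\<^sub>F N in sequentially. P N"
  shows "\<exists>\<^sub>F N in sequentially. P (N + m)"
  using assms eventually_sequentially_seg[of "\<lambda>N. \<not> P N" m] by (simp add: frequently_def)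

text \<open>The pulled back function g' is the logarithm of the mean of exp(g) under the truncated
  kernel. Truncation makes it local on the cube of radius N + m and gives it a bounded flip effect;
  it differs from the untruncated version by at most (d/4) times the volume. Jensen's inequality is
  used on the side of \<nu>, while integrating exp(g') against \<mu> returns the exponential moment
  of \<open>pca_step r \<mu>\<close> up to that error.\<close>

proposition variationally_close_pca_step:
  fixes r :: "(int^'d::finite) set \<Rightarrow> real"
  assumes r: "pca_coefficients r" and \<mu>: "\<mu> \<in> config_measures" and \<nu>: "\<nu> \<in> config_measures"
    and close: "variationally_close \<nu> \<mu>"
  shows "variationally_close (pca_step r \<nu>) (pca_step r \<mu>)"
  unfolding variationally_close_def
proof (intro allI impI)
  fix K d :: real assume K: "K > 0" and d: "d > 0"
  define E where "E = exp K"
  have E: "E \<ge> 1" "E > 0" using K by (auto simp: E_def)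
  \<comment> \<open>With this e, \<open>product_mean_compare\<close> loses d/4 per site whenever the
    kernel and its truncation are exchanged. That happens twice, and the entropy term d/4 lives on a
    volume at most twice as large: d in total.\<close>
  define e where "e = d / (4 * E)"
  have e: "e > 0" using d E by (simp add: e_def)
  obtain m where m: "\<And>x b \<eta> \<eta>'. (\<And>a. a \<in> cube m \<Longrightarrow> \<eta> (a + x) = \<eta>' (a + x)) \<Longrightarrow>
      \<bar>site_prob r x b \<eta> - site_prob r x b \<eta>'\<bar> \<le> e"
    using site_prob_cube_modulus[OF r e] by metis
  let ?p = "\<lambda>\<eta> y b. site_prob r y b \<eta>" and ?q = "\<lambda>\<eta> y b. site_prob r y b (truncate_at m y \<eta>)"
  have pq: "\<bar>?p \<eta> y b - ?q \<eta> y b\<bar> \<le> e" for \<eta> y b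
    by (rule m) (auto simp: truncate_at_def override_on_def translate_def)
  \<comment> \<open>Flip bound of g': the comparison factor E times the total truncated influence of
    one spin.\<close>
  define K' where "K' = E * cube_size TYPE('d) m"
  have K': "K' > 0" using E cube_size_pos[where 'd='d, of m] by (simp add: K'_def)
  have "\<exists>\<^sub>F N in sequentially. \<forall>g. depends_only_on (cube (N + m)) g \<and> flip_bounded K' g \<longrightarrow>
        (\<integral>\<sigma>. g \<sigma> \<partial>\<nu>) \<le> ln (\<integral>\<sigma>. exp (g \<sigma>) \<partial>\<mu>) + d / 4 * cube_size TYPE('d) (N + m)"
  proof (rule frequently_offset)
    have "d / 4 > 0" using d by simp
    with close K' show "\<exists>\<^sub>F N in sequentially. \<forall>g. depends_only_on (cube N) g \<and> flip_bounded K' g \<longrightarrow>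
        (\<integral>\<sigma>. g \<sigma> \<partial>\<nu>) \<le> ln (\<integral>\<sigma>. exp (g \<sigma>) \<partial>\<mu>) + d / 4 * cube_size TYPE('d) N"
      unfolding variationally_close_def by blast
  qed
  from frequently_eventually_frequently[OF this cube_size_le_twice[where 'd='d and m=m]]
  show "\<exists>\<^sub>F N in sequentially. \<forall>g. depends_only_on (cube N) g \<and> flip_bounded K g \<longrightarrow>
        (\<integral>\<sigma>. g \<sigma> \<partial>pca_step r \<nu>) \<le> ln (\<integral>\<sigma>. exp (g \<sigma>) \<partial>pca_step r \<mu>) + d * cube_size TYPE('d) N"
  proof (rule frequently_elim1, intro allI impI, elim conjE)
    fix N and g :: "(int^'d) config \<Rightarrow> real"
    let ?W = "cube N :: (int^'d) set" and ?c = "cube_size TYPE('d) N"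
    assume H: "\<forall>g. depends_only_on (cube (N + m)) g \<and> flip_bounded K' g \<longrightarrow>
        (\<integral>\<sigma>. g \<sigma> \<partial>\<nu>) \<le> ln (\<integral>\<sigma>. exp (g \<sigma>) \<partial>\<mu>) + d / 4 * cube_size TYPE('d) (N + m)"
      and tw: "cube_size TYPE('d) (N + m) \<le> 2 * ?c"
      and g: "depends_only_on ?W g" and gK: "flip_bounded K g"
    have eg: "depends_only_on ?W (\<lambda>s. exp (g s))" using g by (auto simp: depends_only_on_def)
    define G where "G \<eta> = product_mean ?W (?p \<eta>) (\<lambda>s. exp (g s))" for \<eta>
    define G' where "G' \<eta> = product_mean ?W (?q \<eta>) (\<lambda>s. exp (g s))" for \<eta>
    define g' where "g' \<eta> = ln (G' \<eta>)" for \<eta>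
    have flip: "exp (g (s(y := \<not> s y))) \<le> E * exp (g s)" for s y
    proof -
      have "g (s(y := \<not> s y)) \<le> K + g s" using flip_boundedD[OF gK, of s y] by linarith
      then show ?thesis by (simp add: E_def exp_add[symmetric])
    qed
    note tot = site_prob_total and nn = site_prob_nonneg[OF r]
    have G'pos: "G' \<eta> > 0" for \<eta>
      unfolding G'_def by (rule product_mean_pos) (auto simp: tot nn)
    have expg': "exp (g' \<eta>) = G' \<eta>" for \<eta> using G'pos by (simp add: g'_def)
    have sum_e: "E * (\<Sum>y\<in>?W. \<bar>a y\<bar>) \<le> d / 4 * ?c" if "\<And>y. \<bar>a y\<bar> \<le> e" for a :: "_ \<Rightarrow> real"
    proof -
      have "E * (\<Sum>y\<in>?W. \<bar>a y\<bar>) \<le> E * (\<Sum>y\<in>?W. e)"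
        using E by (intro mult_left_mono sum_mono that) auto
      also have "\<dots> = d / 4 * ?c" using E by (simp add: e_def)
      finally show ?thesis .
    qed
    have GG': "G \<eta> \<le> exp (d / 4 * ?c) * G' \<eta>" for \<eta>
    proof -
      have "G \<eta> \<le> exp (E * (\<Sum>y\<in>?W. \<bar>?p \<eta> y True - ?q \<eta> y True\<bar>)) * G' \<eta>"
        unfolding G_def G'_def by (rule product_mean_compare[OF _ _ _ _ _ _ flip E(1)]) (auto simp: tot nn)
      also have "\<dots> \<le> exp (d / 4 * ?c) * G' \<eta>"
        using G'pos[of \<eta>] sum_e[of "\<lambda>y. ?p \<eta> y True - ?q \<eta> y True"] pq by (intro mult_right_mono) auto
      finally show ?thesis .
    qed
    have G'G: "G' \<eta> \<le> exp (d / 4 * ?c) * G \<eta>" for \<eta>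
    proof -
      have "G' \<eta> \<le> exp (E * (\<Sum>y\<in>?W. \<bar>?q \<eta> y True - ?p \<eta> y True\<bar>)) * G \<eta>"
        unfolding G_def G'_def by (rule product_mean_compare[OF _ _ _ _ _ _ flip E(1)]) (auto simp: tot nn)
      also have "\<dots> \<le> exp (d / 4 * ?c) * G \<eta>"
      proof (intro mult_right_mono)
        show "exp (E * (\<Sum>y\<in>?W. \<bar>?q \<eta> y True - ?p \<eta> y True\<bar>)) \<le> exp (d / 4 * ?c)"
          using sum_e[of "\<lambda>y. ?q \<eta> y True - ?p \<eta> y True"] pq by (simp add: abs_minus_commute)
        show "G \<eta> \<ge> 0" unfolding G_def
          by (rule less_imp_le, rule product_mean_pos) (auto simp: tot nn)
      qed
      finally show ?thesis .
    qed
    have depg': "depends_only_on (cube (N + m)) g'"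
      unfolding depends_only_on_def
    proof (intro allI impI)
      fix \<eta> \<eta>' :: "(int^'d) config" assume eq: "\<forall>x\<in>cube (N + m). \<eta> x = \<eta>' x"
      have "truncate_at m y \<eta> = truncate_at m y \<eta>'" if "y \<in> ?W" for y
      proof -
        have "x \<in> cube (N + m)" if "x \<in> translate y (cube m)" for x
          using that cube_add[of "x - y" m y N] \<open>y \<in> ?W\<close> by (simp add: translate_iff add.commute)
        then show ?thesis using eq by (auto simp: truncate_at_def override_on_def)
      qed
      then show "g' \<eta> = g' \<eta>'"
        unfolding g'_def G'_def product_mean_def by simp
    qed
    have flipg': "flip_bounded K' g'"
      unfolding flip_bounded_def
    proof (intro allI)
      have one: "g' \<eta>1 \<le> K' + g' \<eta>2"
        if "(\<Sum>y\<in>?W. \<bar>?q \<eta>1 y True - ?q \<eta>2 y True\<bar>) \<le> cube_size TYPE('d) m" for \<eta>1 \<eta>2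
      proof -
        have "G' \<eta>1 \<le> exp (E * (\<Sum>y\<in>?W. \<bar>?q \<eta>1 y True - ?q \<eta>2 y True\<bar>)) * G' \<eta>2"
          unfolding G'_def by (rule product_mean_compare[OF _ _ _ _ _ _ flip E(1)]) (auto simp: tot nn)
        also have "\<dots> \<le> exp K' * G' \<eta>2"
          using G'pos[of \<eta>2] E that by (intro mult_right_mono) (auto simp: K'_def)
        finally have "ln (G' \<eta>1) \<le> ln (exp K' * G' \<eta>2)"
          using G'pos by (subst ln_le_cancel_iff) auto
        then show ?thesis using G'pos[of \<eta>2] by (simp add: g'_def ln_mult)
      qed
      fix x \<eta>
      have "g' (\<eta>(x := \<not> \<eta> x)) \<le> K' + g' \<eta>"
        by (rule one) (rule truncated_influence[OF r], simp)
      moreover have "g' \<eta> \<le> K' + g' (\<eta>(x := \<not> \<eta> x))"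
        by (rule one) (use truncated_influence[OF r, of ?W m "\<eta>(x := \<not> \<eta> x)" x "\<eta> x"] in simp)
      ultimately show "\<bar>g' (\<eta>(x := \<not> \<eta> x)) - g' \<eta>\<bar> \<le> K'" by linarith
    qed
    have H': "(\<integral>\<sigma>. g' \<sigma> \<partial>\<nu>) \<le> ln (\<integral>\<sigma>. exp (g' \<sigma>) \<partial>\<mu>) + d / 4 * cube_size TYPE('d) (N + m)"
      using H depg' flipg' by blast
    have intg': "integrable \<nu> g'" by (rule local_integrable[OF \<nu> finite_cube depg'])
    have intG': "integrable \<mu> G'"
      by (rule local_integrable[OF \<mu> finite_cube, of "N + m"])
         (use depg' in \<open>auto simp: depends_only_on_def expg'[symmetric]\<close>)
    have intP: "integrable \<rho> (\<lambda>\<eta>. \<Sum>s\<in>?W \<rightarrow>\<^sub>E UNIV. pattern_prob r ?W s \<eta> * f s)"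
      if "\<rho> \<in> config_measures" for \<rho> and f :: "(int^'d) config \<Rightarrow> real"
      by (intro Bochner_Integration.integrable_sum integrable_mult_left pattern_prob_integrable[OF r that])
    have jens: "(\<Sum>s\<in>?W \<rightarrow>\<^sub>E UNIV. pattern_prob r ?W s \<eta> * g s) \<le> g' \<eta> + d / 4 * ?c" for \<eta>
    proof -
      have "(\<Sum>s\<in>?W \<rightarrow>\<^sub>E UNIV. pattern_prob r ?W s \<eta> * g s) \<le> ln (\<Sum>s\<in>?W \<rightarrow>\<^sub>E UNIV. pattern_prob r ?W s \<eta> * exp (g s))"
        by (rule jensen_exp_sum) (auto simp: pattern_prob_nonneg[OF r] sum_pattern_prob[OF r])
      also have "\<dots> = ln (G \<eta>)" by (simp add: pattern_sum_eq_product_mean G_def)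
      also have "\<dots> \<le> ln (exp (d / 4 * ?c) * G' \<eta>)"
        using GG'[of \<eta>] G'pos[of \<eta>] product_mean_pos[of ?W "?p \<eta>" "\<lambda>s. exp (g s)"]
        by (subst ln_le_cancel_iff) (auto simp: G_def tot nn)
      also have "\<dots> = g' \<eta> + d / 4 * ?c"
        using G'pos[of \<eta>] by (simp add: ln_mult g'_def)
      finally show ?thesis .
    qed
    interpret \<nu>: prob_space \<nu> by (rule config_measuresD[OF \<nu>])
    interpret \<mu>: prob_space \<mu> by (rule config_measuresD[OF \<mu>])
    have "(\<integral>\<sigma>. g \<sigma> \<partial>pca_step r \<nu>) \<le> (\<integral>\<eta>. g' \<eta> + d / 4 * ?c \<partial>\<nu>)"
      unfolding integral_pca_step[OF r \<nu> finite_cube g]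
      by (intro integral_mono intP[OF \<nu>] jens) (use intg' in auto)
    also have "\<dots> = (\<integral>\<eta>. g' \<eta> \<partial>\<nu>) + d / 4 * ?c"
      using intg' \<nu>.prob_space by simp
    also have "\<dots> \<le> ln (\<integral>\<sigma>. exp (g' \<sigma>) \<partial>\<mu>) + d / 4 * cube_size TYPE('d) (N + m) + d / 4 * ?c"
      using H' by simp
    also have "ln (\<integral>\<sigma>. exp (g' \<sigma>) \<partial>\<mu>) \<le> ln (\<integral>\<sigma>. exp (g \<sigma>) \<partial>pca_step r \<mu>) + d / 4 * ?c"
    proof -
      have pos: "(\<integral>\<sigma>. exp (g' \<sigma>) \<partial>\<mu>) > 0"
      proof -
        obtain B where B: "\<And>\<sigma>. \<bar>g' \<sigma>\<bar> \<le> B" using local_bounded[OF finite_cube depg'] by blast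
        have "(\<integral>\<sigma>. exp (- B) \<partial>\<mu>) \<le> (\<integral>\<sigma>. exp (g' \<sigma>) \<partial>\<mu>)"
          unfolding expg'
        proof (intro integral_mono intG')
          show "exp (- B) \<le> G' \<sigma>" for \<sigma>
            using B[of \<sigma>] by (simp add: expg'[symmetric] abs_le_iff)
        qed simp
        then show ?thesis using \<mu>.prob_space by simp (meson exp_gt_zero less_le_trans)
      qed
      have "(\<integral>\<sigma>. exp (g' \<sigma>) \<partial>\<mu>) \<le> (\<integral>\<eta>. exp (d / 4 * ?c) * (\<Sum>s\<in>?W \<rightarrow>\<^sub>E UNIV. pattern_prob r ?W s \<eta> * exp (g s)) \<partial>\<mu>)"
        unfolding expg' using intG' intP[OF \<mu>, of "\<lambda>s. exp (g s)"] G'G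
        by (intro integral_mono) (auto simp: pattern_sum_eq_product_mean G_def[symmetric])
      also have "\<dots> = exp (d / 4 * ?c) * (\<integral>\<sigma>. exp (g \<sigma>) \<partial>pca_step r \<mu>)"
        by (simp add: integral_pca_step[OF r \<mu> finite_cube eg])
      finally have le: "(\<integral>\<sigma>. exp (g' \<sigma>) \<partial>\<mu>) \<le> exp (d / 4 * ?c) * (\<integral>\<sigma>. exp (g \<sigma>) \<partial>pca_step r \<mu>)" .
      with pos have pos2: "(\<integral>\<sigma>. exp (g \<sigma>) \<partial>pca_step r \<mu>) > 0"
        by (metis exp_gt_zero less_le_trans zero_less_mult_pos)
      have "ln (\<integral>\<sigma>. exp (g' \<sigma>) \<partial>\<mu>) \<le> ln (exp (d / 4 * ?c) * (\<integral>\<sigma>. exp (g \<sigma>) \<partial>pca_step r \<mu>))"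
        using le pos by (subst ln_le_cancel_iff) auto
      then show ?thesis using pos2 by (simp add: ln_mult)
    qed
    finally have "(\<integral>\<sigma>. g \<sigma> \<partial>pca_step r \<nu>) \<le>
        ln (\<integral>\<sigma>. exp (g \<sigma>) \<partial>pca_step r \<mu>) + d / 4 * ?c + d / 4 * cube_size TYPE('d) (N + m) + d / 4 * ?c"
      by simp
    moreover have "d / 4 * cube_size TYPE('d) (N + m) \<le> d / 4 * (2 * ?c)"
      using tw d by (intro mult_left_mono) auto
    ultimately show "(\<integral>\<sigma>. g \<sigma> \<partial>pca_step r \<nu>) \<le> ln (\<integral>\<sigma>. exp (g \<sigma>) \<partial>pca_step r \<mu>) + d * ?c"
      by (simp add: field_simps)
  qed
qed

lemma iterated_pca_step:
  fixes r :: "(int^'d::finite) set \<Rightarrow> real"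
  assumes r: "pca_coefficients r" and \<mu>: "\<mu> \<in> config_measures" "translation_invariant \<mu>"
  shows "(pca_step r ^^ n) \<mu> \<in> config_measures" "translation_invariant ((pca_step r ^^ n) \<mu>)"
proof (induction n)
  case 0
  show "(pca_step r ^^ 0) \<mu> \<in> config_measures" "translation_invariant ((pca_step r ^^ 0) \<mu>)"
    using \<mu> by auto
next
  case (Suc n)
  show "(pca_step r ^^ Suc n) \<mu> \<in> config_measures" "translation_invariant ((pca_step r ^^ Suc n) \<mu>)"
    using pca_step_config[OF r Suc(1)] pca_step_translation_invariant[OF r Suc(1,2)] by auto
qed

theorem zero_entropy_no_GCB:
  fixes r :: "(int^'d::finite) set \<Rightarrow> real"
  assumes r: "pca_coefficients r" and nd: "non_degenerate r"
    and \<mu>: "\<mu> \<in> config_measures" "translation_invariant \<mu>"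
    and \<nu>: "\<nu> \<in> config_measures" "translation_invariant \<nu>"
    and neq: "\<nu> \<noteq> \<mu>" and s: "liminf (entropy_per_site \<nu> \<mu>) \<le> 0" and C: "C \<ge> 0"
  shows "\<not> GCB C ((pca_step r ^^ n) \<mu>)"
proof
  assume gcb: "GCB C ((pca_step r ^^ n) \<mu>)"
  have "variationally_close ((pca_step r ^^ n) \<nu>) ((pca_step r ^^ n) \<mu>)"
  proof (induction n)
    case 0
    show ?case using variationally_closeI[OF \<mu>(1) \<nu>(1) s] by simp
  next
    case (Suc n)
    show ?case
      using variationally_close_pca_step[OF r iterated_pca_step(1)[OF r \<mu>] iterated_pca_step(1)[OF r \<nu>] Suc] by simp
  qed
  then have "(pca_step r ^^ n) \<nu> = (pca_step r ^^ n) \<mu>"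
    by (rule GCB_unique[OF iterated_pca_step[OF r \<mu>] iterated_pca_step[OF r \<nu>] gcb C])
  then show False using nd neq \<mu>(1) \<nu>(1) unfolding non_degenerate_def by blast
qed

section \<open>Boundary effects for Gibbs measures\<close>

lemma cube_size_upper_shell:
  assumes "d > 0"
  shows "eventually (\<lambda>n. cube_size TYPE('d::finite) (n + m) - cube_size TYPE('d) n \<le> d * cube_size TYPE('d) n) sequentially"
proof -
  have "eventually (\<lambda>n. cube_size TYPE('d) (n + m) / cube_size TYPE('d) n < 1 + d) sequentially"
    by (rule order_tendstoD[OF cube_size_ratio]) (use assms in simp)
  then show ?thesis
  proof eventually_elim
    case (elim n)
    then have "cube_size TYPE('d) (n + m) < (1 + d) * cube_size TYPE('d) n"
      using cube_size_pos[where 'd='d, of n] by (simp add: field_simps)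
    then show ?case by (simp add: algebra_simps)
  qed
qed

lemma cube_size_mono: "m \<le> n \<Longrightarrow> cube_size TYPE('d::finite) m \<le> cube_size TYPE('d) n"
  by (intro of_nat_mono card_mono cube_mono finite_cube)

lemma eventually_minus_const:
  assumes "eventually P sequentially"
  shows "eventually (\<lambda>n. n \<ge> m \<and> P (n - m)) sequentially"
  using eventually_compose_filterlim[OF assms filterlim_minus_const_nat_at_top[of m]]
    eventually_ge_at_top[of m]
  by eventually_elim auto

lemma cube_size_lower_shell:
  assumes "d > 0"
  shows "eventually (\<lambda>n. n \<ge> m \<and> cube_size TYPE('d::finite) n - cube_size TYPE('d) (n - m) \<le> d * cube_size TYPE('d) n) sequentially"
  using eventually_minus_const[OF cube_size_upper_shell[OF assms, where 'd='d and m=m], of m]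
proof eventually_elim
  case (elim n)
  then have "n - m + m = n" by simp
  with elim have "cube_size TYPE('d) n - cube_size TYPE('d) (n - m) \<le> d * cube_size TYPE('d) (n - m)" by metis
  also have "\<dots> \<le> d * cube_size TYPE('d) n"
    using assms by (intro mult_left_mono cube_size_mono) auto
  finally show ?case using elim by simp
qed

section \<open>Tail sums of a summable potential\<close>

definition pot_norm :: "'g potential \<Rightarrow> 'g set \<Rightarrow> real" where
  "pot_norm \<Phi> A = (SUP \<sigma>. \<bar>\<Phi> A \<sigma>\<bar>)"

lemma abs_le_pot_norm:
  assumes "ti_summable_potential \<Phi>" "finite A"
  shows "\<bar>\<Phi> A \<sigma>\<bar> \<le> pot_norm \<Phi> A"
proof -
  have "depends_only_on A (\<Phi> A)" using assms by (simp add: ti_summable_potential_def)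
  then obtain B where "\<And>\<sigma>. \<bar>\<Phi> A \<sigma>\<bar> \<le> B" using local_bounded[OF assms(2)] by blast
  then have "bdd_above (range (\<lambda>\<sigma>. \<bar>\<Phi> A \<sigma>\<bar>))" by (intro bdd_aboveI2)
  then show ?thesis unfolding pot_norm_def by (rule cSUP_upper[OF UNIV_I])
qed

lemma pot_norm_nonneg: "ti_summable_potential \<Phi> \<Longrightarrow> finite A \<Longrightarrow> 0 \<le> pot_norm \<Phi> A"
  using abs_le_pot_norm[of \<Phi> A "\<lambda>_. True"] by linarith

lemma pot_norm_translate:
  assumes "ti_summable_potential \<Phi>" "finite A"
  shows "pot_norm \<Phi> (translate x A) = pot_norm \<Phi> A"
proof -
  have "range (\<lambda>\<sigma>. \<bar>\<Phi> (translate x A) \<sigma>\<bar>) = range (\<lambda>\<sigma>. \<bar>\<Phi> A (shift x \<sigma>)\<bar>)"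
    using assms by (simp add: ti_summable_potential_def)
  also have "\<dots> = (\<lambda>\<sigma>. \<bar>\<Phi> A \<sigma>\<bar>) ` range (shift x)" by auto
  also have "range (shift x :: 'a config \<Rightarrow> _) = UNIV"
    by (rule surjI[of _ "shift (- x)"]) simp
  finally show ?thesis by (simp add: pot_norm_def)
qed

lemma pot_norm_summable_site:
  "ti_summable_potential \<Phi> \<Longrightarrow> pot_norm \<Phi> summable_on {A. finite A \<and> x \<in> A}"
  unfolding ti_summable_potential_def pot_norm_def by auto

lemma pot_norm_summable:
  assumes \<Phi>: "ti_summable_potential \<Phi>" and "finite \<Lambda>"
  shows "pot_norm \<Phi> summable_on {A. finite A \<and> A \<inter> \<Lambda> \<noteq> {}}"
  using assms(2)
proof (induction \<Lambda> rule: finite_induct)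
  case (insert x \<Lambda>)
  let ?S = "\<lambda>\<Lambda>. {A. finite A \<and> A \<inter> \<Lambda> \<noteq> {}}"
  have "?S (insert x \<Lambda>) = {A. finite A \<and> x \<in> A} \<union> (?S \<Lambda> - {A. finite A \<and> x \<in> A})" by auto
  moreover have "pot_norm \<Phi> summable_on {A. finite A \<and> x \<in> A} \<union> (?S \<Lambda> - {A. finite A \<and> x \<in> A})"
    by (intro summable_on_Un_disjoint pot_norm_summable_site \<Phi> summable_on_subset_banach[OF insert.IH]) auto
  ultimately show ?case by simp
qed simp

text \<open>Total strength of the bonds that meet \<Lambda> and leave D. Twice this number bounds
  the effect on the energy in \<Lambda> of spins outside D.\<close>

definition boundary_norm :: "'g potential \<Rightarrow> 'g set \<Rightarrow> 'g set \<Rightarrow> real" where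
  "boundary_norm \<Phi> \<Lambda> D = infsum (pot_norm \<Phi>) {A. finite A \<and> A \<inter> \<Lambda> \<noteq> {} \<and> \<not> A \<subseteq> D}"

lemma hamiltonian_diff_le:
  assumes \<Phi>: "ti_summable_potential \<Phi>" and \<Lambda>: "finite \<Lambda>" and eq: "\<And>x. x \<in> D \<Longrightarrow> \<sigma> x = \<sigma>' x"
  shows "\<bar>hamiltonian \<Phi> \<Lambda> \<sigma> - hamiltonian \<Phi> \<Lambda> \<sigma>'\<bar> \<le> 2 * boundary_norm \<Phi> \<Lambda> D"
  unfolding hamiltonian_def boundary_norm_def
proof (rule abs_infsum_diff_le[OF pot_norm_summable[OF \<Phi> \<Lambda>]])
  fix A assume "A \<in> {A. finite A \<and> A \<inter> \<Lambda> \<noteq> {}} - {A. finite A \<and> A \<inter> \<Lambda> \<noteq> {} \<and> \<not> A \<subseteq> D}"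
  then have A: "finite A" "A \<subseteq> D" by auto
  then have "depends_only_on A (\<Phi> A)" using \<Phi> by (simp add: ti_summable_potential_def)
  then show "\<Phi> A \<sigma> = \<Phi> A \<sigma>'" by (rule depends_only_onD) (use A eq in auto)
qed (auto intro: abs_le_pot_norm[OF \<Phi>])

lemma boundary_norm_small:
  assumes \<Phi>: "ti_summable_potential \<Phi>" and \<Lambda>: "finite \<Lambda>" and e: "e > 0"
  obtains D where "finite D" "boundary_norm \<Phi> \<Lambda> D \<le> e"
proof -
  let ?S = "{A. finite A \<and> A \<inter> \<Lambda> \<noteq> {}}"
  note sm = pot_norm_summable[OF \<Phi> \<Lambda>]
  obtain F where F: "finite F" "F \<subseteq> ?S" "infsum (pot_norm \<Phi>) (?S - F) \<le> e"
    by (rule summable_tail[OF sm _ e]) (use pot_norm_nonneg[OF \<Phi>] in auto)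
  have "boundary_norm \<Phi> \<Lambda> (\<Union>F) \<le> infsum (pot_norm \<Phi>) (?S - F)"
    unfolding boundary_norm_def
    by (rule infsum_mono2[OF summable_on_subset_banach[OF sm] summable_on_subset_banach[OF sm]])
       (use pot_norm_nonneg[OF \<Phi>] in auto)
  then show ?thesis using that[of "\<Union>F"] F by auto
qed

text \<open>Translation by x is a bijection between the bonds through 0 and those through x and
  preserves their norms, so one window around 0 serves all sites.\<close>

lemma boundary_norm_site:
  fixes \<Phi> :: "'g::ab_group_add potential"
  assumes \<Phi>: "ti_summable_potential \<Phi>"
  shows "boundary_norm \<Phi> {x} D = boundary_norm \<Phi> {0} (translate (- x) D)"
proof -
  have eq: "{A. finite A \<and> A \<inter> {y} \<noteq> {} \<and> \<not> A \<subseteq> D} = {A. finite A \<and> y \<in> A \<and> \<not> A \<subseteq> D}" for y and D :: "'g set" by auto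
  have tr: "translate y (translate z A) = translate (z + y) A" for y z and A :: "'g set"
    by (auto simp: translate_def image_image add.assoc)
  have tr0: "translate 0 A = A" for A :: "'g set" by (simp add: translate_def)
  have tm: "translate y A \<subseteq> translate y B" if "A \<subseteq> B" for y and A B :: "'g set"
    using that by (auto simp: translate_def)
  have "bij_betw (translate x) {A. finite A \<and> 0 \<in> A \<and> \<not> A \<subseteq> translate (- x) D} {A. finite A \<and> x \<in> A \<and> \<not> A \<subseteq> D}"
  proof (rule bij_betwI[of _ _ _ "translate (- x)"])
    show "translate x \<in> {A. finite A \<and> 0 \<in> A \<and> \<not> A \<subseteq> translate (- x) D} \<rightarrow> {A. finite A \<and> x \<in> A \<and> \<not> A \<subseteq> D}"
      using tm[of "translate x _" D "- x"] by (auto simp: tr tr0 translate_iff)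
    show "translate (- x) \<in> {A. finite A \<and> x \<in> A \<and> \<not> A \<subseteq> D} \<rightarrow> {A. finite A \<and> 0 \<in> A \<and> \<not> A \<subseteq> translate (- x) D}"
      using tm[of "translate (- x) _" "translate (- x) D" x] by (auto simp: tr tr0 translate_iff)
  qed (simp_all add: tr tr0)
  from infsum_reindex_bij_betw[OF this, of "pot_norm \<Phi>"]
  have "infsum (pot_norm \<Phi>) {A. finite A \<and> x \<in> A \<and> \<not> A \<subseteq> D} =
      infsum (\<lambda>A. pot_norm \<Phi> (translate x A)) {A. finite A \<and> 0 \<in> A \<and> \<not> A \<subseteq> translate (- x) D}" by simp
  also have "\<dots> = infsum (pot_norm \<Phi>) {A. finite A \<and> 0 \<in> A \<and> \<not> A \<subseteq> translate (- x) D}"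
    by (rule infsum_cong) (simp add: pot_norm_translate[OF \<Phi>])
  finally show ?thesis unfolding boundary_norm_def eq .
qed

lemma boundary_norm_mono:
  assumes \<Phi>: "ti_summable_potential \<Phi>" and \<Lambda>: "finite \<Lambda>" and "D \<subseteq> D'"
  shows "boundary_norm \<Phi> \<Lambda> D' \<le> boundary_norm \<Phi> \<Lambda> D"
  unfolding boundary_norm_def
  by (rule infsum_mono2)
     (use assms(3) pot_norm_nonneg[OF \<Phi>] in \<open>auto intro!: summable_on_subset_banach[OF pot_norm_summable[OF \<Phi> \<Lambda>]]\<close>)

lemma boundary_norm_nonneg:
  "ti_summable_potential \<Phi> \<Longrightarrow> 0 \<le> boundary_norm \<Phi> \<Lambda> D"
  unfolding boundary_norm_def by (rule infsum_nonneg) (auto intro: pot_norm_nonneg)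

lemma boundary_norm_le_sum:
  assumes \<Phi>: "ti_summable_potential \<Phi>" and "finite \<Lambda>"
  shows "boundary_norm \<Phi> \<Lambda> D \<le> (\<Sum>x\<in>\<Lambda>. boundary_norm \<Phi> {x} D)"
  using assms(2)
proof (induction \<Lambda> rule: finite_induct)
  case empty
  then show ?case by (simp add: boundary_norm_def)
next
  case (insert x \<Lambda>)
  let ?S = "\<lambda>\<Lambda>. {A. finite A \<and> A \<inter> \<Lambda> \<noteq> {} \<and> \<not> A \<subseteq> D}"
  have sm: "pot_norm \<Phi> summable_on T" if "T \<subseteq> ?S \<Lambda>'" "finite \<Lambda>'" for T \<Lambda>'
    by (rule summable_on_subset_banach[OF pot_norm_summable[OF \<Phi> that(2)]]) (use that in auto)
  have "?S (insert x \<Lambda>) = ?S {x} \<union> (?S \<Lambda> - ?S {x})" by auto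
  then have "boundary_norm \<Phi> (insert x \<Lambda>) D = infsum (pot_norm \<Phi>) (?S {x} \<union> (?S \<Lambda> - ?S {x}))"
    unfolding boundary_norm_def by (rule arg_cong)
  also have "\<dots> = boundary_norm \<Phi> {x} D + infsum (pot_norm \<Phi>) (?S \<Lambda> - ?S {x})"
    unfolding boundary_norm_def
    by (rule infsum_Un_disjoint[OF sm[OF subset_refl] sm[OF Diff_subset]]) (use insert.hyps in auto)
  also have "infsum (pot_norm \<Phi>) (?S \<Lambda> - ?S {x}) \<le> boundary_norm \<Phi> \<Lambda> D"
    unfolding boundary_norm_def
    by (rule infsum_mono2[OF sm[OF Diff_subset] sm[OF subset_refl]])
       (use insert.hyps pot_norm_nonneg[OF \<Phi>] in auto)
  finally show ?case using insert by simp
qed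

text \<open>A site at depth m sees only bonds leaving its window of radius m, of total norm at most
  d/2. A site in the outer shell contributes at most T, its full interaction norm, but such sites
  are a vanishing fraction.\<close>

lemma boundary_norm_cube:
  fixes \<Phi> :: "(int^'d::finite) potential"
  assumes \<Phi>: "ti_summable_potential \<Phi>" and d: "d > 0"
  shows "eventually (\<lambda>n. boundary_norm \<Phi> (cube n) (cube n) \<le> d * cube_size TYPE('d) n) sequentially"
proof -
  define T where "T = boundary_norm \<Phi> {0} {}"
  have T: "T \<ge> 0" unfolding T_def by (rule boundary_norm_nonneg[OF \<Phi>])
  obtain D where D: "finite D" "boundary_norm \<Phi> {0} D \<le> d / 2"
    using boundary_norm_small[OF \<Phi>, of "{0}" "d/2"] d by auto
  obtain m where m: "D \<subseteq> cube m" using finite_subset_cube[OF D(1)] by blast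
  \<comment> \<open>Allowed fraction of shell sites: T times it is at most d/2, with T + 1 guarding
    against T = 0.\<close>
  have "d / (2 * (T + 1)) > 0" using d T by simp
  from cube_size_lower_shell[OF this, where 'd='d and m=m]
  show ?thesis
  proof eventually_elim
    case (elim n)
    let ?c = "cube_size TYPE('d) n"
    have site: "boundary_norm \<Phi> {x} (cube n) \<le> (if x \<in> cube (n - m) then d / 2 else T)" for x
    proof (cases "x \<in> cube (n - m)")
      case True
      have "cube m \<subseteq> translate (- x) (cube n)"
        using cube_add[OF _ True, of _ m] elim by (auto simp: translate_iff)
      then have "boundary_norm \<Phi> {0} (translate (- x) (cube n)) \<le> boundary_norm \<Phi> {0} D"
        using m by (intro boundary_norm_mono[OF \<Phi>]) auto
      then show ?thesis using True D(2) by (simp add: boundary_norm_site[OF \<Phi>, of x])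
    next
      case False
      then show ?thesis
        by (simp add: boundary_norm_site[OF \<Phi>, of x] T_def boundary_norm_mono[OF \<Phi>])
    qed
    have "boundary_norm \<Phi> (cube n) (cube n) \<le> (\<Sum>x\<in>cube n. boundary_norm \<Phi> {x} (cube n))"
      by (rule boundary_norm_le_sum[OF \<Phi> finite_cube])
    also have "\<dots> \<le> (\<Sum>x\<in>(cube n :: (int^'d) set). if x \<in> cube (n - m) then d / 2 else T)"
      by (rule sum_mono) (rule site)
    also have "\<dots> = d / 2 * cube_size TYPE('d) (n - m) + T * (?c - cube_size TYPE('d) (n - m))"
    proof -
      have s: "cube (n - m) \<subseteq> (cube n :: (int^'d) set)" by (rule cube_mono) simp
      then have "(cube n :: (int^'d) set) \<inter> {x. x \<in> cube (n - m)} = cube (n - m)"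
        "(cube n :: (int^'d) set) \<inter> - {x. x \<in> cube (n - m)} = cube n - cube (n - m)" by auto
      then show ?thesis using card_mono[OF finite_cube s]
        by (subst sum.If_cases) (simp_all add: card_Diff_subset[OF finite_cube s] of_nat_diff)
    qed
    also have "\<dots> \<le> d / 2 * ?c + T * (d / (2 * (T + 1)) * ?c)"
      using elim d T by (intro add_mono mult_left_mono cube_size_mono) auto
    also have "\<dots> \<le> d / 2 * ?c + d / 2 * ?c"
    proof -
      have "T * (d / (2 * (T + 1))) \<le> d / 2" using T d by (simp add: field_simps)
      then have "T * (d / (2 * (T + 1))) * ?c \<le> d / 2 * ?c" by (intro mult_right_mono) auto
      then have "T * (d / (2 * (T + 1)) * ?c) \<le> d / 2 * ?c" by (simp only: mult.assoc)
      then show ?thesis by linarith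
    qed
    finally show ?case by (simp add: field_simps)
  qed
qed

section \<open>Conditional pattern probabilities and the DLR equation\<close>

definition gibbs_prob :: "'g potential \<Rightarrow> 'g set \<Rightarrow> 'g config \<Rightarrow> 'g config \<Rightarrow> real" where
  "gibbs_prob \<Phi> \<Lambda> a \<eta> = gibbs_weight \<Phi> \<Lambda> \<eta> a / (\<Sum>\<xi>\<in>\<Lambda> \<rightarrow>\<^sub>E UNIV. gibbs_weight \<Phi> \<Lambda> \<eta> \<xi>)"

lemma patterns_nonempty [simp]: "(\<Lambda> \<rightarrow>\<^sub>E (UNIV :: bool set)) \<noteq> {}"
  by (simp add: PiE_eq_empty_iff)

lemma gibbs_weight_sum_pos:
  "finite \<Lambda> \<Longrightarrow> (\<Sum>\<xi>\<in>\<Lambda> \<rightarrow>\<^sub>E UNIV. gibbs_weight \<Phi> \<Lambda> \<eta> \<xi>) > 0"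
  by (intro sum_pos) (auto simp: gibbs_weight_def)

lemma gibbs_prob_pos: "finite \<Lambda> \<Longrightarrow> gibbs_prob \<Phi> \<Lambda> a \<eta> > 0"
  unfolding gibbs_prob_def by (intro divide_pos_pos gibbs_weight_sum_pos) (auto simp: gibbs_weight_def)

lemma override_on_cong: "(\<And>x. x \<in> A \<Longrightarrow> g x = h x) \<Longrightarrow> override_on f g A = override_on f h A"
  by (auto simp: override_on_def)

lemma gibbs_weight_restrict: "gibbs_weight \<Phi> \<Lambda> \<eta> (restrict a \<Lambda>) = gibbs_weight \<Phi> \<Lambda> \<eta> a"
  unfolding gibbs_weight_def by (subst override_on_cong[of \<Lambda> "restrict a \<Lambda>" a]) auto

lemma gibbs_prob_le_1:
  assumes "finite \<Lambda>"
  shows "gibbs_prob \<Phi> \<Lambda> a \<eta> \<le> 1"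
proof -
  have "gibbs_weight \<Phi> \<Lambda> \<eta> (restrict a \<Lambda>) \<le> (\<Sum>\<xi>\<in>\<Lambda> \<rightarrow>\<^sub>E UNIV. gibbs_weight \<Phi> \<Lambda> \<eta> \<xi>)"
    by (rule member_le_sum) (use assms in \<open>auto simp: gibbs_weight_def\<close>)
  then show ?thesis
    using gibbs_weight_sum_pos[OF assms, of \<Phi> \<eta>]
    by (simp add: gibbs_prob_def gibbs_weight_restrict divide_le_eq)
qed

lemma gibbs_weight_compare:
  assumes \<Phi>: "ti_summable_potential \<Phi>" and \<Lambda>: "finite \<Lambda>" and eq: "\<And>x. x \<in> D - \<Lambda> \<Longrightarrow> \<eta> x = \<eta>' x"
  shows "gibbs_weight \<Phi> \<Lambda> \<eta> a \<le> exp (2 * boundary_norm \<Phi> \<Lambda> D) * gibbs_weight \<Phi> \<Lambda> \<eta>' a"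
proof -
  have "\<bar>hamiltonian \<Phi> \<Lambda> (override_on \<eta> a \<Lambda>) - hamiltonian \<Phi> \<Lambda> (override_on \<eta>' a \<Lambda>)\<bar> \<le> 2 * boundary_norm \<Phi> \<Lambda> D"
    by (rule hamiltonian_diff_le[OF \<Phi> \<Lambda>]) (use eq in \<open>auto simp: override_on_def\<close>)
  then show ?thesis by (simp add: gibbs_weight_def exp_add[symmetric])
qed

text \<open>Changing the boundary condition costs exp(2 \<open>boundary_norm\<close>) in the weight
  of \<open>a\<close> and the same again in the partition function.\<close>

lemma gibbs_prob_compare:
  assumes \<Phi>: "ti_summable_potential \<Phi>" and \<Lambda>: "finite \<Lambda>" and eq: "\<And>x. x \<in> D - \<Lambda> \<Longrightarrow> \<eta> x = \<eta>' x"
  shows "gibbs_prob \<Phi> \<Lambda> a \<eta> \<le> exp (4 * boundary_norm \<Phi> \<Lambda> D) * gibbs_prob \<Phi> \<Lambda> a \<eta>'"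
proof -
  let ?b = "2 * boundary_norm \<Phi> \<Lambda> D"
  let ?Z = "\<lambda>\<eta>. \<Sum>\<xi>\<in>\<Lambda> \<rightarrow>\<^sub>E UNIV. gibbs_weight \<Phi> \<Lambda> \<eta> \<xi>"
  have "?Z \<eta>' \<le> exp ?b * ?Z \<eta>"
    unfolding sum_distrib_left by (intro sum_mono gibbs_weight_compare[OF \<Phi> \<Lambda>]) (use eq in auto)
  then have "1 / ?Z \<eta> \<le> exp ?b / ?Z \<eta>'"
    using gibbs_weight_sum_pos[OF \<Lambda>, of \<Phi>] by (simp add: field_simps)
  then have "gibbs_weight \<Phi> \<Lambda> \<eta> a * (1 / ?Z \<eta>) \<le> (exp ?b * gibbs_weight \<Phi> \<Lambda> \<eta>' a) * (exp ?b / ?Z \<eta>')"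
    using gibbs_weight_sum_pos[OF \<Lambda>, of \<Phi> \<eta>]
    by (intro mult_mono gibbs_weight_compare[OF \<Phi> \<Lambda> eq]) (auto simp: gibbs_weight_def)
  also have "\<dots> = exp (?b + ?b) * gibbs_prob \<Phi> \<Lambda> a \<eta>'"
    unfolding exp_add by (simp add: gibbs_prob_def)
  finally show ?thesis by (simp add: gibbs_prob_def)
qed

lemma gibbs_prob_modulus:
  fixes \<Phi> :: "'g::ab_group_add potential"
  assumes \<Phi>: "ti_summable_potential \<Phi>" and \<Lambda>: "finite \<Lambda>" and e: "e > 0"
  obtains D where "finite D" "\<And>\<eta> \<eta>' a. (\<And>x. x \<in> D - \<Lambda> \<Longrightarrow> \<eta> x = \<eta>' x) \<Longrightarrow>
      gibbs_prob \<Phi> \<Lambda> a \<eta> \<le> exp e * gibbs_prob \<Phi> \<Lambda> a \<eta>'"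
proof -
  obtain D where D: "finite D" "boundary_norm \<Phi> \<Lambda> D \<le> e / 4"
    using boundary_norm_small[OF \<Phi> \<Lambda>, of "e/4"] e by auto
  show thesis
  proof (rule that[OF D(1)])
    fix \<eta> \<eta>' a :: "'g config" assume "\<And>x. x \<in> D - \<Lambda> \<Longrightarrow> \<eta> x = \<eta>' x"
    then have "gibbs_prob \<Phi> \<Lambda> a \<eta> \<le> exp (4 * boundary_norm \<Phi> \<Lambda> D) * gibbs_prob \<Phi> \<Lambda> a \<eta>'"
      by (rule gibbs_prob_compare[OF \<Phi> \<Lambda>])
    also have "\<dots> \<le> exp e * gibbs_prob \<Phi> \<Lambda> a \<eta>'"
      using D(2) gibbs_prob_pos[OF \<Lambda>, of \<Phi> a \<eta>'] by (intro mult_right_mono) auto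
    finally show "gibbs_prob \<Phi> \<Lambda> a \<eta> \<le> exp e * gibbs_prob \<Phi> \<Lambda> a \<eta>'" .
  qed
qed

text \<open>The comparison is used with D equal to the cube itself, so that the two boundary
  conditions are arbitrary; the boundary energy is of smaller order than the volume.\<close>

lemma gibbs_prob_cube_uniform:
  fixes \<Phi> :: "(int^'d::finite) potential"
  assumes \<Phi>: "ti_summable_potential \<Phi>" and d: "d > 0"
  shows "eventually (\<lambda>n. \<forall>a \<eta> \<eta>'. gibbs_prob \<Phi> (cube n) a \<eta> \<le>
           exp (d * cube_size TYPE('d) n) * gibbs_prob \<Phi> (cube n) a \<eta>') sequentially"
proof -
  have "d / 4 > 0" using d by simp
  from boundary_norm_cube[OF \<Phi> this] show ?thesis
  proof eventually_elim
    case (elim n)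
    show ?case
    proof (intro allI)
      fix a \<eta> \<eta>'
      have "gibbs_prob \<Phi> (cube n) a \<eta> \<le> exp (4 * boundary_norm \<Phi> (cube n) (cube n)) * gibbs_prob \<Phi> (cube n) a \<eta>'"
        by (rule gibbs_prob_compare[OF \<Phi> finite_cube]) auto
      also have "\<dots> \<le> exp (d * cube_size TYPE('d) n) * gibbs_prob \<Phi> (cube n) a \<eta>'"
        using elim gibbs_prob_pos[OF finite_cube, of \<Phi> n a \<eta>'] by (intro mult_right_mono) auto
      finally show "gibbs_prob \<Phi> (cube n) a \<eta> \<le> exp (d * cube_size TYPE('d) n) * gibbs_prob \<Phi> (cube n) a \<eta>'" .
    qed
  qed
qed

lemma hamiltonian_quasilocal:
  assumes \<Phi>: "ti_summable_potential \<Phi>" and \<Lambda>: "finite \<Lambda>"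
  shows "quasilocal (hamiltonian \<Phi> \<Lambda>)"
  unfolding quasilocal_def
proof (intro allI impI)
  fix e :: real assume "e > 0"
  then obtain D where D: "finite D" "boundary_norm \<Phi> \<Lambda> D \<le> e / 2"
    using boundary_norm_small[OF \<Phi> \<Lambda>, of "e/2"] by auto
  have "\<bar>hamiltonian \<Phi> \<Lambda> \<sigma> - hamiltonian \<Phi> \<Lambda> \<sigma>'\<bar> \<le> e" if "\<forall>x\<in>D. \<sigma> x = \<sigma>' x" for \<sigma> \<sigma>'
    using hamiltonian_diff_le[OF \<Phi> \<Lambda>, of D \<sigma> \<sigma>'] that D(2) by auto
  then show "\<exists>A. finite A \<and> (\<forall>\<sigma> \<sigma>'. (\<forall>x\<in>A. \<sigma> x = \<sigma>' x) \<longrightarrow> \<bar>hamiltonian \<Phi> \<Lambda> \<sigma> - hamiltonian \<Phi> \<Lambda> \<sigma>'\<bar> \<le> e)"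
    using D(1) by blast
qed

lemma override_measurable:
  "(\<lambda>\<eta>. override_on \<eta> a \<Lambda>) \<in> (borel :: ('g::countable) config measure) \<rightarrow>\<^sub>M borel"
proof (rule measurable_configI)
  fix x
  show "(\<lambda>\<eta>. override_on \<eta> a \<Lambda> x) \<in> (borel :: 'g config measure) \<rightarrow>\<^sub>M count_space UNIV"
    by (cases "x \<in> \<Lambda>") (simp_all add: override_on_def)
qed

lemma gibbs_prob_measurable:
  fixes \<Phi> :: "'g::{ab_group_add,countable} potential"
  assumes \<Phi>: "ti_summable_potential \<Phi>" and \<Lambda>: "finite \<Lambda>"
  shows "gibbs_prob \<Phi> \<Lambda> a \<in> borel_measurable borel"
proof -
  have [measurable]: "(\<lambda>\<eta>. gibbs_weight \<Phi> \<Lambda> \<eta> \<xi>) \<in> borel_measurable borel" for \<xi>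
    unfolding gibbs_weight_def
    using measurable_compose[OF override_measurable quasilocal_measurable[OF hamiltonian_quasilocal[OF \<Phi> \<Lambda>]], of \<xi> \<Lambda>]
    by measurable
  show ?thesis unfolding gibbs_prob_def[abs_def] by measurable
qed

lemma gibbs_specification_cylinder:
  assumes \<Lambda>: "finite \<Lambda>" and B: "depends_only_on (- \<Lambda>) (\<lambda>\<sigma>. \<sigma> \<in> B)"
  shows "gibbs_specification \<Phi> \<Lambda> \<eta> (cylinder \<Lambda> a \<inter> B) = gibbs_prob \<Phi> \<Lambda> a \<eta> * indicator B \<eta>"
proof -
  have inB: "override_on \<eta> \<xi> \<Lambda> \<in> B \<longleftrightarrow> \<eta> \<in> B" for \<xi>
    by (rule depends_only_onD[OF B]) (simp add: override_on_def)
  have incyl: "override_on \<eta> \<xi> \<Lambda> \<in> cylinder \<Lambda> a \<longleftrightarrow> \<xi> = restrict a \<Lambda>" if "\<xi> \<in> \<Lambda> \<rightarrow>\<^sub>E UNIV" for \<xi>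
    using that by (auto simp: in_cylinder_iff fun_eq_iff PiE_def extensional_def override_on_def)
  have "(\<Sum>\<xi>\<in>\<Lambda> \<rightarrow>\<^sub>E UNIV. gibbs_weight \<Phi> \<Lambda> \<eta> \<xi> * indicator (cylinder \<Lambda> a \<inter> B) (override_on \<eta> \<xi> \<Lambda>)) =
      (\<Sum>\<xi>\<in>\<Lambda> \<rightarrow>\<^sub>E UNIV. if \<xi> = restrict a \<Lambda> then gibbs_weight \<Phi> \<Lambda> \<eta> \<xi> * indicator B \<eta> else 0)"
    by (intro sum.cong refl) (auto simp: incyl inB indicator_def)
  also have "\<dots> = gibbs_weight \<Phi> \<Lambda> \<eta> a * indicator B \<eta>"
    using \<Lambda> by (subst sum.delta) (auto simp: gibbs_weight_restrict)
  finally show ?thesis by (simp add: gibbs_specification_def gibbs_prob_def)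
qed

lemma gibbs_measure_config: "gibbs_measure \<Phi> \<mu> \<Longrightarrow> \<mu> \<in> config_measures"
  by (simp add: gibbs_measure_def)

text \<open>The DLR equation is given for events. Resetting the spins in \<Lambda> to +1 turns every
  Borel set into an event that ignores \<Lambda>, and the equation then says that two densities, of
  the cylinder indicator and of \<open>gibbs_prob\<close>, have the same image measure. As
  \<open>g\<close> ignores the reset, integrating it against this common image gives the claim for
  functions.\<close>

lemma DLR_integral:
  fixes \<Phi> :: "'g::{ab_group_add,countable} potential" and g :: "'g config \<Rightarrow> real"
  assumes \<Phi>: "ti_summable_potential \<Phi>" and \<mu>: "gibbs_measure \<Phi> \<mu>" and \<Lambda>: "finite \<Lambda>"
    and g: "depends_only_on (- \<Lambda>) g" and gm: "g \<in> borel_measurable borel"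
  shows "(\<integral>\<eta>. indicator (cylinder \<Lambda> a) \<eta> * g \<eta> \<partial>\<mu>) = (\<integral>\<eta>. gibbs_prob \<Phi> \<Lambda> a \<eta> * g \<eta> \<partial>\<mu>)"
proof -
  have cm: "\<mu> \<in> config_measures" by (rule gibbs_measure_config[OF \<mu>])
  interpret prob_space \<mu> by (rule config_measuresD[OF cm])
  have sets: "sets \<mu> = sets borel" by (rule config_measuresD[OF cm])
  note gp = gibbs_prob_measurable[OF \<Phi> \<Lambda>, of a]
  let ?T = "\<lambda>\<eta>. override_on \<eta> (\<lambda>_. True) \<Lambda>"
  have Tm: "?T \<in> M \<rightarrow>\<^sub>M borel" if "sets M = sets borel" for M
    by (subst measurable_cong_sets[OF that refl]) (rule override_measurable)
  define M1 where "M1 = distr (density \<mu> (indicator (cylinder \<Lambda> a))) borel ?T"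
  define M2 where "M2 = distr (density \<mu> (\<lambda>\<eta>. ennreal (gibbs_prob \<Phi> \<Lambda> a \<eta>))) borel ?T"
  have "M1 = M2"
  proof (rule measure_eqI)
    show "sets M1 = sets M2" by (simp add: M1_def M2_def)
    fix B assume "B \<in> sets M1"
    then have B: "B \<in> sets borel" by (simp add: M1_def)
    define B' where "B' = ?T -` B"
    have B': "B' \<in> sets borel"
      using measurable_sets[OF override_measurable B, of "\<lambda>_. True" \<Lambda>] by (simp add: B'_def)
    have dep: "depends_only_on (- \<Lambda>) (\<lambda>\<sigma>. \<sigma> \<in> B')"
    proof -
      have "?T \<sigma> = ?T \<sigma>'" if "\<forall>x\<in>- \<Lambda>. \<sigma> x = \<sigma>' x" for \<sigma> \<sigma>'
        using that by (auto simp: override_on_def)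
      then show ?thesis unfolding depends_only_on_def B'_def by (metis vimage_eq)
    qed
    have "emeasure M1 B = emeasure (density \<mu> (indicator (cylinder \<Lambda> a))) B'"
      unfolding M1_def B'_def using B config_measuresD(3)[OF cm]
      by (subst emeasure_distr[OF Tm]) (auto simp: sets space_density)
    also have "\<dots> = (\<integral>\<^sup>+\<eta>. indicator (cylinder \<Lambda> a) \<eta> * indicator B' \<eta> \<partial>\<mu>)"
      by (subst emeasure_density) (use B' \<Lambda> sets in auto)
    also have "\<dots> = (\<integral>\<^sup>+\<eta>. indicator (cylinder \<Lambda> a \<inter> B') \<eta> \<partial>\<mu>)"
      by (intro nn_integral_cong) (auto simp: indicator_def)
    also have "\<dots> = emeasure \<mu> (cylinder \<Lambda> a \<inter> B')"
      using B' \<Lambda> sets by simp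
    also have "\<dots> = ennreal (\<integral>\<eta>. gibbs_specification \<Phi> \<Lambda> \<eta> (cylinder \<Lambda> a \<inter> B') \<partial>\<mu>)"
      using \<mu> \<Lambda> B' unfolding gibbs_measure_def by (simp add: emeasure_eq_measure)
    also have "\<dots> = ennreal (\<integral>\<eta>. gibbs_prob \<Phi> \<Lambda> a \<eta> * indicator B' \<eta> \<partial>\<mu>)"
      by (simp add: gibbs_specification_cylinder[OF \<Lambda> dep])
    also have "\<dots> = (\<integral>\<^sup>+\<eta>. ennreal (gibbs_prob \<Phi> \<Lambda> a \<eta> * indicator B' \<eta>) \<partial>\<mu>)"
      using gibbs_prob_le_1[OF \<Lambda>] gibbs_prob_pos[OF \<Lambda>, THEN less_imp_le]
      by (intro nn_integral_eq_integral[symmetric] bounded_integrable[OF cm, of _ 1])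
         (use gp B' in \<open>auto simp: indicator_def\<close>)
    also have "\<dots> = (\<integral>\<^sup>+\<eta>. ennreal (gibbs_prob \<Phi> \<Lambda> a \<eta>) * indicator B' \<eta> \<partial>\<mu>)"
      by (intro nn_integral_cong) (auto simp: indicator_def)
    also have "\<dots> = emeasure (density \<mu> (\<lambda>\<eta>. ennreal (gibbs_prob \<Phi> \<Lambda> a \<eta>))) B'"
      by (subst emeasure_density) (use B' sets gp in \<open>auto simp: config_measuresD(4)[OF cm]\<close>)
    also have "\<dots> = emeasure M2 B"
      unfolding M2_def B'_def using B config_measuresD(3)[OF cm]
      by (subst emeasure_distr[OF Tm]) (auto simp: sets space_density)
    finally show "emeasure M1 B = emeasure M2 B" .
  qed
  have gT: "g (?T \<eta>) = g \<eta>" for \<eta>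
    by (rule depends_only_onD[OF g]) (simp add: override_on_def)
  have gm\<mu>: "g \<in> borel_measurable \<mu>" using gm by (simp add: config_measuresD(4)[OF cm])
  have "(\<integral>\<eta>. g \<eta> \<partial>M1) = (\<integral>\<eta>. indicator (cylinder \<Lambda> a) \<eta> * g \<eta> \<partial>\<mu>)"
  proof -
    have "(\<integral>\<eta>. g \<eta> \<partial>M1) = (\<integral>\<eta>. g (?T \<eta>) \<partial>density \<mu> (indicator (cylinder \<Lambda> a)))"
      unfolding M1_def by (rule integral_distr[OF Tm gm]) (simp add: sets)
    also have "density \<mu> (indicator (cylinder \<Lambda> a)) = density \<mu> (\<lambda>\<eta>. ennreal (indicator (cylinder \<Lambda> a) \<eta>))"
      by (intro arg_cong[where f="density \<mu>"] ext) (simp add: indicator_def)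
    also have "(\<integral>\<eta>. g (?T \<eta>) \<partial>\<dots>) = (\<integral>\<eta>. indicator (cylinder \<Lambda> a) \<eta> *\<^sub>R g \<eta> \<partial>\<mu>)"
      unfolding gT by (rule integral_density) (use gm\<mu> \<Lambda> sets in auto)
    finally show ?thesis by simp
  qed
  moreover have "(\<integral>\<eta>. g \<eta> \<partial>M2) = (\<integral>\<eta>. gibbs_prob \<Phi> \<Lambda> a \<eta> * g \<eta> \<partial>\<mu>)"
  proof -
    have "(\<integral>\<eta>. g \<eta> \<partial>M2) = (\<integral>\<eta>. g (?T \<eta>) \<partial>density \<mu> (\<lambda>\<eta>. ennreal (gibbs_prob \<Phi> \<Lambda> a \<eta>)))"
      unfolding M2_def by (rule integral_distr[OF Tm gm]) (simp add: sets)
    also have "\<dots> = (\<integral>\<eta>. gibbs_prob \<Phi> \<Lambda> a \<eta> *\<^sub>R g \<eta> \<partial>\<mu>)"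
      unfolding gT
      by (rule integral_density) (use gm\<mu> gp config_measuresD(4)[OF cm] gibbs_prob_pos[OF \<Lambda>, THEN less_imp_le] in auto)
    finally show ?thesis by simp
  qed
  ultimately show ?thesis by (simp add: \<open>M1 = M2\<close>)
qed

lemma gibbs_cylinder_measure:
  fixes \<Phi> :: "'g::{ab_group_add,countable} potential"
  assumes \<Phi>: "ti_summable_potential \<Phi>" and \<mu>: "gibbs_measure \<Phi> \<mu>" and \<Lambda>: "finite \<Lambda>"
  shows "measure \<mu> (cylinder \<Lambda> a) = (\<integral>\<eta>. gibbs_prob \<Phi> \<Lambda> a \<eta> \<partial>\<mu>)"
  using DLR_integral[OF \<Phi> \<mu> \<Lambda>, of "\<lambda>_. 1" a] integral_indicator_config[OF gibbs_measure_config[OF \<mu>], of "cylinder \<Lambda> a"] \<Lambda>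
  by (simp add: depends_only_on_def)

lemma gibbs_prob_integrable:
  fixes \<Phi> :: "'g::{ab_group_add,countable} potential"
  assumes \<Phi>: "ti_summable_potential \<Phi>" and \<mu>: "\<mu> \<in> config_measures" and \<Lambda>: "finite \<Lambda>"
  shows "integrable \<mu> (gibbs_prob \<Phi> \<Lambda> a)"
  using gibbs_prob_le_1[OF \<Lambda>] gibbs_prob_pos[OF \<Lambda>, THEN less_imp_le]
  by (intro bounded_integrable[OF \<mu> gibbs_prob_measurable[OF \<Phi> \<Lambda>], of _ 1]) auto

text \<open>The probability of a cylinder is the average of \<open>gibbs_prob\<close> over boundary
  conditions, so a bound uniform in pairs of boundary conditions passes to the average.\<close>

lemma gibbs_prob_vs_measure:
  fixes \<Phi> :: "'g::{ab_group_add,countable} potential"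
  assumes \<Phi>: "ti_summable_potential \<Phi>" and \<mu>: "gibbs_measure \<Phi> \<mu>" and \<Lambda>: "finite \<Lambda>"
    and cmp: "\<And>\<eta> \<eta>'. gibbs_prob \<Phi> \<Lambda> a \<eta> \<le> c * gibbs_prob \<Phi> \<Lambda> a \<eta>'"
  shows "gibbs_prob \<Phi> \<Lambda> a \<eta> \<le> c * measure \<mu> (cylinder \<Lambda> a)"
    and "measure \<mu> (cylinder \<Lambda> a) \<le> c * gibbs_prob \<Phi> \<Lambda> a \<eta>"
proof -
  have cm: "\<mu> \<in> config_measures" by (rule gibbs_measure_config[OF \<mu>])
  interpret prob_space \<mu> by (rule config_measuresD[OF cm])
  note int = gibbs_prob_integrable[OF \<Phi> cm \<Lambda>, of a]
  have "(\<integral>\<eta>'. gibbs_prob \<Phi> \<Lambda> a \<eta> \<partial>\<mu>) \<le> (\<integral>\<eta>'. c * gibbs_prob \<Phi> \<Lambda> a \<eta>' \<partial>\<mu>)"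
    by (intro integral_mono cmp) (use int in auto)
  then show "gibbs_prob \<Phi> \<Lambda> a \<eta> \<le> c * measure \<mu> (cylinder \<Lambda> a)"
    by (simp add: gibbs_cylinder_measure[OF \<Phi> \<mu> \<Lambda>] prob_space)
  have "(\<integral>\<eta>'. gibbs_prob \<Phi> \<Lambda> a \<eta>' \<partial>\<mu>) \<le> (\<integral>\<eta>'. c * gibbs_prob \<Phi> \<Lambda> a \<eta> \<partial>\<mu>)"
    by (intro integral_mono cmp) (use int in auto)
  then show "measure \<mu> (cylinder \<Lambda> a) \<le> c * gibbs_prob \<Phi> \<Lambda> a \<eta>"
    by (simp add: gibbs_cylinder_measure[OF \<Phi> \<mu> \<Lambda>] prob_space)
qed

text \<open>With D empty the comparison holds between any two boundary conditions, at a cost that is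
  large but finite for fixed \<Lambda>.\<close>

lemma gibbs_cylinder_pos:
  fixes \<Phi> :: "'g::{ab_group_add,countable} potential"
  assumes \<Phi>: "ti_summable_potential \<Phi>" and \<mu>: "gibbs_measure \<Phi> \<mu>" and \<Lambda>: "finite \<Lambda>"
  shows "measure \<mu> (cylinder \<Lambda> a) > 0"
proof -
  let ?c = "exp (4 * boundary_norm \<Phi> \<Lambda> {})"
  have "gibbs_prob \<Phi> \<Lambda> a \<eta> \<le> ?c * gibbs_prob \<Phi> \<Lambda> a \<eta>'" for \<eta> \<eta>'
    by (rule gibbs_prob_compare[OF \<Phi> \<Lambda>]) auto
  then have "gibbs_prob \<Phi> \<Lambda> a (\<lambda>_. True) \<le> ?c * measure \<mu> (cylinder \<Lambda> a)"
    by (rule gibbs_prob_vs_measure(1)[OF \<Phi> \<mu> \<Lambda>])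
  then show ?thesis
    using gibbs_prob_pos[OF \<Lambda>, of \<Phi> a "\<lambda>_. True"]
    by (smt (verit) exp_gt_zero measure_nonneg mult_eq_0_iff)
qed

section \<open>Entropy of dominated measures\<close>

lemma relative_entropy_le:
  fixes \<mu> \<nu> :: "('g::countable) config measure"
  assumes \<mu>: "\<mu> \<in> config_measures" and \<nu>: "\<nu> \<in> config_measures" and \<Lambda>: "finite \<Lambda>"
    and dom: "\<And>a. measure \<nu> (cylinder \<Lambda> a) \<le> exp c * measure \<mu> (cylinder \<Lambda> a)"
  shows "relative_entropy \<Lambda> \<nu> \<mu> \<le> ereal c"
proof -
  have ac: "measure \<mu> (cylinder \<Lambda> a) = 0 \<longrightarrow> measure \<nu> (cylinder \<Lambda> a) = 0" for a
    using dom[of a] by (auto simp: measure_le_0_iff)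
  have "pattern_entropy \<Lambda> \<nu> \<mu> \<le> (\<Sum>\<xi>\<in>\<Lambda> \<rightarrow>\<^sub>E UNIV. measure \<nu> (cylinder \<Lambda> \<xi>) * c)"
    unfolding pattern_entropy_def
  proof (rule sum_mono)
    fix \<xi>
    show "measure \<nu> (cylinder \<Lambda> \<xi>) * ln (measure \<nu> (cylinder \<Lambda> \<xi>) / measure \<mu> (cylinder \<Lambda> \<xi>)) \<le> measure \<nu> (cylinder \<Lambda> \<xi>) * c"
    proof (cases "measure \<nu> (cylinder \<Lambda> \<xi>) = 0")
      case False
      then have pos: "measure \<nu> (cylinder \<Lambda> \<xi>) > 0" "measure \<mu> (cylinder \<Lambda> \<xi>) > 0"
        using ac[of \<xi>] by (auto simp: less_le measure_nonneg)
      then have "ln (measure \<nu> (cylinder \<Lambda> \<xi>) / measure \<mu> (cylinder \<Lambda> \<xi>)) \<le> ln (exp c)"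
        using dom[of \<xi>] by (subst ln_le_cancel_iff) (auto simp: divide_le_eq)
      then show ?thesis using pos by (intro mult_left_mono) auto
    qed simp
  qed
  also have "\<dots> = c"
    by (simp add: sum_distrib_right[symmetric] sum_cylinder_measure[OF \<nu> \<Lambda>])
  finally show ?thesis using ac by (auto simp: relative_entropy_def pattern_entropy_def)
qed

lemma liminf_entropy_le_0:
  fixes \<mu> \<nu> :: "(int^'d::finite) config measure"
  assumes \<mu>: "\<mu> \<in> config_measures" and \<nu>: "\<nu> \<in> config_measures"
    and dom: "\<And>d. d > 0 \<Longrightarrow> eventually (\<lambda>n. \<forall>a. measure \<nu> (cylinder (cube n) a) \<le>
        exp (d * cube_size TYPE('d) n) * measure \<mu> (cylinder (cube n) a)) sequentially"
  shows "liminf (entropy_per_site \<nu> \<mu>) \<le> 0"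
proof (rule ereal_le_epsilon2)
  fix d :: real assume d: "0 < d"
  have "eventually (\<lambda>n. entropy_per_site \<nu> \<mu> n \<le> ereal d) sequentially"
    using dom[OF d]
  proof eventually_elim
    case (elim n)
    have "relative_entropy (cube n) \<nu> \<mu> \<le> ereal (d * cube_size TYPE('d) n)"
      by (rule relative_entropy_le[OF \<mu> \<nu> finite_cube]) (use elim in blast)
    then show ?case
      using cube_size_pos[where 'd='d, of n] unfolding entropy_per_site_def
      by (simp add: ereal_divide_le_pos mult.commute)
  qed
  then have "limsup (entropy_per_site \<nu> \<mu>) \<le> ereal d" by (rule Limsup_bounded)
  then show "liminf (entropy_per_site \<nu> \<mu>) \<le> 0 + ereal d"
    using Liminf_le_Limsup[of sequentially "entropy_per_site \<nu> \<mu>"] by (simp add: order_trans)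
qed

text \<open>Both measures are compared with the same \<open>gibbs_prob\<close> at the all-plus
  boundary condition; each comparison spends half of the exponent.\<close>

lemma common_potential_entropy:
  fixes \<mu> \<nu> :: "(int^'d::finite) config measure"
  assumes \<Psi>: "ti_summable_potential \<Psi>" and \<mu>: "gibbs_measure \<Psi> \<mu>" and \<nu>: "gibbs_measure \<Psi> \<nu>"
  shows "liminf (entropy_per_site \<nu> \<mu>) \<le> 0"
proof (rule liminf_entropy_le_0[OF gibbs_measure_config[OF \<mu>] gibbs_measure_config[OF \<nu>]])
  fix d :: real assume d: "d > 0"
  then have "d / 2 > 0" by simp
  from gibbs_prob_cube_uniform[OF \<Psi> this]
  show "eventually (\<lambda>n. \<forall>a. measure \<nu> (cylinder (cube n) a) \<le>
        exp (d * cube_size TYPE('d) n) * measure \<mu> (cylinder (cube n) a)) sequentially"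
  proof eventually_elim
    case (elim n)
    show ?case
    proof
      fix a
      let ?c = "exp (d / 2 * cube_size TYPE('d) n)" and ?g = "gibbs_prob \<Psi> (cube n) a (\<lambda>_. True)"
      have "measure \<nu> (cylinder (cube n) a) \<le> ?c * ?g"
        by (rule gibbs_prob_vs_measure(2)[OF \<Psi> \<nu> finite_cube]) (use elim in blast)
      also have "\<dots> \<le> ?c * (?c * measure \<mu> (cylinder (cube n) a))"
        by (intro mult_left_mono gibbs_prob_vs_measure(1)[OF \<Psi> \<mu> finite_cube]) (use elim in auto)
      also have "\<dots> = exp (d * cube_size TYPE('d) n) * measure \<mu> (cylinder (cube n) a)"
        by (simp add: exp_add[symmetric] mult.assoc[symmetric])
      finally show "measure \<nu> (cylinder (cube n) a) \<le> exp (d * cube_size TYPE('d) n) * measure \<mu> (cylinder (cube n) a)" .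
    qed
  qed
qed

section \<open>The Markov property of the path measure\<close>

lemma measurable_coordinate_past:
  fixes x :: "'g::countable"
  assumes "s \<le> t"
  shows "(\<lambda>\<omega>. \<omega> (x, s)) \<in> past_algebra t \<rightarrow>\<^sub>M count_space UNIV"
proof -
  let ?I = "UNIV \<times> {..t} :: ('g \<times> int) set"
  have r: "(\<lambda>\<omega>. restrict \<omega> ?I) \<in> past_algebra t \<rightarrow>\<^sub>M PiM ?I (\<lambda>_. count_space (UNIV :: bool set))"
    unfolding past_algebra_def by (rule measurable_vimage_algebra1) (simp add: space_PiM)
  have "(\<lambda>\<omega>. \<omega> (x, s)) \<in> PiM ?I (\<lambda>_. count_space (UNIV :: bool set)) \<rightarrow>\<^sub>M count_space UNIV"
    by (rule measurable_component_singleton) (use assms in simp)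
  from measurable_compose[OF r this] show ?thesis using assms by simp
qed

lemma time_slice_measurable_past:
  fixes t :: int
  assumes "s \<le> t"
  shows "time_slice s \<in> past_algebra t \<rightarrow>\<^sub>M (borel :: ('g::countable) config measure)"
  by (rule measurable_configI) (simp add: time_slice_def measurable_coordinate_past[OF assms])

lemma space_past_algebra [simp]: "space (past_algebra t) = UNIV"
  by (simp add: past_algebra_def)

lemma sets_past_algebra_subset: "sets (past_algebra t :: ('g::countable \<times> int) config measure) \<subseteq> sets borel"
  unfolding past_algebra_def
proof (rule sets_image_in_sets)
  show "(\<lambda>\<omega>. restrict \<omega> (UNIV \<times> {..t})) \<in> (borel :: ('g \<times> int) config measure) \<rightarrow>\<^sub>M
      PiM (UNIV \<times> {..t}) (\<lambda>_. count_space UNIV)"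
    by (rule measurable_restrict) (rule measurable_spin_at)
qed simp

lemma time_slice_measurable [measurable]:
  "time_slice s \<in> borel \<rightarrow>\<^sub>M (borel :: ('g::countable) config measure)"
  by (rule measurable_configI) (simp add: time_slice_def)

lemma cylinder_past:
  fixes A :: "('g::countable \<times> int) set"
  assumes "finite A" "A \<subseteq> UNIV \<times> {..t}"
  shows "cylinder A \<omega> \<in> sets (past_algebra t)"
proof -
  have m: "(\<lambda>\<omega>. \<omega> z) \<in> past_algebra t \<rightarrow>\<^sub>M count_space UNIV" if "z \<in> A" for z
    using measurable_coordinate_past[of "snd z" t "fst z"] assms(2) that by auto
  have "{\<omega>' \<in> space (past_algebra t). \<omega>' z = \<omega> z} \<in> sets (past_algebra t)" if "z \<in> A" for z
    using measurable_sets[OF m[OF that], of "{\<omega> z}"] by (simp add: vimage_def)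
  then have "{\<omega>' \<in> space (past_algebra t). \<forall>z\<in>A. \<omega>' z = \<omega> z} \<in> sets (past_algebra t)"
    using assms(1) by (intro sets.sets_Collect_finite_All) auto
  then show ?thesis by (simp add: cylinder_def)
qed

lemma subalgebra_past:
  fixes M :: "('g::countable \<times> int) config measure"
  assumes "M \<in> config_measures"
  shows "subalgebra M (past_algebra t)"
  using sets_past_algebra_subset[of t] config_measuresD[OF assms] by (simp add: subalgebra_def)

lemma past_measurable_borel:
  fixes f :: "('g::countable \<times> int) config \<Rightarrow> 'b::topological_space"
  assumes "f \<in> borel_measurable (past_algebra t)"
  shows "f \<in> borel_measurable borel"
  using assms sets_past_algebra_subset[of t, where 'g='g] by (auto simp: measurable_def)

lemma past_measurable_mono:
  fixes f :: "('g::countable \<times> int) config \<Rightarrow> 'b::topological_space"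
  assumes "f \<in> borel_measurable (past_algebra s)" "s \<le> t"
  shows "f \<in> borel_measurable (past_algebra t)"
proof -
  have "sets (past_algebra s :: ('g \<times> int) config measure) \<subseteq> sets (past_algebra t)"
    unfolding past_algebra_def[of s]
  proof (rule sets_image_in_sets)
    show "(\<lambda>\<omega>. restrict \<omega> (UNIV \<times> {..s})) \<in> (past_algebra t :: ('g \<times> int) config measure) \<rightarrow>\<^sub>M
        PiM (UNIV \<times> {..s}) (\<lambda>_. count_space UNIV)"
    proof (rule measurable_restrict)
      fix z :: "'g \<times> int" assume "z \<in> UNIV \<times> {..s}"
      then show "(\<lambda>\<omega>. \<omega> z) \<in> past_algebra t \<rightarrow>\<^sub>M count_space UNIV"
        using measurable_coordinate_past[of "snd z" t "fst z"] assms(2) by auto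
    qed
  qed simp
  then show ?thesis using assms(1) by (auto simp: measurable_def)
qed

lemma path_space_lawD:
  assumes "path_space_law r \<nu> M"
  shows "M \<in> config_measures" "distr M borel (time_slice t) = \<nu>"
  using assms by (auto simp: path_space_law_def)

text \<open>The definition of the path law speaks of a past event and an event in the next slice.
  Both are extended to functions in turn: first the slice event, by identifying the law of the slice
  under the restricted measure, then the past event, by comparing two densities on the past
  algebra.\<close>

lemma markov_nn_integral:
  fixes r :: "('g::{ab_group_add,countable}) set \<Rightarrow> real"
  assumes r: "pca_coefficients r" and path: "path_space_law r \<nu> M"
    and u: "u \<in> borel_measurable (past_algebra t)" and g: "g \<in> borel_measurable borel"
  shows "(\<integral>\<^sup>+\<omega>. u \<omega> * g (time_slice (t + 1) \<omega>) \<partial>M) =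
         (\<integral>\<^sup>+\<omega>. u \<omega> * (\<integral>\<^sup>+\<sigma>. g \<sigma> \<partial>pca_kernel r (time_slice t \<omega>)) \<partial>M)"
proof -
  have cm: "M \<in> config_measures" by (rule path_space_lawD[OF path])
  interpret prob_space M by (rule config_measuresD[OF cm])
  interpret k: prob_space "pca_kernel r \<eta>" for \<eta> by (rule config_measuresD[OF pca_kernel_config])
  have sets: "sets M = sets borel" by (rule config_measuresD[OF cm])
  have slM: "time_slice s \<in> N \<rightarrow>\<^sub>M borel" if "sets N = sets borel" for s and N :: "('g \<times> int) config measure"
    by (subst measurable_cong_sets[OF that refl]) simp
  have bM: "borel_measurable M = (borel_measurable borel :: (_ \<Rightarrow> ennreal) set)"
    by (rule config_measuresD[OF cm])
  have km: "pca_kernel r \<in> borel \<rightarrow>\<^sub>M subprob_algebra borel"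
    by (rule measurable_prob_algebraD[OF pca_kernel_measurable[OF r]])
  let ?F1 = "\<lambda>\<omega>. g (time_slice (t + 1) \<omega>)"
  let ?F2 = "\<lambda>\<omega>. \<integral>\<^sup>+\<sigma>. g \<sigma> \<partial>pca_kernel r (time_slice t \<omega>)"
  have F1: "?F1 \<in> borel_measurable M"
    by (rule measurable_compose[OF slM[OF sets] g])
  have kg: "(\<lambda>\<eta>. \<integral>\<^sup>+\<sigma>. g \<sigma> \<partial>pca_kernel r \<eta>) \<in> borel_measurable borel"
    by (rule measurable_compose[OF km nn_integral_measurable_subprob_algebra[OF g]])
  have F2: "?F2 \<in> borel_measurable M"
    by (rule measurable_compose[OF slM[OF sets] kg])
  \<comment> \<open>For a fixed past event E let D be M restricted to E. The slice at time t + 1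
    under D then has the law of the slice at time t followed by one step of the kernel.\<close>
  have onsets: "(\<integral>\<^sup>+\<omega>. indicator E \<omega> * ?F1 \<omega> \<partial>M) = (\<integral>\<^sup>+\<omega>. indicator E \<omega> * ?F2 \<omega> \<partial>M)"
    if E: "E \<in> sets (past_algebra t)" for E
  proof -
    have EM: "E \<in> sets M" using E sets_past_algebra_subset[of t, where 'g='g] sets by auto
    define D where "D = density M (indicator E :: _ \<Rightarrow> ennreal)"
    have sD: "sets D = sets borel" by (simp add: D_def sets)
    have spD: "space D = UNIV" by (simp add: D_def space_density config_measuresD(3)[OF cm])
    have eq: "distr D borel (time_slice (t + 1)) = distr D borel (time_slice t) \<bind> pca_kernel r"
    proof (rule measure_eqI)
      show "sets (distr D borel (time_slice (t + 1))) = sets (distr D borel (time_slice t) \<bind> pca_kernel r)"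
        by (subst sets_bind) (auto simp: sets_pca_kernel)
      fix B assume "B \<in> sets (distr D borel (time_slice (t + 1)))"
      then have B: "B \<in> sets borel" by simp
      have tB: "time_slice (t + 1) -` B \<in> sets borel"
        using measurable_sets[OF time_slice_measurable B, of "t + 1"] by simp
      have "emeasure (distr D borel (time_slice (t + 1))) B = emeasure D (time_slice (t + 1) -` B)"
        using B by (subst emeasure_distr[OF slM[OF sD]]) (auto simp: spD)
      also have "\<dots> = (\<integral>\<^sup>+\<omega>. indicator E \<omega> * indicator (time_slice (t + 1) -` B) \<omega> \<partial>M)"
        unfolding D_def using EM tB sets by (subst emeasure_density) auto
      also have "\<dots> = (\<integral>\<^sup>+\<omega>. indicator (E \<inter> time_slice (t + 1) -` B) \<omega> \<partial>M)"
        by (intro nn_integral_cong) (auto simp: indicator_def)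
      also have "\<dots> = emeasure M (E \<inter> time_slice (t + 1) -` B)"
        using EM tB sets by simp
      also have "\<dots> = ennreal (\<integral>\<omega>. indicator E \<omega> * measure (pca_kernel r (time_slice t \<omega>)) B \<partial>M)"
        using path E B unfolding path_space_law_def by (simp add: emeasure_eq_measure)
      also have "\<dots> = (\<integral>\<^sup>+\<omega>. ennreal (indicator E \<omega> * measure (pca_kernel r (time_slice t \<omega>)) B) \<partial>M)"
      proof (rule nn_integral_eq_integral[symmetric])
        have "(\<lambda>\<eta>. measure (pca_kernel r \<eta>) B) \<in> borel_measurable borel"
          by (rule measurable_compose[OF km measurable_measure_subprob_algebra[OF B]])
        then have "(\<lambda>\<omega>. measure (pca_kernel r (time_slice t \<omega>)) B) \<in> borel_measurable M"
          by (rule measurable_compose[OF slM[OF sets]])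
        then show "integrable M (\<lambda>\<omega>. indicator E \<omega> * measure (pca_kernel r (time_slice t \<omega>)) B)"
          using EM by (intro integrable_const_bound[of _ 1]) (auto simp: indicator_def)
      qed (auto simp: indicator_def)
      also have "\<dots> = (\<integral>\<^sup>+\<omega>. indicator E \<omega> * emeasure (pca_kernel r (time_slice t \<omega>)) B \<partial>M)"
        by (intro nn_integral_cong) (auto simp: indicator_def k.emeasure_eq_measure)
      also have "\<dots> = (\<integral>\<^sup>+\<omega>. emeasure (pca_kernel r (time_slice t \<omega>)) B \<partial>D)"
      proof -
        have "(\<lambda>\<omega>. emeasure (pca_kernel r (time_slice t \<omega>)) B) \<in> borel_measurable M"
          by (rule measurable_compose[OF slM[OF sets]])
             (rule measurable_compose[OF km measurable_emeasure_subprob_algebra[OF B]])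
        then show ?thesis unfolding D_def using EM by (subst nn_integral_density) auto
      qed
      also have "\<dots> = (\<integral>\<^sup>+\<eta>. emeasure (pca_kernel r \<eta>) B \<partial>distr D borel (time_slice t))"
        by (subst nn_integral_distr[OF slM[OF sD]])
           (auto intro: measurable_compose[OF km measurable_emeasure_subprob_algebra[OF B]])
      also have "\<dots> = emeasure (distr D borel (time_slice t) \<bind> pca_kernel r) B"
        by (rule emeasure_bind[symmetric, OF _ _ B]) (use km in auto)
      finally show "emeasure (distr D borel (time_slice (t + 1))) B =
          emeasure (distr D borel (time_slice t) \<bind> pca_kernel r) B" .
    qed
    have "(\<integral>\<^sup>+\<omega>. indicator E \<omega> * ?F1 \<omega> \<partial>M) = (\<integral>\<^sup>+\<omega>. ?F1 \<omega> \<partial>D)"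
      unfolding D_def by (rule nn_integral_density[symmetric]) (use EM F1 in auto)
    also have "\<dots> = (\<integral>\<^sup>+\<sigma>. g \<sigma> \<partial>distr D borel (time_slice (t + 1)))"
      by (rule nn_integral_distr[symmetric, OF slM[OF sD]]) (use g in simp)
    also have "\<dots> = (\<integral>\<^sup>+\<eta>. \<integral>\<^sup>+\<sigma>. g \<sigma> \<partial>pca_kernel r \<eta> \<partial>distr D borel (time_slice t))"
      unfolding eq by (rule nn_integral_bind[OF g]) (use km in simp)
    also have "\<dots> = (\<integral>\<^sup>+\<omega>. ?F2 \<omega> \<partial>D)"
      by (rule nn_integral_distr[OF slM[OF sD]]) (use kg in simp)
    also have "\<dots> = (\<integral>\<^sup>+\<omega>. indicator E \<omega> * ?F2 \<omega> \<partial>M)"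
      unfolding D_def by (rule nn_integral_density) (use EM F2 in auto)
    finally show ?thesis .
  qed
  have sub: "subalgebra (density M f) (past_algebra t)" for f
    using subalgebra_past[OF cm, of t] by (simp add: subalgebra_def space_density)
  \<comment> \<open>The two densities agree on all past events, hence integrate every
    past-measurable function equally.\<close>
  have "restr_to_subalg (density M ?F1) (past_algebra t) = restr_to_subalg (density M ?F2) (past_algebra t)"
  proof (rule measure_eqI)
    fix E assume "E \<in> sets (restr_to_subalg (density M ?F1) (past_algebra t))"
    then have E: "E \<in> sets (past_algebra t)" by (simp add: sets_restr_to_subalg[OF sub])
    then have EM: "E \<in> sets M" using sets_past_algebra_subset[of t, where 'g='g] sets by auto
    show "emeasure (restr_to_subalg (density M ?F1) (past_algebra t)) E =
          emeasure (restr_to_subalg (density M ?F2) (past_algebra t)) E"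
      using onsets[OF E] EM F1 F2
      by (simp add: emeasure_restr_to_subalg[OF sub E] emeasure_density mult.commute)
  qed (simp add: sets_restr_to_subalg[OF sub])
  then have "(\<integral>\<^sup>+\<omega>. u \<omega> \<partial>density M ?F1) = (\<integral>\<^sup>+\<omega>. u \<omega> \<partial>density M ?F2)"
    using nn_integral_subalgebra2[OF sub u] by metis
  moreover have "u \<in> borel_measurable M" using past_measurable_borel[OF u] bM by simp
  ultimately show ?thesis using F1 F2 by (simp add: nn_integral_density mult.commute)
qed

lemma kernel_integral_measurable:
  fixes r :: "('g::{ab_group_add,countable}) set \<Rightarrow> real" and g :: "'g config \<Rightarrow> real"
  assumes "pca_coefficients r" "g \<in> borel_measurable borel"
  shows "(\<lambda>\<eta>. \<integral>\<sigma>. g \<sigma> \<partial>pca_kernel r \<eta>) \<in> borel_measurable borel"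
  by (rule measurable_compose[OF measurable_prob_algebraD[OF pca_kernel_measurable[OF assms(1)]]
        integral_measurable_subprob_algebra[OF assms(2)]])

lemma markov_integral:
  fixes r :: "('g::{ab_group_add,countable}) set \<Rightarrow> real"
    and u :: "('g \<times> int) config \<Rightarrow> real" and g :: "'g config \<Rightarrow> real"
  assumes r: "pca_coefficients r" and path: "path_space_law r \<nu> M"
    and u: "u \<in> borel_measurable (past_algebra t)" "\<And>\<omega>. 0 \<le> u \<omega>" "\<And>\<omega>. u \<omega> \<le> Bu"
    and g: "g \<in> borel_measurable borel" "\<And>\<sigma>. 0 \<le> g \<sigma>" "\<And>\<sigma>. g \<sigma> \<le> Bg"
  shows "(\<integral>\<omega>. u \<omega> * g (time_slice (t + 1) \<omega>) \<partial>M) =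
         (\<integral>\<omega>. u \<omega> * (\<integral>\<sigma>. g \<sigma> \<partial>pca_kernel r (time_slice t \<omega>)) \<partial>M)"
proof -
  have cm: "M \<in> config_measures" by (rule path_space_lawD[OF path])
  interpret prob_space M by (rule config_measuresD[OF cm])
  interpret k: prob_space "pca_kernel r \<eta>" for \<eta> by (rule config_measuresD[OF pca_kernel_config])
  have uB: "u \<in> borel_measurable borel" by (rule past_measurable_borel[OF u(1)])
  have gk: "integrable (pca_kernel r \<eta>) g" for \<eta>
    by (rule bounded_integrable[OF pca_kernel_config g(1), where B=Bg]) (use g in auto)
  have kg: "0 \<le> (\<integral>\<sigma>. g \<sigma> \<partial>pca_kernel r \<eta>)" "(\<integral>\<sigma>. g \<sigma> \<partial>pca_kernel r \<eta>) \<le> Bg" for \<eta>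
    using g(2,3) k.integral_le_const[OF gk] by (auto intro!: Bochner_Integration.integral_nonneg)
  have Bu: "Bu \<ge> 0" and Bg: "Bg \<ge> 0" using u(2,3) g(2,3) order_trans by blast+
  have i1: "integrable M (\<lambda>\<omega>. u \<omega> * g (time_slice (t + 1) \<omega>))"
    by (rule bounded_integrable[OF cm, of _ "Bu * Bg"])
       (use uB g u measurable_compose[OF time_slice_measurable g(1)] Bu in \<open>auto intro!: mult_mono simp: abs_mult\<close>)
  have i2: "integrable M (\<lambda>\<omega>. u \<omega> * (\<integral>\<sigma>. g \<sigma> \<partial>pca_kernel r (time_slice t \<omega>)))"
    by (rule bounded_integrable[OF cm, of _ "Bu * Bg"])
       (use uB kg u measurable_compose[OF time_slice_measurable kernel_integral_measurable[OF r g(1)]] Bu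
        in \<open>auto intro!: mult_mono simp: abs_mult\<close>)
  have "ennreal (\<integral>\<omega>. u \<omega> * g (time_slice (t + 1) \<omega>) \<partial>M) =
      (\<integral>\<^sup>+\<omega>. ennreal (u \<omega>) * ennreal (g (time_slice (t + 1) \<omega>)) \<partial>M)"
    using u g by (subst nn_integral_eq_integral[symmetric, OF i1]) (auto simp: ennreal_mult)
  also have "\<dots> = (\<integral>\<^sup>+\<omega>. ennreal (u \<omega>) * (\<integral>\<^sup>+\<sigma>. ennreal (g \<sigma>) \<partial>pca_kernel r (time_slice t \<omega>)) \<partial>M)"
    by (rule markov_nn_integral[OF r path]) (use u g in measurable)
  also have "\<dots> = (\<integral>\<^sup>+\<omega>. ennreal (u \<omega> * (\<integral>\<sigma>. g \<sigma> \<partial>pca_kernel r (time_slice t \<omega>))) \<partial>M)"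
    using u g kg by (intro nn_integral_cong) (simp add: nn_integral_eq_integral[OF gk] ennreal_mult)
  also have "\<dots> = ennreal (\<integral>\<omega>. u \<omega> * (\<integral>\<sigma>. g \<sigma> \<partial>pca_kernel r (time_slice t \<omega>)) \<partial>M)"
    using u kg by (intro nn_integral_eq_integral[OF i2]) auto
  finally show ?thesis
    using u g kg by (subst (asm) ennreal_inj) (auto intro!: Bochner_Integration.integral_nonneg)
qed

lemma markov_cylinder:
  fixes r :: "('g::{ab_group_add,countable}) set \<Rightarrow> real" and u :: "('g \<times> int) config \<Rightarrow> real"
  assumes r: "pca_coefficients r" and path: "path_space_law r \<nu> M"
    and u: "u \<in> borel_measurable (past_algebra t)" "\<And>\<omega>. 0 \<le> u \<omega>" "\<And>\<omega>. u \<omega> \<le> Bu"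
    and W: "finite W"
  shows "(\<integral>\<omega>. u \<omega> * indicator (cylinder W s) (time_slice (t + 1) \<omega>) \<partial>M) =
         (\<integral>\<omega>. u \<omega> * pattern_prob r W s (time_slice t \<omega>) \<partial>M)"
proof -
  have "(\<integral>\<sigma>. indicator (cylinder W s) \<sigma> \<partial>pca_kernel r \<eta>) = pattern_prob r W s \<eta>" for \<eta>
    using integral_indicator_config[OF pca_kernel_config cylinder_sets[OF W], of r \<eta> s]
    by (simp add: measure_pca_kernel_cylinder[OF r W])
  then show ?thesis
    using markov_integral[OF r path u, of "indicator (cylinder W s)" 1] W
    by (simp add: indicator_def)
qed

lemma pattern_prob_lower:
  assumes "\<And>x b \<eta>. \<kappa> \<le> site_prob r x b \<eta>" "\<kappa> \<ge> 0"
  shows "\<kappa> ^ card W \<le> pattern_prob r W s \<eta>"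
  unfolding pattern_prob_def using assms by (subst prod_constant[symmetric]) (intro prod_mono, auto)

text \<open>By the Markov property the probability of a future event given the past is a function Z
  of the present slice alone. Peeling off the slice at time t + 1 and integrating it against the
  kernel gives Z recursively, and the lower bound on the rates keeps it above a positive constant,
  which will justify dividing by it.\<close>

lemma future_cylinder:
  fixes r :: "('g::{ab_group_add,countable}) set \<Rightarrow> real" and \<omega>0 :: "('g \<times> int) config"
  assumes r: "pca_coefficients r" and path: "path_space_law r \<nu> M"
    and \<kappa>: "\<kappa> > 0" "\<And>x b \<eta>. \<kappa> \<le> site_prob r x b \<eta>"
    and "finite A" "A \<subseteq> UNIV \<times> {t<..t + int j}"
  shows "\<exists>(Z :: 'g config \<Rightarrow> real) c. Z \<in> borel_measurable borel \<and> c > 0 \<and> (\<forall>\<eta>. c \<le> Z \<eta> \<and> Z \<eta> \<le> 1) \<and>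
     (\<forall>(u :: ('g \<times> int) config \<Rightarrow> real) Bu. u \<in> borel_measurable (past_algebra t) \<longrightarrow> (\<forall>\<omega>. 0 \<le> u \<omega> \<and> u \<omega> \<le> Bu) \<longrightarrow>
        (\<integral>\<omega>. u \<omega> * indicator (cylinder A \<omega>0) \<omega> \<partial>M) = (\<integral>\<omega>. u \<omega> * Z (time_slice t \<omega>) \<partial>M))"
  using assms(5,6)
proof (induction j arbitrary: t A)
  case 0
  then have "A = {}" by auto
  then show ?case by (intro exI[of _ "\<lambda>_. 1"] exI[of _ 1]) (auto simp: cylinder_def)
next
  case (Suc j)
  \<comment> \<open>The window is split into its part W at time t + 1 and its part A' strictly
    later; the induction hypothesis handles A' with time t + 1 as the present.\<close>
  define A' where "A' = A \<inter> UNIV \<times> {t + 1<..}"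
  define W where "W = {x. (x, t + 1) \<in> A}"
  have "W = fst ` (A \<inter> UNIV \<times> {t + 1})" by (force simp: W_def)
  then have W: "finite W" using Suc.prems(1) by simp
  define s where "s = time_slice (t + 1) \<omega>0"
  have cylA: "indicator (cylinder A \<omega>0) \<omega> =
      (indicator (cylinder W s) (time_slice (t + 1) \<omega>) * indicator (cylinder A' \<omega>0) \<omega> :: real)" for \<omega>
  proof -
    have "\<omega> \<in> cylinder A \<omega>0 \<longleftrightarrow> time_slice (t + 1) \<omega> \<in> cylinder W s \<and> \<omega> \<in> cylinder A' \<omega>0"
    proof -
      have "A = A' \<union> (\<lambda>x. (x, t + 1)) ` W"
      proof (intro equalityI subsetI)
        fix z assume z: "z \<in> A"
        obtain x l where [simp]: "z = (x, l)" by (cases z)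
        have "l > t" using Suc.prems(2) z by auto
        then have "l = t + 1 \<or> l > t + 1" by linarith
        then show "z \<in> A' \<union> (\<lambda>x. (x, t + 1)) ` W" using z by (auto simp: A'_def W_def)
      qed (auto simp: A'_def W_def)
      then show ?thesis
        by (auto simp: in_cylinder_iff s_def time_slice_def)
    qed
    then show ?thesis by (auto simp: indicator_def)
  qed
  have "finite A'" "A' \<subseteq> UNIV \<times> {t + 1<..t + 1 + int j}"
    using Suc.prems by (auto simp: A'_def)
  from Suc.IH[OF this] obtain Z :: "'g config \<Rightarrow> real" and c where Z: "Z \<in> borel_measurable borel" "c > 0"
      "\<And>\<eta>. c \<le> Z \<eta>" "\<And>\<eta>. Z \<eta> \<le> 1"
    and IH: "\<And>(u :: ('g \<times> int) config \<Rightarrow> real) Bu. u \<in> borel_measurable (past_algebra (t + 1)) \<Longrightarrow> (\<forall>\<omega>. 0 \<le> u \<omega> \<and> u \<omega> \<le> Bu) \<Longrightarrow>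
        (\<integral>\<omega>. u \<omega> * indicator (cylinder A' \<omega>0) \<omega> \<partial>M) = (\<integral>\<omega>. u \<omega> * Z (time_slice (t + 1) \<omega>) \<partial>M)"
    by blast
  define g where "g \<sigma> = indicator (cylinder W s) \<sigma> * Z \<sigma>" for \<sigma>
  have gm: "g \<in> borel_measurable borel" unfolding g_def[abs_def] using Z(1) W by measurable
  have g0: "0 \<le> g \<sigma>" and g1: "g \<sigma> \<le> 1" for \<sigma>
    using Z(2) Z(3)[of \<sigma>] Z(4)[of \<sigma>] by (auto simp: g_def indicator_def)
  define Z' where "Z' \<eta> = (\<integral>\<sigma>. g \<sigma> \<partial>pca_kernel r \<eta>)" for \<eta>
  interpret k: prob_space "pca_kernel r \<eta>" for \<eta> by (rule config_measuresD[OF pca_kernel_config])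
  have gi: "integrable (pca_kernel r \<eta>) g" for \<eta>
    by (rule bounded_integrable[OF pca_kernel_config gm, where B=1]) (use g0 g1 in auto)
  show ?case
  proof (intro exI conjI allI impI)
    show "Z' \<in> borel_measurable borel" unfolding Z'_def[abs_def] by (rule kernel_integral_measurable[OF r gm])
    show "c * \<kappa> ^ card W > 0" using Z(2) \<kappa>(1) by simp
    show "Z' \<eta> \<le> 1" for \<eta> unfolding Z'_def using g1 k.integral_le_const[OF gi] by auto
    \<comment> \<open>Each new slice multiplies the lower bound by the least probability of its
      pattern.\<close>
    show "c * \<kappa> ^ card W \<le> Z' \<eta>" for \<eta>
    proof -
      have "c * \<kappa> ^ card W \<le> c * pattern_prob r W s \<eta>"
        using Z(2) \<kappa> by (intro mult_left_mono pattern_prob_lower) auto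
      also have "\<dots> = (\<integral>\<sigma>. c * indicator (cylinder W s) \<sigma> \<partial>pca_kernel r \<eta>)"
        using integral_indicator_config[OF pca_kernel_config cylinder_sets[OF W], of r \<eta> s]
        by (simp add: measure_pca_kernel_cylinder[OF r W])
      also have "\<dots> \<le> Z' \<eta>"
        unfolding Z'_def
      proof (rule integral_mono[OF _ gi])
        show "integrable (pca_kernel r \<eta>) (\<lambda>\<sigma>. c * indicator (cylinder W s) \<sigma>)"
          by (rule bounded_integrable[OF pca_kernel_config, where B=c]) (use W Z(2) in \<open>auto simp: indicator_def\<close>)
        show "c * indicator (cylinder W s) \<sigma> \<le> g \<sigma>" for \<sigma>
          using Z(3)[of \<sigma>] by (auto simp: g_def indicator_def)
      qed
      finally show ?thesis .
    qed
    fix u :: "('g \<times> int) config \<Rightarrow> real" and Bu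
    assume u: "u \<in> borel_measurable (past_algebra t)" and ub: "\<forall>\<omega>. 0 \<le> u \<omega> \<and> u \<omega> \<le> Bu"
    let ?u = "\<lambda>\<omega>. u \<omega> * indicator (cylinder W s) (time_slice (t + 1) \<omega>)"
    have ind: "(\<lambda>\<omega>. indicator (cylinder W s) (time_slice (t + 1) \<omega>) :: real) \<in> borel_measurable (past_algebra (t + 1))"
      by (rule measurable_compose[OF time_slice_measurable_past]) (use W in auto)
    have "(\<integral>\<omega>. u \<omega> * indicator (cylinder A \<omega>0) \<omega> \<partial>M) = (\<integral>\<omega>. ?u \<omega> * indicator (cylinder A' \<omega>0) \<omega> \<partial>M)"
      by (simp add: cylA mult.assoc)
    also have "\<dots> = (\<integral>\<omega>. ?u \<omega> * Z (time_slice (t + 1) \<omega>) \<partial>M)"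
    proof (rule IH)
      show "?u \<in> borel_measurable (past_algebra (t + 1))"
        by (intro borel_measurable_times past_measurable_mono[OF u] ind) simp
      show "\<forall>\<omega>. 0 \<le> ?u \<omega> \<and> ?u \<omega> \<le> max Bu 0"
        using ub by (auto simp: indicator_def le_max_iff_disj)
    qed
    also have "\<dots> = (\<integral>\<omega>. u \<omega> * g (time_slice (t + 1) \<omega>) \<partial>M)"
      by (simp add: g_def mult.assoc)
    also have "\<dots> = (\<integral>\<omega>. u \<omega> * Z' (time_slice t \<omega>) \<partial>M)"
      unfolding Z'_def using markov_integral[OF r path u _ _ gm g0 g1] ub by blast
    finally show "(\<integral>\<omega>. u \<omega> * indicator (cylinder A \<omega>0) \<omega> \<partial>M) = (\<integral>\<omega>. u \<omega> * Z' (time_slice t \<omega>) \<partial>M)" .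
  qed
qed

section \<open>Consequences of the Gibbs property of the path measure\<close>

text \<open>A Gibbs measure gives the spin at the space-time origin a conditional probability
  bounded below whatever surrounds it. Tested on the event that the slice at time -1 looks like
  \<theta> near 0, the DLR equation bounds from below the same integral that the Markov property
  evaluates as nearly \<open>site_prob r 0 b \<theta>\<close>. The event has positive probability,
  so the bound holds for every \<theta>, and translation carries it to all sites.\<close>

lemma rates_bounded_below:
  fixes r :: "('g::{ab_group_add,countable}) set \<Rightarrow> real"
  assumes r: "pca_coefficients r" and path: "path_space_law r \<nu> M"
    and \<Phi>: "ti_summable_potential \<Phi>" and M: "gibbs_measure \<Phi> M"
  obtains \<kappa> where "\<kappa> > 0" "\<And>x b \<eta>. \<kappa> \<le> site_prob r x b \<eta>"
proof -
  define o0 where "o0 = (0::'g, 0::int)"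
  have cm: "M \<in> config_measures" by (rule path_space_lawD[OF path])
  have fo: "finite {o0}" by simp
  \<comment> \<open>The all-plus value of the conditional probability, reduced by the worst boundary
    effect (comparison with D empty).\<close>
  define c where "c b = exp (- (4 * boundary_norm \<Phi> {o0} {})) * gibbs_prob \<Phi> {o0} (\<lambda>_. b) (\<lambda>_. True)" for b
  have c: "c b \<le> gibbs_prob \<Phi> {o0} (\<lambda>_. b) \<omega>" for b \<omega>
  proof -
    have "gibbs_prob \<Phi> {o0} (\<lambda>_. b) (\<lambda>_. True) \<le> exp (4 * boundary_norm \<Phi> {o0} {}) * gibbs_prob \<Phi> {o0} (\<lambda>_. b) \<omega>"
      by (rule gibbs_prob_compare[OF \<Phi> fo]) auto
    then have "c b \<le> exp (- (4 * boundary_norm \<Phi> {o0} {})) * (exp (4 * boundary_norm \<Phi> {o0} {}) * gibbs_prob \<Phi> {o0} (\<lambda>_. b) \<omega>)"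
      unfolding c_def by (intro mult_left_mono) auto
    then show ?thesis by (simp add: mult.assoc[symmetric] exp_add[symmetric])
  qed
  have key: "c b \<le> site_prob r 0 b \<theta>" for b \<theta>
  proof (rule field_le_epsilon)
    fix e :: real assume "e > 0"
    from quasilocalD[OF site_prob_quasilocal[OF r] this, of 0 b] obtain D where D: "finite D"
      "\<And>\<sigma> \<sigma>'. \<forall>x\<in>D. \<sigma> x = \<sigma>' x \<Longrightarrow> \<bar>site_prob r 0 b \<sigma> - site_prob r 0 b \<sigma>'\<bar> \<le> e" by blast
    define E where "E = cylinder (D \<times> {-1::int}) (\<lambda>z. \<theta> (fst z))"
    have fD: "finite (D \<times> {-1::int})" using D(1) by simp
    have EP: "E \<in> sets (past_algebra (-1))"
      unfolding E_def by (rule cylinder_past[OF fD]) auto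
    have EB: "E \<in> sets borel" unfolding E_def using fD by simp
    let ?u = "indicator E :: _ \<Rightarrow> real"
    have u: "?u \<in> borel_measurable (past_algebra (-1))" using EP by simp
    have iE: "integrable M ?u"
      by (rule bounded_integrable[OF cm, where B=1]) (use EB in \<open>auto simp: indicator_def\<close>)
    have posE: "(\<integral>\<omega>. ?u \<omega> \<partial>M) > 0"
      using gibbs_cylinder_pos[OF \<Phi> M fD] integral_indicator_config[OF cm EB] by (simp add: E_def)
    \<comment> \<open>The event lives at time -1 and so does not involve the origin: the DLR
      equation at the origin may use it as a test function.\<close>
    have off: "depends_only_on (- {o0}) ?u"
      by (auto simp: depends_only_on_def E_def indicator_def in_cylinder_iff o0_def)
    have slm: "(\<lambda>\<omega>. site_prob r 0 b (time_slice (-1) \<omega>)) \<in> borel_measurable borel"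
      by (rule measurable_compose[OF time_slice_measurable site_prob_measurable[OF r]])
    have "c b * (\<integral>\<omega>. ?u \<omega> \<partial>M) = (\<integral>\<omega>. c b * ?u \<omega> \<partial>M)" by simp
    also have "\<dots> \<le> (\<integral>\<omega>. gibbs_prob \<Phi> {o0} (\<lambda>_. b) \<omega> * ?u \<omega> \<partial>M)"
    proof (rule integral_mono)
      show "integrable M (\<lambda>\<omega>. gibbs_prob \<Phi> {o0} (\<lambda>_. b) \<omega> * ?u \<omega>)"
        by (rule bounded_integrable[OF cm, where B=1])
           (use EB gibbs_prob_measurable[OF \<Phi> fo] gibbs_prob_le_1[OF fo] gibbs_prob_pos[OF fo, THEN less_imp_le]
            in \<open>auto simp: indicator_def\<close>)
      show "c b * ?u \<omega> \<le> gibbs_prob \<Phi> {o0} (\<lambda>_. b) \<omega> * ?u \<omega>" for \<omega>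
        by (intro mult_right_mono c) simp
    qed (use iE in simp)
    also have "\<dots> = (\<integral>\<omega>. indicator (cylinder {o0} (\<lambda>_. b)) \<omega> * ?u \<omega> \<partial>M)"
      by (rule DLR_integral[OF \<Phi> M fo off, symmetric]) (use EB in simp)
    also have "\<dots> = (\<integral>\<omega>. ?u \<omega> * indicator (cylinder {0} (\<lambda>_. b)) (time_slice (-1 + 1) \<omega>) \<partial>M)"
      by (intro Bochner_Integration.integral_cong refl)
         (auto simp: indicator_def in_cylinder_iff time_slice_def o0_def)
    also have "\<dots> = (\<integral>\<omega>. ?u \<omega> * pattern_prob r {0} (\<lambda>_. b) (time_slice (-1) \<omega>) \<partial>M)"
      by (rule markov_cylinder[OF r path u, where Bu=1]) (auto simp: indicator_def)
    also have "\<dots> = (\<integral>\<omega>. ?u \<omega> * site_prob r 0 b (time_slice (-1) \<omega>) \<partial>M)"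
      by (simp add: pattern_prob_def)
    also have "\<dots> \<le> (\<integral>\<omega>. (site_prob r 0 b \<theta> + e) * ?u \<omega> \<partial>M)"
    proof (rule integral_mono)
      show "integrable M (\<lambda>\<omega>. ?u \<omega> * site_prob r 0 b (time_slice (-1) \<omega>))"
        by (rule bounded_integrable[OF cm, where B=1])
           (use EB slm site_prob_nonneg[OF r] site_prob_le_1[OF r] in \<open>auto simp: indicator_def\<close>)
      show "?u \<omega> * site_prob r 0 b (time_slice (-1) \<omega>) \<le> (site_prob r 0 b \<theta> + e) * ?u \<omega>" for \<omega>
      proof (cases "\<omega> \<in> E")
        case True
        then have "\<forall>x\<in>D. time_slice (-1) \<omega> x = \<theta> x"
          by (auto simp: E_def in_cylinder_iff time_slice_def)
        from D(2)[OF this] True show ?thesis by simp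
      qed simp
    qed (use iE in simp)
    also have "\<dots> = (site_prob r 0 b \<theta> + e) * (\<integral>\<omega>. ?u \<omega> \<partial>M)" by simp
    finally show "c b \<le> site_prob r 0 b \<theta> + e" using posE by simp
  qed
  have cpos: "c b > 0" for b unfolding c_def using gibbs_prob_pos[OF fo] by simp
  show thesis
  proof (rule that[of "min (c True) (c False)"])
    show "min (c True) (c False) > 0" using cpos by simp
    show "min (c True) (c False) \<le> site_prob r x b \<eta>" for x b \<eta>
      using key[of b "shift x \<eta>"] site_prob_shift[of r 0 x b \<eta>] by (cases b) auto
  qed
qed

lemma site_prob_ratio:
  assumes "\<kappa> > 0" "\<kappa> \<le> site_prob r x b \<zeta>'" "\<bar>site_prob r x b \<zeta> - site_prob r x b \<zeta>'\<bar> \<le> e"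
  shows "site_prob r x b \<zeta> \<le> exp (e / \<kappa>) * site_prob r x b \<zeta>'"
proof -
  have e: "e \<ge> 0" using assms(3) by linarith
  have "site_prob r x b \<zeta> \<le> site_prob r x b \<zeta>' + e" using assms(3) by linarith
  also have "e \<le> e / \<kappa> * site_prob r x b \<zeta>'"
    using assms(1,2) e mult_left_mono[OF assms(2) e] by (simp add: field_simps)
  finally have "site_prob r x b \<zeta> \<le> (1 + e / \<kappa>) * site_prob r x b \<zeta>'" by (simp add: algebra_simps)
  also have "\<dots> \<le> exp (e / \<kappa>) * site_prob r x b \<zeta>'"
    using assms(1,2) by (intro mult_right_mono exp_ge_add_one_self) auto
  finally show ?thesis .
qed

lemma pattern_prob_ratio:
  assumes \<kappa>: "\<kappa> > 0" "\<And>x b \<eta>. \<kappa> \<le> site_prob r x b \<eta>" and W: "finite W"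
    and e: "\<And>y. y \<in> W \<Longrightarrow> \<bar>site_prob r y (s y) \<zeta> - site_prob r y (s y) \<zeta>'\<bar> \<le> e"
  shows "pattern_prob r W s \<zeta> \<le> exp (real (card W) * (e / \<kappa>)) * pattern_prob r W s \<zeta>'"
proof -
  have "pattern_prob r W s \<zeta> \<le> (\<Prod>y\<in>W. exp (e / \<kappa>) * site_prob r y (s y) \<zeta>')"
    unfolding pattern_prob_def
    using \<kappa> e by (intro prod_mono conjI site_prob_ratio) (auto intro: order_trans[OF less_imp_le])
  also have "\<dots> = exp (real (card W) * (e / \<kappa>)) * pattern_prob r W s \<zeta>'"
    unfolding exp_of_nat_mult by (simp add: prod.distrib pattern_prob_def)
  finally show ?thesis .
qed

lemma pattern_prob_modulus:
  fixes r :: "('g::{ab_group_add,countable}) set \<Rightarrow> real"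
  assumes r: "pca_coefficients r" and \<kappa>: "\<kappa> > 0" "\<And>x b \<eta>. \<kappa> \<le> site_prob r x b \<eta>"
    and W: "finite W" and d: "d > 0"
  obtains D where "finite D"
    "\<And>\<zeta> \<zeta>' s. \<forall>x\<in>D. \<zeta> x = \<zeta>' x \<Longrightarrow> pattern_prob r W s \<zeta> \<le> exp d * pattern_prob r W s \<zeta>'"
proof -
  \<comment> \<open>An error e in a rate of size at least \<kappa> costs a factor exp(e / \<kappa>),
    incurred once per site of W; the added 1 covers empty W.\<close>
  define e where "e = \<kappa> * d / (real (card W) + 1)"
  have e: "e > 0" using \<kappa>(1) d by (simp add: e_def add_nonneg_pos)
  obtain D where D: "finite D"
    "\<And>x b \<eta> \<eta>'. (\<And>a. a \<in> D \<Longrightarrow> \<eta> (a + x) = \<eta>' (a + x)) \<Longrightarrow> \<bar>site_prob r x b \<eta> - site_prob r x b \<eta>'\<bar> \<le> e"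
    using site_prob_modulus[OF r e] by metis
  show thesis
  proof (rule that[of "\<Union>y\<in>W. translate y D"])
    show "finite (\<Union>y\<in>W. translate y D)" using W D(1) by auto
    fix \<zeta> \<zeta>' s :: "'g config" assume eq: "\<forall>x\<in>(\<Union>y\<in>W. translate y D). \<zeta> x = \<zeta>' x"
    have "pattern_prob r W s \<zeta> \<le> exp (real (card W) * (e / \<kappa>)) * pattern_prob r W s \<zeta>'"
    proof (rule pattern_prob_ratio[OF \<kappa> W])
      fix y assume "y \<in> W"
      then show "\<bar>site_prob r y (s y) \<zeta> - site_prob r y (s y) \<zeta>'\<bar> \<le> e"
        using eq by (intro D(2)) (auto simp: translate_def)
    qed
    also have "\<dots> \<le> exp d * pattern_prob r W s \<zeta>'"
    proof (intro mult_right_mono pattern_prob_nonneg[OF r])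
      have "e / \<kappa> = d / (real (card W) + 1)" using \<kappa>(1) by (simp add: e_def)
      moreover have "real (card W) * (d / (real (card W) + 1)) \<le> d" using d by (simp add: field_simps)
      ultimately have "real (card W) * (e / \<kappa>) \<le> d" by (simp only:)
      then show "exp (real (card W) * (e / \<kappa>)) \<le> exp d" by simp
    qed
    finally show "pattern_prob r W s \<zeta> \<le> exp d * pattern_prob r W s \<zeta>'" .
  qed
qed

text \<open>
  Conditioning on the past, on the remaining spins at time 0 and on \<open>W\<close> at time 1, the law of
  the spin at the space-time origin is controlled in two ways: by the Markov property it is
  proportional to the transition probability into \<open>s\<close> on \<open>W\<close>, and by the DLR equation it is nearly
  independent of everything outside a fixed window \<open>C\<close>. The potential also couples to later times;
  dividing by \<open>Z\<close>, the probability of the prescribed future window given the slice at time 1,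
  removes that dependence exactly.
\<close>

proposition influence_tail:
  fixes r :: "('g::{ab_group_add,countable}) set \<Rightarrow> real"
  assumes r: "pca_coefficients r" and path: "path_space_law r \<nu> M"
    and \<Phi>: "ti_summable_potential \<Phi>" and M: "gibbs_measure \<Phi> M"
    and \<kappa>: "\<kappa> > 0" "\<And>x b \<eta>. \<kappa> \<le> site_prob r x b \<eta>" and e: "e > 0"
  obtains C where "finite C"
    "\<And>F \<eta> s b b'. finite F \<Longrightarrow> F \<inter> C = {} \<Longrightarrow>
       pattern_prob r F s (\<eta>(0 := b)) \<le> exp e * pattern_prob r F s (\<eta>(0 := b'))"
proof -
  define o0 where "o0 = (0::'g, 0::int)"
  have cm: "M \<in> config_measures" by (rule path_space_lawD[OF path])
  have fo: "finite {o0}" by simp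
  \<comment> \<open>Each inequality from \<open>key\<close> costs exp(2 d). Comparing f with X / Y
    uses two of them, and going from b to b' uses that comparison twice, hence exp(8 d).\<close>
  define d where "d = e / 8"
  have d: "d > 0" using e by (simp add: d_def)
  have e2: "exp (2 * d) = exp d * exp d" by (simp add: exp_add[symmetric])
  obtain A where A: "finite A" "\<And>\<omega> \<omega>' a. (\<And>z. z \<in> A - {o0} \<Longrightarrow> \<omega> z = \<omega>' z) \<Longrightarrow>
      gibbs_prob \<Phi> {o0} a \<omega> \<le> exp d * gibbs_prob \<Phi> {o0} a \<omega>'"
  proof (rule gibbs_prob_modulus[OF \<Phi> fo d])
    fix D assume D: "finite D" "\<And>\<eta> \<eta>' a. (\<And>x. x \<in> D - {o0} \<Longrightarrow> \<eta> x = \<eta>' x) \<Longrightarrow>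
      gibbs_prob \<Phi> {o0} a \<eta> \<le> exp d * gibbs_prob \<Phi> {o0} a \<eta>'"
    show thesis by (rule that[OF D(1)]) (rule D(2))
  qed
  \<comment> \<open>The time-1 part of the DLR window. A pattern on a set W containing C fixes every
    spin at time 1 to which the origin is noticeably coupled.\<close>
  define C where "C = {x. (x, 1::int) \<in> A}"
  have "C = fst ` (A \<inter> UNIV \<times> {1})" by (force simp: C_def)
  then have finC: "finite C" using A(1) by simp
  show thesis
  proof (rule that[OF finC])
    fix F and \<eta> s :: "'g config" and b b'
    assume F: "finite F" "F \<inter> C = {}"
    define \<omega>0 where "\<omega>0 = (\<lambda>(x, t::int). if t = 0 then \<eta> x else if t = 1 then s x else True)"
    obtain D where D: "finite D"
      "\<And>\<zeta> \<zeta>' s. \<forall>x\<in>D. \<zeta> x = \<zeta>' x \<Longrightarrow> pattern_prob r (C \<union> F) s \<zeta> \<le> exp d * pattern_prob r (C \<union> F) s \<zeta>'"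
      using pattern_prob_modulus[OF r \<kappa> finite_UnI[OF finC F(1)] d] by blast
    obtain D' where D': "finite D'"
      "\<And>\<zeta> \<zeta>' s. \<forall>x\<in>D'. \<zeta> x = \<zeta>' x \<Longrightarrow> pattern_prob r C s \<zeta> \<le> exp d * pattern_prob r C s \<zeta>'"
      using pattern_prob_modulus[OF r \<kappa> finC d] by blast
    \<comment> \<open>Conditioning up to time 0 fixes the DLR window there and also D and D', where
      the slice at time 0 must be known for the transition probabilities to be nearly constant. The
      origin itself stays free.\<close>
    define A0 where "A0 = (A \<inter> UNIV \<times> {..<0}) \<union> ((A \<inter> UNIV \<times> {0}) \<union> (D \<union> D') \<times> {0}) - {o0}"
    have A0: "finite A0" "A0 \<subseteq> UNIV \<times> {..0}" "o0 \<notin> A0"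
      using A(1) D(1) D'(1) by (auto simp: A0_def)
    define A2 where "A2 = A \<inter> UNIV \<times> {1<..}"
    have finA2: "finite A2" using A(1) by (simp add: A2_def)
    obtain j where j: "A2 \<subseteq> UNIV \<times> {1<..1 + int j}"
    proof
      show "A2 \<subseteq> UNIV \<times> {1<..1 + int (nat (Max (insert 0 (snd ` A2))))}"
      proof
        fix z assume z: "z \<in> A2"
        then have "snd z \<le> Max (insert 0 (snd ` A2))" using finA2 by (intro Max_ge) auto
        then show "z \<in> UNIV \<times> {1<..1 + int (nat (Max (insert 0 (snd ` A2))))}"
          using z by (cases z) (auto simp: A2_def)
      qed
    qed
    from future_cylinder[OF r path \<kappa> finA2 j, of \<omega>0] obtain Z :: "'g config \<Rightarrow> real" and c
      where Z: "Z \<in> borel_measurable borel" "c > 0" "\<And>\<eta>. c \<le> Z \<eta>" "\<And>\<eta>. Z \<eta> \<le> 1"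
        and fut: "\<And>(u :: ('g \<times> int) config \<Rightarrow> real) Bu. u \<in> borel_measurable (past_algebra 1) \<Longrightarrow>
          (\<forall>\<omega>. 0 \<le> u \<omega> \<and> u \<omega> \<le> Bu) \<Longrightarrow>
          (\<integral>\<omega>. u \<omega> * indicator (cylinder A2 \<omega>0) \<omega> \<partial>M) = (\<integral>\<omega>. u \<omega> * Z (time_slice 1 \<omega>) \<partial>M)"
      by blast
    have Zpos: "Z \<zeta> > 0" for \<zeta> using Z(2) Z(3)[of \<zeta>] by linarith
    define \<gamma> where "\<gamma> b = gibbs_prob \<Phi> {o0} (\<lambda>_. b) \<omega>0" for b
    have \<gamma>: "\<gamma> b > 0" for b unfolding \<gamma>_def by (rule gibbs_prob_pos[OF fo])
    define Q where "Q b = measure M (cylinder (insert o0 A0) (\<omega>0(o0 := b)))" for b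
    have Q: "Q b > 0" for b unfolding Q_def by (rule gibbs_cylinder_pos[OF \<Phi> M]) (use A0 in simp)
    let ?E = "\<lambda>b. indicator (cylinder (insert o0 A0) (\<omega>0(o0 := b))) :: _ \<Rightarrow> real"
    have Esplit: "?E b \<omega> = indicator (cylinder {o0} (\<lambda>_. b)) \<omega> * indicator (cylinder A0 \<omega>0) \<omega>" for b \<omega>
      using A0(3) by (auto simp: indicator_def in_cylinder_iff)
    have EP: "?E b \<in> borel_measurable (past_algebra 0)" for b
      using A0(1,2) by (intro borel_measurable_indicator cylinder_past) (auto simp: o0_def)
    \<comment> \<open>Both evaluations of the same integral, up to exp(2 d): the transition
      probability times Q b by the Markov property, \<gamma> b times X by DLR. X does not depend on
      b. Used with W = C \<union> F and with W = C; in the quotient \<gamma> and Q cancel and only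
      the transition probability into F remains.\<close>
    have key: "\<exists>X. X > 0 \<and> (\<forall>b. pattern_prob r W s (\<eta>(0 := b)) * Q b \<le> exp (2 * d) * (\<gamma> b * X) \<and>
        \<gamma> b * X \<le> exp (2 * d) * (pattern_prob r W s (\<eta>(0 := b)) * Q b))"
      if W: "finite W" "C \<subseteq> W" and cont: "\<And>\<zeta> \<zeta>'. \<forall>x\<in>D \<union> D'. \<zeta> x = \<zeta>' x \<Longrightarrow>
            pattern_prob r W s \<zeta> \<le> exp d * pattern_prob r W s \<zeta>'" for W
    proof -
      let ?G = "\<lambda>\<omega>. indicator (cylinder W s) (time_slice 1 \<omega>) :: real"
      \<comment> \<open>The test function fixes the past and present windows, the pattern on W and
        the future window; the division by Z compensates the last of these.\<close>
      define H where "H \<omega> = indicator (cylinder A0 \<omega>0) \<omega> * ?G \<omega> *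
          indicator (cylinder A2 \<omega>0) \<omega> / Z (time_slice 1 \<omega>)" for \<omega>
      define X where "X = (\<integral>\<omega>. H \<omega> \<partial>M)"
      have GP: "?G \<in> borel_measurable (past_algebra 1)"
        by (rule measurable_compose[OF time_slice_measurable_past]) (use W in auto)
      have ZP: "(\<lambda>\<omega>. Z (time_slice 1 \<omega>)) \<in> borel_measurable (past_algebra 1)"
        by (rule measurable_compose[OF time_slice_measurable_past Z(1)]) simp
      have Hm: "H \<in> borel_measurable borel"
      proof -
        have "cylinder A0 \<omega>0 \<in> sets borel" "cylinder A2 \<omega>0 \<in> sets borel" using A0(1) finA2 by auto
        then show ?thesis
          unfolding H_def[abs_def]
          by (intro borel_measurable_divide borel_measurable_times borel_measurable_indicator
              past_measurable_borel[OF GP] past_measurable_borel[OF ZP])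
      qed
      have H0: "H \<omega> \<ge> 0" for \<omega> using Zpos by (auto simp: H_def indicator_def less_imp_le)
      have HB: "H \<omega> \<le> 1 / c" for \<omega>
        using Zpos[of "time_slice 1 \<omega>"] Z(2) Z(3)[of "time_slice 1 \<omega>"]
        by (auto simp: H_def indicator_def frac_le)
      have Hoff: "depends_only_on (- {o0}) H"
      proof -
        have "H \<omega> = H \<omega>'" if eq: "\<forall>z\<in>- {o0}. \<omega> z = \<omega>' z" for \<omega> \<omega>'
        proof -
          have sl: "time_slice 1 \<omega> = time_slice 1 \<omega>'" using eq by (auto simp: time_slice_def o0_def)
          have "o0 \<notin> A2" by (simp add: A2_def o0_def)
          then have "\<omega> \<in> cylinder A2 \<omega>0 \<longleftrightarrow> \<omega>' \<in> cylinder A2 \<omega>0" "\<omega> \<in> cylinder A0 \<omega>0 \<longleftrightarrow> \<omega>' \<in> cylinder A0 \<omega>0"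
            using eq A0(3) by (auto simp: in_cylinder_iff)
          then show ?thesis by (simp add: H_def sl indicator_def)
        qed
        then show ?thesis unfolding depends_only_on_def by blast
      qed
      \<comment> \<open>Where H does not vanish, every spin of the DLR window other than the origin
        agrees with \<omega>0, so the conditional probability at the origin is within exp(d) of
        \<gamma> b.\<close>
      have near: "\<omega> z = \<omega>0 z" if "H \<omega> \<noteq> 0" "z \<in> A - {o0}" for \<omega> z
      proof -
        have mem: "\<omega> \<in> cylinder A0 \<omega>0" "time_slice 1 \<omega> \<in> cylinder W s" "\<omega> \<in> cylinder A2 \<omega>0"
          using that(1) by (auto simp: H_def indicator_def split: if_splits)
        obtain x t where [simp]: "z = (x, t)" by (cases z)
        consider "t < 0" | "t = 0" | "t = 1" | "t > 1" by linarith
        then show ?thesis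
        proof cases
          case 3
          then have "x \<in> W" using that(2) W(2) by (auto simp: C_def)
          then show ?thesis using mem(2) 3 by (auto simp: in_cylinder_iff time_slice_def \<omega>0_def)
        next
          case 4
          then have "z \<in> A2" using that(2) by (auto simp: A2_def)
          then show ?thesis using mem(3) by (auto simp: in_cylinder_iff)
        qed (use mem(1) that(2) in \<open>auto simp: in_cylinder_iff A0_def\<close>)
      qed
      have gp: "\<gamma> b * H \<omega> \<le> exp d * (gibbs_prob \<Phi> {o0} (\<lambda>_. b) \<omega> * H \<omega>) \<and>
          gibbs_prob \<Phi> {o0} (\<lambda>_. b) \<omega> * H \<omega> \<le> exp d * (\<gamma> b * H \<omega>)" for b \<omega>
      proof (cases "H \<omega> = 0")
        case False
        have "\<gamma> b \<le> exp d * gibbs_prob \<Phi> {o0} (\<lambda>_. b) \<omega>"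
          unfolding \<gamma>_def by (rule A(2)) (use near[OF False] in simp)
        moreover have "gibbs_prob \<Phi> {o0} (\<lambda>_. b) \<omega> \<le> exp d * \<gamma> b"
          unfolding \<gamma>_def by (rule A(2)) (use near[OF False] in simp)
        ultimately show ?thesis using H0[of \<omega>] by (simp add: mult_right_mono mult.assoc[symmetric])
      qed simp
      have iH: "integrable M H"
        by (rule bounded_integrable[OF cm Hm, where B="1/c"]) (use H0 HB in simp)
      have igH: "integrable M (\<lambda>\<omega>. gibbs_prob \<Phi> {o0} (\<lambda>_. b) \<omega> * H \<omega>)" for b
      proof (rule bounded_integrable[OF cm, where B="1/c"])
        show "(\<lambda>\<omega>. gibbs_prob \<Phi> {o0} (\<lambda>_. b) \<omega> * H \<omega>) \<in> borel_measurable borel"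
          using Hm gibbs_prob_measurable[OF \<Phi> fo] by simp
        show "\<bar>gibbs_prob \<Phi> {o0} (\<lambda>_. b) \<omega> * H \<omega>\<bar> \<le> 1 / c" for \<omega>
        proof -
          have "gibbs_prob \<Phi> {o0} (\<lambda>_. b) \<omega> * H \<omega> \<le> 1 * (1 / c)"
            using H0[of \<omega>] by (intro mult_mono gibbs_prob_le_1[OF fo] HB) auto
          then show ?thesis using H0[of \<omega>] gibbs_prob_pos[OF fo, of \<Phi> "\<lambda>_. b" \<omega>] by (simp add: abs_mult)
        qed
      qed
      have dlr: "(\<integral>\<omega>. gibbs_prob \<Phi> {o0} (\<lambda>_. b) \<omega> * H \<omega> \<partial>M) =
          (\<integral>\<omega>. ?E b \<omega> * pattern_prob r W s (time_slice 0 \<omega>) \<partial>M)" for b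
      proof -
        let ?u = "\<lambda>\<omega>. ?E b \<omega> * ?G \<omega> / Z (time_slice 1 \<omega>)"
        have "(\<integral>\<omega>. gibbs_prob \<Phi> {o0} (\<lambda>_. b) \<omega> * H \<omega> \<partial>M) =
            (\<integral>\<omega>. indicator (cylinder {o0} (\<lambda>_. b)) \<omega> * H \<omega> \<partial>M)"
          by (rule DLR_integral[OF \<Phi> M fo Hoff Hm, symmetric])
        also have "\<dots> = (\<integral>\<omega>. ?u \<omega> * indicator (cylinder A2 \<omega>0) \<omega> \<partial>M)"
          by (intro Bochner_Integration.integral_cong refl) (simp add: Esplit H_def)
        also have "\<dots> = (\<integral>\<omega>. ?u \<omega> * Z (time_slice 1 \<omega>) \<partial>M)"
        proof (rule fut)
          show "?u \<in> borel_measurable (past_algebra 1)"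
            by (intro borel_measurable_divide borel_measurable_times past_measurable_mono[OF EP] GP ZP) simp
          show "\<forall>\<omega>. 0 \<le> ?u \<omega> \<and> ?u \<omega> \<le> 1 / c"
            using Zpos Z(2,3) by (auto simp: indicator_def less_imp_le frac_le)
        qed
        \<comment> \<open>The future window has just been integrated out into a factor Z, which
          cancels the Z in the denominator exactly.\<close>
        also have "\<dots> = (\<integral>\<omega>. ?E b \<omega> * indicator (cylinder W s) (time_slice (0 + 1) \<omega>) \<partial>M)"
          using Zpos by (intro Bochner_Integration.integral_cong refl) (simp add: less_imp_neq[symmetric])
        also have "\<dots> = (\<integral>\<omega>. ?E b \<omega> * pattern_prob r W s (time_slice 0 \<omega>) \<partial>M)"
          by (rule markov_cylinder[OF r path EP _ _ W(1), where Bu=1]) (auto simp: indicator_def)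
        finally show ?thesis .
      qed
      have EB: "?E b \<in> borel_measurable borel" for b by (rule past_measurable_borel[OF EP])
      have iE: "integrable M (?E b)" for b
        by (rule bounded_integrable[OF cm EB, where B=1]) (auto simp: indicator_def)
      have iEp: "integrable M (\<lambda>\<omega>. ?E b \<omega> * pattern_prob r W s (time_slice 0 \<omega>))" for b
      proof (rule bounded_integrable[OF cm, where B=1])
        show "(\<lambda>\<omega>. ?E b \<omega> * pattern_prob r W s (time_slice 0 \<omega>)) \<in> borel_measurable borel"
          by (intro borel_measurable_times EB measurable_compose[OF time_slice_measurable pattern_prob_measurable[OF r]])
      qed (use pattern_prob_nonneg[OF r] pattern_prob_le_1[OF r] in \<open>auto simp: indicator_def\<close>)
      have EQ: "(\<integral>\<omega>. ?E b \<omega> \<partial>M) = Q b" for b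
        unfolding Q_def by (rule integral_indicator_config[OF cm]) (use A0(1) in simp)
      have pp: "pattern_prob r W s (\<eta>(0 := b)) * ?E b \<omega> \<le> exp d * (?E b \<omega> * pattern_prob r W s (time_slice 0 \<omega>)) \<and>
          ?E b \<omega> * pattern_prob r W s (time_slice 0 \<omega>) \<le> exp d * (pattern_prob r W s (\<eta>(0 := b)) * ?E b \<omega>)" for b \<omega>
      proof (cases "\<omega> \<in> cylinder (insert o0 A0) (\<omega>0(o0 := b))")
        case True
        have "time_slice 0 \<omega> x = (\<eta>(0 := b)) x" if "x \<in> D \<union> D'" for x
        proof (cases "x = 0")
          case False
          then have "(x, 0) \<in> A0" "(x, 0) \<noteq> o0" using that by (auto simp: A0_def o0_def)
          then have "\<omega> (x, 0) = \<omega>0 (x, 0)" using True by (auto simp: in_cylinder_iff)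
          then show ?thesis using False by (simp add: time_slice_def \<omega>0_def)
        qed (use True in \<open>auto simp: in_cylinder_iff time_slice_def o0_def\<close>)
        then have "pattern_prob r W s (\<eta>(0 := b)) \<le> exp d * pattern_prob r W s (time_slice 0 \<omega>)"
          "pattern_prob r W s (time_slice 0 \<omega>) \<le> exp d * pattern_prob r W s (\<eta>(0 := b))"
          by (intro cont; simp)+
        then show ?thesis using True by simp
      qed simp
      have low: "pattern_prob r W s (\<eta>(0 := b)) * Q b \<le> exp (2 * d) * (\<gamma> b * X)" for b
      proof -
        have "pattern_prob r W s (\<eta>(0 := b)) * Q b = (\<integral>\<omega>. pattern_prob r W s (\<eta>(0 := b)) * ?E b \<omega> \<partial>M)"
          by (simp add: EQ[symmetric])
        also have "\<dots> \<le> (\<integral>\<omega>. exp d * (?E b \<omega> * pattern_prob r W s (time_slice 0 \<omega>)) \<partial>M)"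
          using pp by (intro integral_mono integrable_mult_right iEp iE) blast
        also have "\<dots> = exp d * (\<integral>\<omega>. gibbs_prob \<Phi> {o0} (\<lambda>_. b) \<omega> * H \<omega> \<partial>M)"
          by (simp add: dlr)
        also have "\<dots> \<le> exp d * (\<integral>\<omega>. exp d * (\<gamma> b * H \<omega>) \<partial>M)"
        proof (rule mult_left_mono)
          show "(\<integral>\<omega>. gibbs_prob \<Phi> {o0} (\<lambda>_. b) \<omega> * H \<omega> \<partial>M) \<le> (\<integral>\<omega>. exp d * (\<gamma> b * H \<omega>) \<partial>M)"
            using gp by (intro integral_mono igH integrable_mult_right iH) blast
        qed simp
        also have "\<dots> = exp (2 * d) * (\<gamma> b * X)" unfolding e2 by (simp add: X_def)
        finally show ?thesis .
      qed
      moreover have "\<gamma> b * X \<le> exp (2 * d) * (pattern_prob r W s (\<eta>(0 := b)) * Q b)" for b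
      proof -
        have "\<gamma> b * X = (\<integral>\<omega>. \<gamma> b * H \<omega> \<partial>M)" by (simp add: X_def)
        also have "\<dots> \<le> (\<integral>\<omega>. exp d * (gibbs_prob \<Phi> {o0} (\<lambda>_. b) \<omega> * H \<omega>) \<partial>M)"
          using gp by (intro integral_mono integrable_mult_right igH iH) blast
        also have "\<dots> = exp d * (\<integral>\<omega>. ?E b \<omega> * pattern_prob r W s (time_slice 0 \<omega>) \<partial>M)"
          by (simp add: dlr)
        also have "\<dots> \<le> exp d * (\<integral>\<omega>. exp d * (pattern_prob r W s (\<eta>(0 := b)) * ?E b \<omega>) \<partial>M)"
        proof (rule mult_left_mono)
          show "(\<integral>\<omega>. ?E b \<omega> * pattern_prob r W s (time_slice 0 \<omega>) \<partial>M) \<le>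
              (\<integral>\<omega>. exp d * (pattern_prob r W s (\<eta>(0 := b)) * ?E b \<omega>) \<partial>M)"
            using pp by (intro integral_mono iEp integrable_mult_right iE) blast
        qed simp
        also have "\<dots> = exp (2 * d) * (pattern_prob r W s (\<eta>(0 := b)) * Q b)"
          unfolding e2 by (simp add: EQ[symmetric])
        finally show ?thesis .
      qed
      moreover have "X > 0"
      proof -
        have "pattern_prob r W s (\<eta>(0 := True)) \<ge> \<kappa> ^ card W" using \<kappa> by (intro pattern_prob_lower) auto
        then have "pattern_prob r W s (\<eta>(0 := True)) > 0" using \<kappa>(1) zero_less_power[of \<kappa> "card W"] by linarith
        then have "0 < exp (2 * d) * (\<gamma> True * X)"
          using low[of True] Q[of True] mult_pos_pos by (meson less_le_trans)
        then show ?thesis using \<gamma>[of True] by (simp add: zero_less_mult_iff)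
      qed
      ultimately show ?thesis by blast
    qed
    have c1: "pattern_prob r (C \<union> F) s \<zeta> \<le> exp d * pattern_prob r (C \<union> F) s \<zeta>'"
      if "\<forall>x\<in>D \<union> D'. \<zeta> x = \<zeta>' x" for \<zeta> \<zeta>' by (rule D(2)) (use that in blast)
    from key[OF finite_UnI[OF finC F(1)] Un_upper1 c1]
    obtain X where X: "X > 0"
      "\<And>b. pattern_prob r (C \<union> F) s (\<eta>(0 := b)) * Q b \<le> exp (2 * d) * (\<gamma> b * X)"
      "\<And>b. \<gamma> b * X \<le> exp (2 * d) * (pattern_prob r (C \<union> F) s (\<eta>(0 := b)) * Q b)"
      by blast
    have c2: "pattern_prob r C s \<zeta> \<le> exp d * pattern_prob r C s \<zeta>'"
      if "\<forall>x\<in>D \<union> D'. \<zeta> x = \<zeta>' x" for \<zeta> \<zeta>' by (rule D'(2)) (use that in blast)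
    from key[OF finC subset_refl c2]
    obtain Y where Y: "Y > 0"
      "\<And>b. pattern_prob r C s (\<eta>(0 := b)) * Q b \<le> exp (2 * d) * (\<gamma> b * Y)"
      "\<And>b. \<gamma> b * Y \<le> exp (2 * d) * (pattern_prob r C s (\<eta>(0 := b)) * Q b)"
      by blast
    define p where "p b = pattern_prob r C s (\<eta>(0 := b))" for b
    define f where "f b = pattern_prob r F s (\<eta>(0 := b))" for b
    have split: "pattern_prob r (C \<union> F) s (\<eta>(0 := b)) = p b * f b" for b
      unfolding p_def f_def by (rule pattern_prob_union) (use finC F in auto)
    have ppos: "p b > 0" for b
    proof -
      have "p b \<ge> \<kappa> ^ card C" unfolding p_def using \<kappa> by (intro pattern_prob_lower) auto
      then show ?thesis using \<kappa>(1) zero_less_power[of \<kappa> "card C"] by linarith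
    qed
    have f0: "f b \<ge> 0" for b unfolding f_def by (rule pattern_prob_nonneg[OF r])
    \<comment> \<open>Here p b is eliminated between the two instances of \<open>key\<close>,
      leaving f b comparable to X / Y for either value of b.\<close>
    have up: "f b * Y \<le> exp (4 * d) * X" for b
    proof -
      have "f b * (\<gamma> b * Y) \<le> f b * (exp (2 * d) * (p b * Q b))"
        using Y(3)[of b] f0[of b] unfolding p_def by (intro mult_left_mono) auto
      also have "\<dots> = exp (2 * d) * (p b * f b * Q b)" by simp
      also have "\<dots> \<le> exp (2 * d) * (exp (2 * d) * (\<gamma> b * X))"
        using X(2)[of b] by (intro mult_left_mono) (auto simp: split)
      also have "\<dots> = exp (4 * d) * (\<gamma> b * X)" by (simp add: mult.assoc[symmetric] exp_add[symmetric])
      finally have "\<gamma> b * (f b * Y) \<le> \<gamma> b * (exp (4 * d) * X)" by (simp add: mult_ac)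
      then show ?thesis using \<gamma>[of b] by simp
    qed
    have down: "X \<le> exp (4 * d) * (f b * Y)" for b
    proof -
      have "\<gamma> b * X \<le> exp (2 * d) * (p b * f b * Q b)" using X(3)[of b] by (simp add: split)
      also have "\<dots> = exp (2 * d) * (f b * (p b * Q b))" by simp
      also have "\<dots> \<le> exp (2 * d) * (f b * (exp (2 * d) * (\<gamma> b * Y)))"
        using Y(2)[of b] f0[of b] unfolding p_def by (intro mult_left_mono) auto
      also have "\<dots> = \<gamma> b * (exp (4 * d) * (f b * Y))"
      proof -
        have "exp (2 * d) * exp (2 * d) = exp (4 * d)" by (simp add: exp_add[symmetric])
        then show ?thesis by (metis (no_types, opaque_lifting) mult.assoc mult.left_commute)
      qed
      finally show ?thesis using \<gamma>[of b] by simp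
    qed
    have "f b * Y \<le> exp (4 * d) * (exp (4 * d) * (f b' * Y))"
      by (rule order_trans[OF up]) (intro mult_left_mono down, simp)
    also have "\<dots> = (exp e * f b') * Y" by (simp add: d_def mult.assoc[symmetric] exp_add[symmetric])
    finally have "f b \<le> exp e * f b'" using Y(1) by simp
    then show "pattern_prob r F s (\<eta>(0 := b)) \<le> exp e * pattern_prob r F s (\<eta>(0 := b'))"
      by (simp add: f_def)
  qed
qed

section \<open>Existence of the relative entropy density\<close>

definition tile_center :: "nat \<Rightarrow> int^'d::finite \<Rightarrow> int^'d" where
  "tile_center k w = (\<chi> i. (2 * int k + 1) * w $ i)"

text \<open>The radius q of the index cube is the largest with (2k+1) q + k \<le> n (for n at least
  k), which is what keeps every tile inside \<open>cube n\<close>.\<close>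

definition tile_centers :: "nat \<Rightarrow> nat \<Rightarrow> (int^'d::finite) set" where
  "tile_centers k n = tile_center k ` cube ((n - k) div (2 * k + 1))"

definition disjoint_tiles :: "'g::ab_group_add set \<Rightarrow> 'g set \<Rightarrow> bool" where
  "disjoint_tiles V Z \<longleftrightarrow> (\<forall>z\<in>Z. \<forall>z'\<in>Z. z \<noteq> z' \<longrightarrow> translate z V \<inter> translate z' V = {})"

lemma finite_tile_centers [simp]: "finite (tile_centers k n)"
  by (simp add: tile_centers_def)

lemma inj_tile_center: "inj (tile_center k)"
proof (rule injI)
  fix w w' :: "int^'d" assume "tile_center k w = tile_center k w'"
  then have "(2 * int k + 1) * w $ i = (2 * int k + 1) * w' $ i" for i
    by (simp add: tile_center_def vec_eq_iff)
  moreover have "2 * int k + 1 \<noteq> 0" by linarith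
  ultimately show "w = w'" by (simp add: vec_eq_iff)
qed

lemma card_tile_centers:
  "card (tile_centers k n :: (int^'d::finite) set) = card (cube ((n - k) div (2 * k + 1)) :: (int^'d) set)"
  unfolding tile_centers_def by (rule card_image) (meson inj_tile_center inj_on_subset subset_UNIV)

text \<open>Distinct centers differ in some coordinate by a nonzero multiple of 2k+1, but a common
  point of two tiles would force all differences to be at most 2k.\<close>

lemma tile_centers_disjoint: "disjoint_tiles (cube k) (tile_centers k n :: (int^'d::finite) set)"
  unfolding disjoint_tiles_def
proof (intro ballI impI)
  fix z z' :: "int^'d" assume "z \<in> tile_centers k n" "z' \<in> tile_centers k n" "z \<noteq> z'"
  then obtain w w' where w: "z = tile_center k w" "z' = tile_center k w'" "w \<noteq> w'"
    by (auto simp: tile_centers_def)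
  show "translate z (cube k) \<inter> translate z' (cube k) = {}"
  proof (rule ccontr)
    assume "translate z (cube k) \<inter> translate z' (cube k) \<noteq> {}"
    then obtain y where y: "y - z \<in> cube k" "y - z' \<in> cube k" by (auto simp: translate_iff)
    have "w $ i = w' $ i" for i
    proof -
      have "\<bar>y $ i - (2 * int k + 1) * w $ i\<bar> \<le> int k" "\<bar>y $ i - (2 * int k + 1) * w' $ i\<bar> \<le> int k"
        using y by (auto simp: cube_def w tile_center_def)
      then have "\<bar>(2 * int k + 1) * (w $ i - w' $ i)\<bar> \<le> 2 * int k"
        by (simp add: right_diff_distrib abs_le_iff)
      then have "(2 * int k + 1) * \<bar>w $ i - w' $ i\<bar> < 2 * int k + 1" by (simp add: abs_mult)
      then have "\<bar>w $ i - w' $ i\<bar> < 1" using mult_less_cancel_left2[of "2 * int k + 1" "\<bar>w $ i - w' $ i\<bar>"] by auto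
      then show ?thesis by simp
    qed
    then show False using w(3) by (simp add: vec_eq_iff)
  qed
qed

lemma tile_subset_cube:
  assumes "k \<le> n" "z \<in> tile_centers k n"
  shows "translate z (cube k) \<subseteq> (cube n :: (int^'d::finite) set)"
proof
  define q where "q = (n - k) div (2 * k + 1)"
  obtain w where w: "w \<in> cube q" "z = tile_center k w"
    using assms(2) by (auto simp: tile_centers_def q_def)
  have "(2 * k + 1) * q \<le> n - k" unfolding q_def by (rule times_div_less_eq_dividend)
  then have qn: "(2 * int k + 1) * int q + int k \<le> int n"
    using assms(1) by (simp flip: of_nat_mult of_nat_add add: of_nat_diff) (metis add.commute add_le_imp_le_diff le_diff_conv2 mult_Suc of_nat_Suc of_nat_add of_nat_le_iff of_nat_mult of_nat_numeral)
  fix y assume "y \<in> translate z (cube k)"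
  then have y: "y - z \<in> cube k" by (simp add: translate_iff)
  have "\<bar>y $ i\<bar> \<le> int n" for i
  proof -
    have "\<bar>y $ i - (2 * int k + 1) * w $ i\<bar> \<le> int k"
      using y by (auto simp: cube_def w(2) tile_center_def)
    moreover have "\<bar>(2 * int k + 1) * w $ i\<bar> \<le> (2 * int k + 1) * int q"
      using w(1) by (auto simp: cube_def abs_mult intro!: mult_left_mono)
    ultimately show ?thesis using qn by linarith
  qed
  then show "y \<in> cube n" by (simp add: cube_def)
qed

text \<open>Along each axis the tiles miss at most 4k of the 2n+1 positions: the remainder of the
  division is at most 2k on either side.\<close>

lemma tile_density:
  "(\<lambda>n. real (card (tile_centers k n :: (int^'d::finite) set)) * cube_size TYPE('d) k / cube_size TYPE('d) n) \<longlonglongrightarrow> 1"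
proof -
  let ?q = "\<lambda>n. (n - k) div (2 * k + 1)"
  let ?b = "\<lambda>n. (2 * real (?q n) + 1) * (2 * real k + 1) / (2 * real n + 1)"
  have z: "(\<lambda>n. 1 - 4 * real k * inverse (real (Suc n))) \<longlonglongrightarrow> 1 - 4 * real k * 0"
    by (intro tendsto_diff tendsto_mult tendsto_const LIMSEQ_inverse_real_of_nat)
  have bounds: "1 - 4 * real k * inverse (real (Suc n)) \<le> ?b n \<and> ?b n \<le> 1" if "n \<ge> k" for n
  proof -
    have "(2 * k + 1) * ?q n \<le> n - k" by (rule times_div_less_eq_dividend)
    then have "real ((2 * k + 1) * ?q n) \<le> real (n - k)" by (rule of_nat_mono)
    then have up: "(2 * real k + 1) * real (?q n) \<le> real n - real k"
      using that by (simp add: of_nat_diff algebra_simps)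
    have "n - k = (2 * k + 1) * ?q n + (n - k) mod (2 * k + 1)"
      by (rule mult_div_mod_eq[symmetric])
    moreover have "(n - k) mod (2 * k + 1) \<le> 2 * k"
      using pos_mod_bound[of "2 * k + 1" "n - k"] by (metis Suc_eq_plus1 less_Suc_eq_le mod_less_divisor zero_less_Suc)
    ultimately have "n - k \<le> (2 * k + 1) * ?q n + 2 * k" by linarith
    then have "real (n - k) \<le> real ((2 * k + 1) * ?q n + 2 * k)" by (rule of_nat_mono)
    then have lo: "real n - real k \<le> (2 * real k + 1) * real (?q n) + 2 * real k"
      using that by (simp add: of_nat_diff algebra_simps)
    have eq: "(2 * real (?q n) + 1) * (2 * real k + 1) = 2 * ((2 * real k + 1) * real (?q n)) + 2 * real k + 1"
      by (simp add: algebra_simps)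
    have "?b n \<le> 1" using up unfolding eq by simp
    moreover have "1 - 4 * real k * inverse (real (Suc n)) \<le> 1 - 4 * real k / (2 * real n + 1)"
      by (simp add: divide_inverse mult_left_mono le_imp_inverse_le)
    moreover have "1 - 4 * real k / (2 * real n + 1) = (2 * real n + 1 - 4 * real k) / (2 * real n + 1)"
      by (simp add: diff_divide_distrib)
    moreover have "\<dots> \<le> ?b n"
      using lo unfolding eq by (intro divide_right_mono) auto
    ultimately show ?thesis by linarith
  qed
  have "?b \<longlonglongrightarrow> 1"
    by (rule tendsto_sandwich[OF _ _ z[simplified] tendsto_const])
       (use bounds in \<open>auto intro!: eventually_sequentiallyI[of k]\<close>)
  then have "(\<lambda>n. ?b n ^ CARD('d)) \<longlonglongrightarrow> 1 ^ CARD('d)" by (rule tendsto_power)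
  moreover have "?b n ^ CARD('d) =
      real (card (tile_centers k n :: (int^'d) set)) * cube_size TYPE('d) k / cube_size TYPE('d) n" for n
    by (simp add: card_tile_centers card_cube power_divide power_mult_distrib add.commute)
  ultimately show ?thesis by simp
qed

text \<open>After expanding f over patterns on V, the DLR equation replaces each cylinder indicator
  by \<open>gibbs_prob\<close>, and this is at most c times the unconditional probability whatever
  the outside is.\<close>

lemma gibbs_decoupling:
  fixes \<Psi> :: "'g::{ab_group_add,countable} potential"
  assumes \<Psi>: "ti_summable_potential \<Psi>" and \<mu>: "gibbs_measure \<Psi> \<mu>" and V: "finite V"
    and cmp: "\<And>a \<eta> \<eta>'. gibbs_prob \<Psi> V a \<eta> \<le> c * gibbs_prob \<Psi> V a \<eta>'"
    and f: "depends_only_on V f" "\<And>\<sigma>. 0 \<le> f \<sigma>"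
    and g: "depends_only_on (- V) g" "g \<in> borel_measurable borel" "\<And>\<sigma>. 0 \<le> g \<sigma>" "\<And>\<sigma>. g \<sigma> \<le> B"
  shows "(\<integral>\<eta>. f \<eta> * g \<eta> \<partial>\<mu>) \<le> c * (\<integral>\<eta>. f \<eta> \<partial>\<mu>) * (\<integral>\<eta>. g \<eta> \<partial>\<mu>)"
proof -
  have cm: "\<mu> \<in> config_measures" by (rule gibbs_measure_config[OF \<mu>])
  have gi: "integrable \<mu> g" by (rule bounded_integrable[OF cm g(2), where B=B]) (use g in simp)
  have ig: "integrable \<mu> (\<lambda>\<eta>. indicator (cylinder V a) \<eta> * g \<eta>)" for a
    by (rule bounded_integrable[OF cm, where B=B])
       (use g V order_trans[OF g(3) g(4)] in \<open>auto simp: indicator_def\<close>)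
  have ip: "integrable \<mu> (\<lambda>\<eta>. gibbs_prob \<Psi> V a \<eta> * g \<eta>)" for a
  proof (rule bounded_integrable[OF cm, where B="1 * B"])
    show "\<bar>gibbs_prob \<Psi> V a \<eta> * g \<eta>\<bar> \<le> 1 * B" for \<eta>
      unfolding abs_mult using g(3,4) gibbs_prob_le_1[OF V] gibbs_prob_pos[OF V, THEN less_imp_le]
      by (intro mult_mono) auto
  qed (use g gibbs_prob_measurable[OF \<Psi> V] in simp)
  have one: "(\<integral>\<eta>. indicator (cylinder V a) \<eta> * g \<eta> \<partial>\<mu>) \<le> c * measure \<mu> (cylinder V a) * (\<integral>\<eta>. g \<eta> \<partial>\<mu>)" for a
  proof -
    have "(\<integral>\<eta>. indicator (cylinder V a) \<eta> * g \<eta> \<partial>\<mu>) = (\<integral>\<eta>. gibbs_prob \<Psi> V a \<eta> * g \<eta> \<partial>\<mu>)"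
      by (rule DLR_integral[OF \<Psi> \<mu> V g(1,2)])
    also have "\<dots> \<le> (\<integral>\<eta>. c * measure \<mu> (cylinder V a) * g \<eta> \<partial>\<mu>)"
    proof (rule integral_mono[OF ip])
      show "gibbs_prob \<Psi> V a \<eta> * g \<eta> \<le> c * measure \<mu> (cylinder V a) * g \<eta>" for \<eta>
        by (intro mult_right_mono gibbs_prob_vs_measure(1)[OF \<Psi> \<mu> V] cmp g(3))
    qed (use gi in simp)
    finally show ?thesis by simp
  qed
  have "(\<integral>\<eta>. f \<eta> * g \<eta> \<partial>\<mu>) = (\<integral>\<eta>. (\<Sum>a\<in>V \<rightarrow>\<^sub>E UNIV. f a * (indicator (cylinder V a) \<eta> * g \<eta>)) \<partial>\<mu>)"
    by (intro Bochner_Integration.integral_cong refl, subst local_expansion[OF V f(1)])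
       (simp add: sum_distrib_left mult_ac)
  also have "\<dots> = (\<Sum>a\<in>V \<rightarrow>\<^sub>E UNIV. f a * (\<integral>\<eta>. indicator (cylinder V a) \<eta> * g \<eta> \<partial>\<mu>))"
    by (subst Bochner_Integration.integral_sum) (use ig in auto)
  also have "\<dots> \<le> (\<Sum>a\<in>V \<rightarrow>\<^sub>E UNIV. f a * (c * measure \<mu> (cylinder V a) * (\<integral>\<eta>. g \<eta> \<partial>\<mu>)))"
    by (intro sum_mono mult_left_mono one f(2))
  also have "\<dots> = c * (\<integral>\<eta>. f \<eta> \<partial>\<mu>) * (\<integral>\<eta>. g \<eta> \<partial>\<mu>)"
    by (simp add: integral_local[OF cm V f(1)] sum_distrib_left sum_distrib_right mult_ac)
  finally show ?thesis .
qed

lemma depends_only_on_shift: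
  assumes "depends_only_on V f"
  shows "depends_only_on (translate z V) (\<lambda>\<sigma>. f (shift z \<sigma>))"
  unfolding depends_only_on_def
proof (intro allI impI)
  fix \<sigma> \<sigma>' :: "'a config" assume eq: "\<forall>x\<in>translate z V. \<sigma> x = \<sigma>' x"
  show "f (shift z \<sigma>) = f (shift z \<sigma>')"
    by (rule depends_only_onD[OF assms]) (use eq in \<open>auto simp: shift_def translate_def\<close>)
qed

lemma depends_only_on_prod:
  assumes "\<And>z. z \<in> I \<Longrightarrow> depends_only_on A (f z)"
  shows "depends_only_on A (\<lambda>\<sigma>. \<Prod>z\<in>I. f z \<sigma> :: real)"
  unfolding depends_only_on_def
  by (intro allI impI prod.cong refl) (use assms in \<open>auto simp: depends_only_on_def\<close>)

lemma depends_only_on_sum: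
  assumes "\<And>z. z \<in> I \<Longrightarrow> depends_only_on A (f z)"
  shows "depends_only_on A (\<lambda>\<sigma>. \<Sum>z\<in>I. f z \<sigma> :: real)"
  unfolding depends_only_on_def
  by (intro allI impI sum.cong refl) (use assms in \<open>auto simp: depends_only_on_def\<close>)

text \<open>Recentering at z puts the tile of z onto V; by disjointness the remaining tiles then
  avoid V.\<close>

lemma shift_off_tile:
  assumes I: "z \<notin> I" "disjoint_tiles V (insert z I)"
    and f: "\<And>z'. z' \<in> I \<Longrightarrow> depends_only_on (translate z' V) (f z')"
  shows "depends_only_on (- V) (\<lambda>\<sigma>. \<Prod>z'\<in>I. f z' (shift (- z) \<sigma>) :: real)"
proof (rule depends_only_on_prod)
  fix z' assume z': "z' \<in> I"
  have "translate (- z) (translate z' V) \<subseteq> - V"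
  proof
    fix x assume "x \<in> translate (- z) (translate z' V)"
    then have "x + z \<in> translate z' V" by (simp add: translate_iff)
    then have "x + z \<notin> translate z V"
      using I z' unfolding disjoint_tiles_def by (metis IntI empty_iff insertCI)
    then show "x \<in> - V" by (simp add: translate_iff)
  qed
  then show "depends_only_on (- V) (\<lambda>\<sigma>. f z' (shift (- z) \<sigma>))"
    using depends_only_on_mono[OF depends_only_on_shift[OF f[OF z']]] by blast
qed

lemma gibbs_tiles:
  fixes \<Psi> :: "'g::{ab_group_add,countable} potential"
  assumes \<Psi>: "ti_summable_potential \<Psi>" and \<mu>: "gibbs_measure \<Psi> \<mu>" "translation_invariant \<mu>" and V: "finite V"
    and cmp: "\<And>a \<eta> \<eta>'. gibbs_prob \<Psi> V a \<eta> \<le> c * gibbs_prob \<Psi> V a \<eta>'" and c: "c \<ge> 0"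
    and f: "depends_only_on V f" "\<And>\<sigma>. 0 \<le> f \<sigma>"
    and I: "finite I" "disjoint_tiles V I"
  shows "(\<integral>\<eta>. (\<Prod>z\<in>I. f (shift z \<eta>)) \<partial>\<mu>) \<le> (c * (\<integral>\<eta>. f \<eta> \<partial>\<mu>)) ^ card I"
  using I
proof (induction I rule: finite_induct)
  case empty
  interpret prob_space \<mu> by (rule config_measuresD[OF gibbs_measure_config[OF \<mu>(1)]])
  show ?case by (simp add: prob_space)
next
  case (insert z I)
  have cm: "\<mu> \<in> config_measures" by (rule gibbs_measure_config[OF \<mu>(1)])
  obtain B where B: "\<And>\<sigma>. \<bar>f \<sigma>\<bar> \<le> B" using local_bounded[OF V f(1)] by blast
  let ?g = "\<lambda>\<sigma>. \<Prod>z'\<in>I. f (shift z' \<sigma>)"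
  have gm: "?g \<in> borel_measurable borel"
    by (intro borel_measurable_prod measurable_compose[OF shift_measurable local_measurable[OF V f(1)]])
  have fm: "f \<in> borel_measurable borel" by (rule local_measurable[OF V f(1)])
  have "(\<integral>\<eta>. (\<Prod>z\<in>insert z I. f (shift z \<eta>)) \<partial>\<mu>) = (\<integral>\<eta>. f (shift z \<eta>) * ?g (shift (- z) (shift z \<eta>)) \<partial>\<mu>)"
    using insert.hyps by simp
  also have "\<dots> = (\<integral>\<eta>. f \<eta> * ?g (shift (- z) \<eta>) \<partial>\<mu>)"
    by (rule integral_shift[OF cm \<mu>(2), of "\<lambda>\<eta>. f \<eta> * ?g (shift (- z) \<eta>)"])
       (intro borel_measurable_times fm measurable_compose[OF shift_measurable gm])
  also have "\<dots> \<le> c * (\<integral>\<eta>. f \<eta> \<partial>\<mu>) * (\<integral>\<eta>. ?g (shift (- z) \<eta>) \<partial>\<mu>)"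
  proof (rule gibbs_decoupling[OF \<Psi> \<mu>(1) V cmp f, where B="B ^ card I"])
    show "depends_only_on (- V) (\<lambda>\<eta>. ?g (shift (- z) \<eta>))"
      by (rule shift_off_tile[OF insert.hyps(2) insert.prems, of "\<lambda>z' \<sigma>. f (shift z' \<sigma>)"])
         (rule depends_only_on_shift[OF f(1)])
    show "(\<lambda>\<eta>. ?g (shift (- z) \<eta>)) \<in> borel_measurable borel"
      by (rule measurable_compose[OF shift_measurable gm])
    show "0 \<le> ?g (shift (- z) \<sigma>)" for \<sigma> by (intro prod_nonneg) (simp add: f)
    show "?g (shift (- z) \<sigma>) \<le> B ^ card I" for \<sigma>
      unfolding prod_constant[symmetric] using f(2) B by (intro prod_mono) (auto dest: abs_le_D1)
  qed
  also have "(\<integral>\<eta>. ?g (shift (- z) \<eta>) \<partial>\<mu>) = (\<integral>\<eta>. ?g \<eta> \<partial>\<mu>)"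
    by (rule integral_shift[OF cm \<mu>(2) gm])
  also have "c * (\<integral>\<eta>. f \<eta> \<partial>\<mu>) * (\<integral>\<eta>. ?g \<eta> \<partial>\<mu>) \<le> c * (\<integral>\<eta>. f \<eta> \<partial>\<mu>) * (c * (\<integral>\<eta>. f \<eta> \<partial>\<mu>)) ^ card I"
  proof (rule mult_left_mono)
    show "(\<integral>\<eta>. ?g \<eta> \<partial>\<mu>) \<le> (c * (\<integral>\<eta>. f \<eta> \<partial>\<mu>)) ^ card I"
      by (rule insert.IH) (use insert.prems in \<open>auto simp: disjoint_tiles_def\<close>)
    show "0 \<le> c * (\<integral>\<eta>. f \<eta> \<partial>\<mu>)" using c f(2) by (intro mult_nonneg_nonneg Bochner_Integration.integral_nonneg)
  qed
  finally show ?case using insert.hyps by simp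
qed

text \<open>The variational principle on W is tested with the sum over tiles of the log-density of
  \<nu> relative to \<mu> on V. Under \<nu> its mean is the number of tiles times the entropy of one
  tile, and under \<mu> its exponential moment nearly factorises over tiles.\<close>

lemma pattern_entropy_superadditive:
  fixes \<Psi> :: "'g::{ab_group_add,countable} potential"
  assumes \<Psi>: "ti_summable_potential \<Psi>" and \<mu>: "gibbs_measure \<Psi> \<mu>" "translation_invariant \<mu>"
    and \<nu>: "\<nu> \<in> config_measures" "translation_invariant \<nu>" and V: "finite V"
    and cmp: "\<And>a \<eta> \<eta>'. gibbs_prob \<Psi> V a \<eta> \<le> exp b * gibbs_prob \<Psi> V a \<eta>'"
    and W: "finite W" and I: "finite I" "disjoint_tiles V I" "\<And>z. z \<in> I \<Longrightarrow> translate z V \<subseteq> W"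
  shows "real (card I) * (pattern_entropy V \<nu> \<mu> - b - ln 2) \<le> pattern_entropy W \<nu> \<mu>"
proof -
  have cm: "\<mu> \<in> config_measures" by (rule gibbs_measure_config[OF \<mu>(1)])
  let ?m = "\<lambda>\<sigma>. measure \<mu> (cylinder V \<sigma>)" and ?n = "\<lambda>\<sigma>. measure \<nu> (cylinder V \<sigma>)"
  \<comment> \<open>On \<nu>-null patterns the density is replaced by 1 to keep its logarithm
    finite. This raises the \<mu>-mean from at most 1 to at most 2 and is the source of the loss
    \<open>ln 2\<close> per tile.\<close>
  define f where "f \<sigma> = (if ?n \<sigma> = 0 then 1 else ?n \<sigma> / ?m \<sigma>)" for \<sigma>
  have mpos: "measure \<mu> (cylinder A \<sigma>) > 0" if "finite A" for A \<sigma> by (rule gibbs_cylinder_pos[OF \<Psi> \<mu>(1) that])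
  have fpos: "f \<sigma> > 0" for \<sigma> using mpos[OF V, of \<sigma>] by (auto simp: f_def less_le)
  have depf: "depends_only_on V f"
    unfolding depends_only_on_def
  proof (intro allI impI)
    fix \<sigma> \<sigma>' :: "'g config" assume "\<forall>x\<in>V. \<sigma> x = \<sigma>' x"
    then have "cylinder V \<sigma> = cylinder V \<sigma>'" by (auto simp: cylinder_def)
    then show "f \<sigma> = f \<sigma>'" by (simp add: f_def)
  qed
  then have depl: "depends_only_on V (\<lambda>\<sigma>. ln (f \<sigma>))" unfolding depends_only_on_def by metis
  have Ef: "(\<integral>\<sigma>. f \<sigma> \<partial>\<mu>) \<le> 2"
  proof -
    have "(\<integral>\<sigma>. f \<sigma> \<partial>\<mu>) \<le> (\<Sum>\<xi>\<in>V \<rightarrow>\<^sub>E UNIV. ?n \<xi> + ?m \<xi>)"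
      unfolding integral_local[OF cm V depf]
      by (rule sum_mono) (use mpos[OF V] in \<open>auto simp: f_def less_imp_neq[symmetric]\<close>)
    also have "\<dots> = 2" by (simp add: sum.distrib sum_cylinder_measure[OF cm V] sum_cylinder_measure[OF \<nu>(1) V])
    finally show ?thesis .
  qed
  have El: "(\<integral>\<sigma>. ln (f \<sigma>) \<partial>\<nu>) = pattern_entropy V \<nu> \<mu>"
    unfolding integral_local[OF \<nu>(1) V depl] pattern_entropy_def
    by (intro sum.cong refl) (auto simp: f_def)
  define F where "F \<sigma> = (\<Sum>z\<in>I. ln (f (shift z \<sigma>)))" for \<sigma>
  have depF: "depends_only_on W F"
    unfolding F_def[abs_def]
    by (intro depends_only_on_sum depends_only_on_mono[OF depends_only_on_shift[OF depl]] I(3))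
  have expF: "exp (F \<sigma>) = (\<Prod>z\<in>I. f (shift z \<sigma>))" for \<sigma>
    unfolding F_def exp_sum[OF I(1)] by (intro prod.cong refl) (simp add: fpos)
  have "real (card I) * pattern_entropy V \<nu> \<mu> = (\<integral>\<sigma>. F \<sigma> \<partial>\<nu>)"
  proof -
    have "(\<integral>\<sigma>. F \<sigma> \<partial>\<nu>) = (\<Sum>z\<in>I. \<integral>\<sigma>. ln (f (shift z \<sigma>)) \<partial>\<nu>)"
      unfolding F_def
      by (intro Bochner_Integration.integral_sum local_integrable[OF \<nu>(1) _ depends_only_on_shift[OF depl]]) (use V in simp)
    also have "\<dots> = (\<Sum>z\<in>I. pattern_entropy V \<nu> \<mu>)"
      unfolding El[symmetric] by (intro sum.cong refl integral_shift[OF \<nu>] local_measurable[OF V depl])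
    finally show ?thesis by simp
  qed
  also have "\<dots> \<le> pattern_entropy W \<nu> \<mu> + ln (\<integral>\<sigma>. exp (F \<sigma>) \<partial>\<mu>)"
    by (rule variational_bound_real[OF cm \<nu>(1) W depF]) (use mpos[OF W] in \<open>auto simp: less_imp_neq[symmetric]\<close>)
  also have "ln (\<integral>\<sigma>. exp (F \<sigma>) \<partial>\<mu>) \<le> real (card I) * (b + ln 2)"
  proof -
    have "(\<integral>\<sigma>. exp (F \<sigma>) \<partial>\<mu>) \<le> (exp b * (\<integral>\<sigma>. f \<sigma> \<partial>\<mu>)) ^ card I"
      unfolding expF by (rule gibbs_tiles[OF \<Psi> \<mu> V cmp _ depf _ I(1,2)]) (use fpos in \<open>auto simp: less_imp_le\<close>)
    also have "\<dots> \<le> (exp b * 2) ^ card I"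
      using Ef fpos by (intro power_mono mult_left_mono mult_nonneg_nonneg Bochner_Integration.integral_nonneg) (auto simp: less_imp_le)
    also have "\<dots> = exp (real (card I) * (b + ln 2))" by (simp add: exp_of_nat_mult exp_add)
    finally have le: "(\<integral>\<sigma>. exp (F \<sigma>) \<partial>\<mu>) \<le> exp (real (card I) * (b + ln 2))" .
    show ?thesis
    proof (cases "(\<integral>\<sigma>. exp (F \<sigma>) \<partial>\<mu>) > 0")
      case True
      then show ?thesis using le by (metis exp_gt_zero ln_exp ln_le_cancel_iff)
    next
      case False
      have "(\<integral>\<sigma>. exp (F \<sigma>) \<partial>\<mu>) \<ge> 0" by (intro Bochner_Integration.integral_nonneg) simp
      then have z: "(\<integral>\<sigma>. exp (F \<sigma>) \<partial>\<mu>) = 0" using False by linarith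
      \<comment> \<open>If the integral vanished, so would the shifted one, and the identity would
        read ln 0 = ln 0 + 1.\<close>
      have "ln (\<integral>\<sigma>. exp (F \<sigma> - (- 1)) \<partial>\<mu>) = ln (\<integral>\<sigma>. exp (F \<sigma>) \<partial>\<mu>) - (- 1)"
        by (rule ln_integral_exp_centered[OF cm W depF])
      then show ?thesis using z by (simp add: exp_add)
    qed
  qed
  finally show ?thesis by (simp add: algebra_simps)
qed

text \<open>Every late term is at most liminf + d, hence limsup is at most liminf + d for each d;
  boundedness makes the common value finite.\<close>

lemma convergent_almost_superadditive:
  fixes u :: "nat \<Rightarrow> real"
  assumes b: "\<And>n. 0 \<le> u n" "\<And>n. u n \<le> B"
    and s: "\<And>d. d > 0 \<Longrightarrow> eventually (\<lambda>k. eventually (\<lambda>n. u k - d \<le> u n) sequentially) sequentially"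
  obtains L where "u \<longlonglongrightarrow> L"
proof -
  let ?x = "\<lambda>n. ereal (u n)"
  have "limsup ?x \<le> liminf ?x"
  proof (rule ereal_le_epsilon2)
    fix d :: real assume "d > 0"
    from s[OF this] have "eventually (\<lambda>k. ?x k \<le> liminf ?x + ereal d) sequentially"
    proof eventually_elim
      case (elim k)
      then have "eventually (\<lambda>n. ereal (u k - d) \<le> ?x n) sequentially" by simp
      then have "ereal (u k - d) \<le> liminf ?x" by (rule Liminf_bounded)
      then show ?case by (cases "liminf ?x") auto
    qed
    then show "limsup ?x \<le> liminf ?x + ereal d" by (rule Limsup_bounded)
  qed
  then have eq: "liminf ?x = limsup ?x"
    using Liminf_le_Limsup[of sequentially ?x] by (simp add: antisym)
  then have lim: "?x \<longlonglongrightarrow> limsup ?x" by (simp add: tendsto_iff_Liminf_eq_Limsup)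
  have "0 \<le> liminf ?x" by (rule Liminf_bounded) (use b in simp)
  moreover have "limsup ?x \<le> ereal B" by (rule Limsup_bounded) (use b in simp)
  ultimately obtain L where "limsup ?x = ereal L" using eq by (cases "limsup ?x") auto
  then have "u \<longlonglongrightarrow> L" using lim by simp
  then show thesis by (rule that)
qed

lemma entropy_per_site_real:
  fixes \<mu> \<nu> :: "(int^'d::finite) config measure"
  assumes "\<And>a. measure \<mu> (cylinder (cube n) a) > 0"
  shows "entropy_per_site \<nu> \<mu> n = ereal (pattern_entropy (cube n) \<nu> \<mu> / cube_size TYPE('d) n)"
proof -
  have "relative_entropy (cube n) \<nu> \<mu> = ereal (pattern_entropy (cube n) \<nu> \<mu>)"
    using assms by (auto simp: relative_entropy_def pattern_entropy_def less_imp_neq[symmetric])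
  moreover have "(cube n :: (int^'d) set) \<noteq> {}" using cube_0 by blast
  ultimately show ?thesis by (simp add: entropy_per_site_def)
qed

text \<open>Tiling a large cube by copies of a fixed one shows that the entropy per site almost
  increases. The lower bound on cylinder probabilities bounds it by ln(1/\<kappa>), so the limit is
  a real number and can be subtracted later.\<close>

lemma entropy_density_exists:
  fixes \<Psi> :: "(int^'d::finite) potential"
  assumes \<Psi>: "ti_summable_potential \<Psi>" and \<mu>: "gibbs_measure \<Psi> \<mu>" "translation_invariant \<mu>"
    and \<nu>: "\<nu> \<in> config_measures" "translation_invariant \<nu>"
    and low: "\<kappa> > 0" "\<And>n a. \<kappa> ^ card (cube n :: (int^'d) set) \<le> measure \<mu> (cylinder (cube n) a)"
  obtains L where "(\<lambda>n. pattern_entropy (cube n) \<nu> \<mu> / cube_size TYPE('d) n) \<longlonglongrightarrow> L"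
    and "relative_entropy_density \<nu> \<mu> = ereal L"
proof -
  have cm: "\<mu> \<in> config_measures" by (rule gibbs_measure_config[OF \<mu>(1)])
  have mpos: "measure \<mu> (cylinder (cube n) a) > 0" for n a
    using low zero_less_power[OF low(1)] by (meson less_le_trans)
  let ?u = "\<lambda>n. pattern_entropy (cube n) \<nu> \<mu> / cube_size TYPE('d) n"
  note cpos = cube_size_pos[where 'd='d]
  have re: "relative_entropy (cube n) \<nu> \<mu> = ereal (pattern_entropy (cube n) \<nu> \<mu>)" for n
    using mpos by (auto simp: relative_entropy_def pattern_entropy_def less_imp_neq[symmetric])
  have u0: "0 \<le> ?u n" for n
    using relative_entropy_nonneg[OF cm \<nu>(1) finite_cube, of n] cpos[of n] by (simp add: re)
  have uB: "?u n \<le> ln (1 / \<kappa>)" for n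
  proof -
    have "relative_entropy (cube n) \<nu> \<mu> \<le> ereal (cube_size TYPE('d) n * ln (1 / \<kappa>))"
    proof (rule relative_entropy_le[OF cm \<nu>(1) finite_cube])
      fix a
      interpret prob_space \<nu> by (rule config_measuresD[OF \<nu>(1)])
      have "exp (cube_size TYPE('d) n * ln (1 / \<kappa>)) * \<kappa> ^ card (cube n :: (int^'d) set) = 1"
        using low(1) by (simp add: exp_of_nat_mult power_mult_distrib[symmetric])
      then have "1 \<le> exp (cube_size TYPE('d) n * ln (1 / \<kappa>)) * measure \<mu> (cylinder (cube n) a)"
        using low(2)[of n a] by (metis exp_ge_zero mult_left_mono)
      then show "measure \<nu> (cylinder (cube n) a) \<le> exp (cube_size TYPE('d) n * ln (1 / \<kappa>)) * measure \<mu> (cylinder (cube n) a)"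
        using prob_le_1[of "cylinder (cube n) a"] by linarith
    qed
    then show ?thesis using cpos[of n] by (simp add: re divide_le_eq mult.commute)
  qed
  have sa: "eventually (\<lambda>k. eventually (\<lambda>n. ?u k - d \<le> ?u n) sequentially) sequentially" if d: "d > 0" for d
  proof -
    \<comment> \<open>Boundary coupling and \<open>ln 2\<close> cost at most e per site of the small
      cube each, incomplete coverage costs another e: 3e in all, below d.\<close>
    define e where "e = d / 4"
    have e: "e > 0" using d by (simp add: e_def)
    have "eventually (\<lambda>k. ln 2 \<le> e * cube_size TYPE('d) k) sequentially"
    proof -
      obtain K :: nat where K: "ln 2 / e \<le> real K" using real_arch_simple by blast
      have "ln 2 \<le> e * cube_size TYPE('d) k" if "k \<ge> K" for k
      proof -
        have "(2 * real k + 1) ^ 1 \<le> (2 * real k + 1) ^ CARD('d)"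
          by (rule power_increasing) (auto simp: Suc_le_eq)
        then have "real k \<le> cube_size TYPE('d) k" by (simp add: card_cube add.commute)
        then have "ln 2 / e \<le> cube_size TYPE('d) k" using K that by linarith
        then show ?thesis using e by (simp add: divide_le_eq mult.commute)
      qed
      then show ?thesis by (auto simp: eventually_sequentially)
    qed
    with gibbs_prob_cube_uniform[OF \<Psi> e]
    show ?thesis
    proof eventually_elim
      case (elim k)
      let ?N = "\<lambda>n. real (card (tile_centers k n :: (int^'d) set))"
      let ?v = "?u k - 2 * e"
      have "(\<lambda>n. ?N n * cube_size TYPE('d) k / cube_size TYPE('d) n * ?v) \<longlonglongrightarrow> 1 * ?v"
        by (intro tendsto_mult tile_density tendsto_const)
      then have "eventually (\<lambda>n. ?v - e < ?N n * cube_size TYPE('d) k / cube_size TYPE('d) n * ?v) sequentially"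
        by (rule order_tendstoD) (use e in simp)
      then show ?case using eventually_ge_at_top[of k]
      proof eventually_elim
        case (elim n)
        have cmp: "gibbs_prob \<Psi> (cube k) a \<eta> \<le> exp (e * cube_size TYPE('d) k) * gibbs_prob \<Psi> (cube k) a \<eta>'" for a \<eta> \<eta>'
          using \<open>\<forall>a \<eta> \<eta>'. _ a \<eta> \<eta>'\<close> by blast
        have "?N n * (pattern_entropy (cube k) \<nu> \<mu> - e * cube_size TYPE('d) k - ln 2) \<le> pattern_entropy (cube n) \<nu> \<mu>"
          by (rule pattern_entropy_superadditive[OF \<Psi> \<mu> \<nu> finite_cube cmp finite_cube finite_tile_centers
                tile_centers_disjoint tile_subset_cube]) (use elim in auto)
        moreover have "?N n * (cube_size TYPE('d) k * ?v) \<le> ?N n * (pattern_entropy (cube k) \<nu> \<mu> - e * cube_size TYPE('d) k - ln 2)"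
        proof (rule mult_left_mono)
          have "cube_size TYPE('d) k \<noteq> 0" using cpos[of k] by (rule less_imp_neq[symmetric])
          then have "cube_size TYPE('d) k * ?u k = pattern_entropy (cube k) \<nu> \<mu>"
            by (subst times_divide_eq_right) (rule nonzero_mult_div_cancel_left)
          then show "cube_size TYPE('d) k * ?v \<le> pattern_entropy (cube k) \<nu> \<mu> - e * cube_size TYPE('d) k - ln 2"
            using \<open>ln 2 \<le> _\<close> by (simp only: right_diff_distrib) (simp add: mult_ac)
        qed simp
        ultimately have "?N n * (cube_size TYPE('d) k * ?v) / cube_size TYPE('d) n \<le> ?u n"
          using cpos[of n] by (intro divide_right_mono) auto
        then have "?v - e \<le> ?u n" using elim(1) by (simp add: mult_ac)
        then show ?case using d by (simp add: e_def)
      qed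
    qed
  qed
  obtain L where L: "?u \<longlonglongrightarrow> L"
    by (rule convergent_almost_superadditive[OF u0 uB sa])
  have "entropy_per_site \<nu> \<mu> \<longlonglongrightarrow> ereal L"
    using L entropy_per_site_real[OF mpos, of \<nu>] by (simp add: entropy_per_site_real[OF mpos, abs_def])
  then have "relative_entropy_density \<nu> \<mu> = ereal L"
    unfolding relative_entropy_density_def by (rule limI)
  with L show thesis by (rule that)
qed

section \<open>Zero relative entropy production\<close>

lemma pattern_prob_pos:
  assumes "\<kappa> > 0" "\<And>x b \<eta>. \<kappa> \<le> site_prob r x b \<eta>"
  shows "0 < pattern_prob r W s \<eta>"
proof -
  have "0 < \<kappa> ^ card W" using assms(1) by simp
  also have "\<dots> \<le> pattern_prob r W s \<eta>" using assms by (intro pattern_prob_lower) auto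
  finally show ?thesis .
qed

lemma pattern_prob_crude_ratio:
  assumes r: "pca_coefficients r" and \<kappa>: "\<kappa> > 0" "\<And>x b \<eta>. \<kappa> \<le> site_prob r x b \<eta>"
  shows "pattern_prob r N s \<zeta> \<le> exp (real (card N) * ln (1 / \<kappa>)) * pattern_prob r N s \<zeta>'"
proof -
  have "pattern_prob r N s \<zeta> \<le> exp (real (card N) * ln (1 / \<kappa>)) * \<kappa> ^ card N"
    using \<kappa>(1) pattern_prob_le_1[OF r, of N s \<zeta>] by (simp add: exp_of_nat_mult power_mult_distrib[symmetric])
  also have "\<dots> \<le> exp (real (card N) * ln (1 / \<kappa>)) * pattern_prob r N s \<zeta>'"
    using \<kappa> by (intro mult_left_mono pattern_prob_lower) auto
  finally show ?thesis .
qed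

lemma rate_bound_log:
  assumes r: "pca_coefficients r" and \<kappa>: "\<kappa> > 0" "\<And>x b \<eta>. \<kappa> \<le> site_prob r x b \<eta>"
  shows "ln (1 / \<kappa>) \<ge> 0"
  using \<kappa>(1) order_trans[OF \<kappa>(2) site_prob_le_1[OF r]] by (simp add: ln_div)

text \<open>Deep inside the cube a site sees only spins on which the two configurations agree, up to
  a small error per site. In the shell of width m only the crude bound 1/\<kappa> per site is
  available, but the shell is a vanishing fraction. Each region accounts for half of the
  exponent.\<close>

lemma cube_pattern_boundary:
  fixes r :: "(int^'d::finite) set \<Rightarrow> real"
  assumes r: "pca_coefficients r" and \<kappa>: "\<kappa> > 0" "\<And>x b \<eta>. \<kappa> \<le> site_prob r x b \<eta>" and d: "d > 0"
  shows "eventually (\<lambda>k. \<forall>s \<zeta> \<zeta>'. (\<forall>x\<in>cube k. \<zeta> x = \<zeta>' x) \<longrightarrow>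
           pattern_prob r (cube k) s \<zeta> \<le> exp (d * cube_size TYPE('d) k) * pattern_prob r (cube k) s \<zeta>') sequentially"
proof -
  define l where "l = ln (1 / \<kappa>)"
  have l: "l \<ge> 0" unfolding l_def by (rule rate_bound_log[OF r \<kappa>])
  define e where "e = \<kappa> * d / 2"
  have e: "e > 0" using \<kappa>(1) d by (simp add: e_def)
  have ek: "e / \<kappa> = d / 2" using \<kappa>(1) by (simp add: e_def)
  obtain m where m: "\<And>x b \<eta> \<eta>'. (\<And>a. a \<in> cube m \<Longrightarrow> \<eta> (a + x) = \<eta>' (a + x)) \<Longrightarrow>
      \<bar>site_prob r x b \<eta> - site_prob r x b \<eta>'\<bar> \<le> e"
    using site_prob_cube_modulus[OF r e] by metis
  have "d / (2 * (l + 1)) > 0" using d l by simp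
  from cube_size_lower_shell[OF this, where 'd='d and m=m]
  show ?thesis
  proof eventually_elim
    case (elim k)
    let ?V = "cube k :: (int^'d) set" and ?I = "cube (k - m) :: (int^'d) set"
    have sub: "?I \<subseteq> ?V" by (rule cube_mono) simp
    have cardS: "real (card (?V - ?I)) = cube_size TYPE('d) k - cube_size TYPE('d) (k - m)"
      using card_mono[OF finite_cube sub] by (simp add: card_Diff_subset[OF finite_cube sub] of_nat_diff)
    show ?case
    proof (intro allI impI)
      fix s \<zeta> \<zeta>' :: "(int^'d) config" assume eq: "\<forall>x\<in>cube k. \<zeta> x = \<zeta>' x"
      have split: "pattern_prob r ?V s \<zeta> = pattern_prob r ?I s \<zeta> * pattern_prob r (?V - ?I) s \<zeta>" for \<zeta>
      proof -
        have "?V = ?I \<union> (?V - ?I)" using sub by auto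
        then have "pattern_prob r ?V s \<zeta> = pattern_prob r (?I \<union> (?V - ?I)) s \<zeta>" by simp
        also have "\<dots> = pattern_prob r ?I s \<zeta> * pattern_prob r (?V - ?I) s \<zeta>"
          by (rule pattern_prob_union) auto
        finally show ?thesis .
      qed
      have inner: "pattern_prob r ?I s \<zeta> \<le> exp (real (card ?I) * (e / \<kappa>)) * pattern_prob r ?I s \<zeta>'"
      proof (rule pattern_prob_ratio[OF \<kappa> finite_cube])
        fix y assume y: "y \<in> ?I"
        show "\<bar>site_prob r y (s y) \<zeta> - site_prob r y (s y) \<zeta>'\<bar> \<le> e"
        proof (rule m)
          fix a :: "int^'d" assume "a \<in> cube m"
          then have "a + y \<in> cube k" using cube_add[OF _ y, of a m] elim by simp
          then show "\<zeta> (a + y) = \<zeta>' (a + y)" using eq by simp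
        qed
      qed
      have shell: "pattern_prob r (?V - ?I) s \<zeta> \<le> exp (real (card (?V - ?I)) * l) * pattern_prob r (?V - ?I) s \<zeta>'"
        unfolding l_def by (rule pattern_prob_crude_ratio[OF r \<kappa>])
      have "pattern_prob r ?V s \<zeta> \<le> (exp (real (card ?I) * (e / \<kappa>)) * pattern_prob r ?I s \<zeta>') *
          (exp (real (card (?V - ?I)) * l) * pattern_prob r (?V - ?I) s \<zeta>')"
        unfolding split by (intro mult_mono inner shell mult_nonneg_nonneg pattern_prob_nonneg[OF r]) auto
      also have "\<dots> = exp (real (card ?I) * (e / \<kappa>) + real (card (?V - ?I)) * l) * pattern_prob r ?V s \<zeta>'"
        unfolding split exp_add by (simp only: mult_ac)
      also have "\<dots> \<le> exp (d * cube_size TYPE('d) k) * pattern_prob r ?V s \<zeta>'"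
      proof (intro mult_right_mono pattern_prob_nonneg[OF r])
        have "real (card ?I) * (e / \<kappa>) \<le> cube_size TYPE('d) k * (d / 2)"
          unfolding ek using d by (intro mult_right_mono cube_size_mono) auto
        moreover have "real (card (?V - ?I)) * l \<le> (d / (2 * (l + 1)) * cube_size TYPE('d) k) * l"
          unfolding cardS using elim l by (intro mult_right_mono) auto
        moreover have "(d / (2 * (l + 1)) * cube_size TYPE('d) k) * l \<le> cube_size TYPE('d) k * (d / 2)"
        proof -
          have "d / (2 * (l + 1)) * l \<le> d / 2" using l d by (simp add: field_simps)
          then have "cube_size TYPE('d) k * (d / (2 * (l + 1)) * l) \<le> cube_size TYPE('d) k * (d / 2)"
            by (intro mult_left_mono) auto
          then show ?thesis by (simp only: mult_ac)
        qed
        ultimately have "real (card ?I) * (e / \<kappa>) + real (card (?V - ?I)) * l \<le> d * cube_size TYPE('d) k"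
          by (simp add: mult.commute)
        then show "exp (real (card ?I) * (e / \<kappa>) + real (card (?V - ?I)) * l) \<le> exp (d * cube_size TYPE('d) k)"
          by simp
      qed
      finally show "pattern_prob r ?V s \<zeta> \<le> exp (d * cube_size TYPE('d) k) * pattern_prob r ?V s \<zeta>'" .
    qed
  qed
qed

lemma translate_translate: "translate y (translate z A) = translate (z + y) A"
  by (auto simp: translate_def image_image add.assoc)

lemma translate_0 [simp]: "translate 0 A = A"
  by (simp add: translate_def)

text \<open>The spins of U are switched one at a time, each at cost e. The bound for the spin at 0
  applies after translating x to the origin; the condition on y - x says that the translated F
  misses C.\<close>

lemma far_influence:
  fixes r :: "('g::ab_group_add) set \<Rightarrow> real"
  assumes tail: "\<And>F \<eta> s b b'. finite F \<Longrightarrow> F \<inter> C = {} \<Longrightarrow>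
       pattern_prob r F s (\<eta>(0 := b)) \<le> exp e * pattern_prob r F s (\<eta>(0 := b'))"
    and F: "finite F" and "finite U" "\<And>x y. x \<in> U \<Longrightarrow> y \<in> F \<Longrightarrow> y - x \<notin> C"
  shows "pattern_prob r F s (override_on \<eta> a U) \<le> exp (e * real (card U)) * pattern_prob r F s (override_on \<eta> b U)"
  using assms(3,4)
proof (induction U arbitrary: \<eta> rule: finite_induct)
  case empty
  then show ?case by simp
next
  case (insert x U)
  have single: "pattern_prob r F s (\<zeta>(x := p)) \<le> exp e * pattern_prob r F s (\<zeta>(x := q))" for \<zeta> p q
  proof -
    let ?F = "translate (- x) F"
    have F': "translate x ?F = F" by (simp add: translate_translate)
    have upd: "shift x (\<zeta>(x := p)) = (shift x \<zeta>)(0 := p)" for p by (auto simp: shift_def)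
    have "?F \<inter> C = {}"
      using insert.prems[of x] by (auto simp: translate_def)
    then have "pattern_prob r ?F (shift x s) ((shift x \<zeta>)(0 := p)) \<le> exp e * pattern_prob r ?F (shift x s) ((shift x \<zeta>)(0 := q))"
      by (intro tail) (use F in auto)
    then show ?thesis
      using pattern_prob_translate[of r x ?F s "\<zeta>(x := p)"] pattern_prob_translate[of r x ?F s "\<zeta>(x := q)"]
      by (simp add: F' upd)
  qed
  have ov1: "override_on \<eta> a (insert x U) = override_on (\<eta>(x := a x)) a U" by (auto simp: override_on_def)
  have ov2: "override_on (\<eta>(x := a x)) b U = (override_on \<eta> b U)(x := a x)"
    using insert.hyps by (auto simp: override_on_def fun_eq_iff)
  have ov3: "(override_on \<eta> b U)(x := b x) = override_on \<eta> b (insert x U)"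
    by (auto simp: override_on_def fun_eq_iff)
  have "pattern_prob r F s (override_on \<eta> a (insert x U)) \<le>
      exp (e * real (card U)) * pattern_prob r F s ((override_on \<eta> b U)(x := a x))"
    unfolding ov1 ov2[symmetric] by (rule insert.IH) (use insert.prems in auto)
  also have "\<dots> \<le> exp (e * real (card U)) * (exp e * pattern_prob r F s (override_on \<eta> b (insert x U)))"
    unfolding ov3[symmetric] by (intro mult_left_mono single) auto
  also have "\<dots> = exp (e * real (card (insert x U))) * pattern_prob r F s (override_on \<eta> b (insert x U))"
    using insert.hyps by (simp add: exp_add[symmetric] mult.assoc[symmetric] algebra_simps)
  finally show ?case .
qed

text \<open>Replacing pattern a by b on a cube V barely affects transitions outside V. With W split
  into V, a surrounding shell N and the far part F, there are four factors exp((d/4) |V|): two on V,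
  where the configuration outside is ignored for a and for b, one on N from its small size, and one
  on F, where each switched spin costs d/4.\<close>

lemma pattern_swap:
  fixes r :: "(int^'d::finite) set \<Rightarrow> real"
  assumes r: "pca_coefficients r" and \<kappa>: "\<kappa> > 0" "\<And>x b \<eta>. \<kappa> \<le> site_prob r x b \<eta>"
    and tails: "\<forall>e>0. \<exists>C. finite C \<and> (\<forall>F \<eta> s b b'. finite F \<longrightarrow> F \<inter> C = {} \<longrightarrow>
       pattern_prob r F s (\<eta>(0 := b)) \<le> exp e * pattern_prob r F s (\<eta>(0 := b')))"
    and d: "d > 0"
  shows "eventually (\<lambda>k. \<forall>W s \<eta> a b. finite W \<longrightarrow> cube k \<subseteq> W \<longrightarrow>
      pattern_prob r W s (override_on \<eta> a (cube k)) * pattern_prob r (cube k) s b \<le>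
      exp (d * cube_size TYPE('d) k) *
        (pattern_prob r W s (override_on \<eta> b (cube k)) * pattern_prob r (cube k) s a)) sequentially"
proof -
  define l where "l = ln (1 / \<kappa>)"
  have l: "l \<ge> 0" unfolding l_def by (rule rate_bound_log[OF r \<kappa>])
  have d4: "d / 4 > 0" using d by simp
  obtain C where C: "finite C" "\<And>F \<eta> s b b'. finite F \<Longrightarrow> F \<inter> C = {} \<Longrightarrow>
       pattern_prob r F s (\<eta>(0 := b)) \<le> exp (d / 4) * pattern_prob r F s (\<eta>(0 := b'))"
    using tails d4 by meson
  obtain m where m: "C \<subseteq> cube m" using finite_subset_cube[OF C(1)] by blast
  have "d / (4 * (l + 1)) > 0" using d l by simp
  from cube_size_upper_shell[OF this, where 'd='d and m=m] cube_pattern_boundary[OF r \<kappa> d4]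
  show ?thesis
  proof eventually_elim
    case (elim k)
    let ?V = "cube k :: (int^'d) set" and ?c = "cube_size TYPE('d) k"
    show ?case
    proof (intro allI impI)
      fix W and s \<eta> a b :: "(int^'d) config"
      assume W: "finite W" "?V \<subseteq> W"
      let ?a = "override_on \<eta> a ?V" and ?b = "override_on \<eta> b ?V"
      define N where "N = (W - ?V) \<inter> cube (k + m)"
      define F where "F = W - cube (k + m)"
      have fin: "finite N" "finite F" using W by (auto simp: N_def F_def)
      have km: "?V \<subseteq> cube (k + m)" by (rule cube_mono) simp
      have Weq: "W = ?V \<union> (N \<union> F)" using W km by (auto simp: N_def F_def)
      have split: "pattern_prob r W s \<zeta> = pattern_prob r ?V s \<zeta> * (pattern_prob r N s \<zeta> * pattern_prob r F s \<zeta>)" for \<zeta>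
      proof -
        have "pattern_prob r W s \<zeta> = pattern_prob r ?V s \<zeta> * pattern_prob r (N \<union> F) s \<zeta>"
          by (subst Weq, rule pattern_prob_union) (use fin km in \<open>auto simp: N_def F_def\<close>)
        also have "pattern_prob r (N \<union> F) s \<zeta> = pattern_prob r N s \<zeta> * pattern_prob r F s \<zeta>"
          by (rule pattern_prob_union) (use fin in \<open>auto simp: N_def F_def\<close>)
        finally show ?thesis .
      qed
      let ?e = "exp (d / 4 * ?c)"
      have Va: "pattern_prob r ?V s ?a \<le> ?e * pattern_prob r ?V s a"
        by (rule elim(2)[rule_format]) (simp add: override_on_def)
      have Vb: "pattern_prob r ?V s b \<le> ?e * pattern_prob r ?V s ?b"
        by (rule elim(2)[rule_format]) (simp add: override_on_def)
      have near: "pattern_prob r N s ?a \<le> ?e * pattern_prob r N s ?b"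
      proof -
        have "pattern_prob r N s ?a \<le> exp (real (card N) * l) * pattern_prob r N s ?b"
          unfolding l_def by (rule pattern_prob_crude_ratio[OF r \<kappa>])
        also have "\<dots> \<le> ?e * pattern_prob r N s ?b"
        proof (intro mult_right_mono pattern_prob_nonneg[OF r])
          have "card N \<le> card (cube (k + m) - ?V)"
            by (rule card_mono) (auto simp: N_def)
          then have "real (card N) \<le> real (card (cube (k + m) - ?V))" by simp
          also have "\<dots> = cube_size TYPE('d) (k + m) - ?c"
            using card_mono[OF finite_cube km] by (simp add: card_Diff_subset[OF finite_cube km] of_nat_diff)
          also have "\<dots> \<le> d / (4 * (l + 1)) * ?c" by (rule elim(1))
          finally have "real (card N) * l \<le> d / (4 * (l + 1)) * ?c * l" using l by (rule mult_right_mono)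
          also have "\<dots> \<le> d / 4 * ?c"
          proof -
            have "d / (4 * (l + 1)) * l \<le> d / 4" using l d by (simp add: field_simps)
            then have "d / (4 * (l + 1)) * l * ?c \<le> d / 4 * ?c" by (intro mult_right_mono) auto
            then show ?thesis by (simp only: mult_ac)
          qed
          finally show "exp (real (card N) * l) \<le> ?e" by simp
        qed
        finally show ?thesis .
      qed
      have far: "pattern_prob r F s ?a \<le> ?e * pattern_prob r F s ?b"
      proof (rule far_influence[OF C(2) fin(2) finite_cube])
        fix x y assume "x \<in> ?V" "y \<in> F"
        then show "y - x \<notin> C"
          using cube_add[of x k "y - x" m] m by (auto simp: F_def)
      qed
      note nn = pattern_prob_nonneg[OF r]
      have "pattern_prob r W s ?a * pattern_prob r ?V s b \<le>
          ((?e * pattern_prob r ?V s a) * ((?e * pattern_prob r N s ?b) * (?e * pattern_prob r F s ?b))) *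
          (?e * pattern_prob r ?V s ?b)"
        unfolding split by (intro mult_mono Va Vb near far mult_nonneg_nonneg nn) auto
      also have "\<dots> = (?e * ?e * ?e * ?e) * (pattern_prob r W s ?b * pattern_prob r ?V s a)"
        unfolding split by (simp only: mult_ac)
      also have "?e * ?e * ?e * ?e = exp (d * ?c)" by (simp add: exp_add[symmetric])
      finally show "pattern_prob r W s ?a * pattern_prob r ?V s b \<le>
          exp (d * ?c) * (pattern_prob r W s ?b * pattern_prob r ?V s a)" .
    qed
  qed
qed

text \<open>The conditional probabilities of a and of b are both comparable to the unconditional
  ones, so their ratios agree up to one factor c for each.\<close>

lemma gibbs_swap:
  fixes \<Psi> :: "'g::{ab_group_add,countable} potential"
  assumes \<Psi>: "ti_summable_potential \<Psi>" and \<mu>: "gibbs_measure \<Psi> \<mu>" and V: "finite V" and c: "c \<ge> 0"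
    and cmp: "\<And>a \<eta> \<eta>'. gibbs_prob \<Psi> V a \<eta> \<le> c * gibbs_prob \<Psi> V a \<eta>'"
    and g: "depends_only_on (- V) g" "g \<in> borel_measurable borel" "\<And>\<sigma>. 0 \<le> g \<sigma>" "\<And>\<sigma>. g \<sigma> \<le> B"
  shows "measure \<mu> (cylinder V b) * (\<integral>\<eta>. indicator (cylinder V a) \<eta> * g \<eta> \<partial>\<mu>) \<le>
         c\<^sup>2 * measure \<mu> (cylinder V a) * (\<integral>\<eta>. indicator (cylinder V b) \<eta> * g \<eta> \<partial>\<mu>)"
proof -
  have cm: "\<mu> \<in> config_measures" by (rule gibbs_measure_config[OF \<mu>])
  have ip: "integrable \<mu> (\<lambda>\<eta>. gibbs_prob \<Psi> V a \<eta> * g \<eta>)" for a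
  proof (rule bounded_integrable[OF cm, where B="1 * B"])
    show "\<bar>gibbs_prob \<Psi> V a \<eta> * g \<eta>\<bar> \<le> 1 * B" for \<eta>
      unfolding abs_mult using g(3,4) gibbs_prob_le_1[OF V] gibbs_prob_pos[OF V, THEN less_imp_le]
      by (intro mult_mono) auto
  qed (use g gibbs_prob_measurable[OF \<Psi> V] in simp)
  note gv = gibbs_prob_vs_measure[OF \<Psi> \<mu> V cmp]
  have "measure \<mu> (cylinder V b) * (\<integral>\<eta>. gibbs_prob \<Psi> V a \<eta> * g \<eta> \<partial>\<mu>) =
      (\<integral>\<eta>. measure \<mu> (cylinder V b) * (gibbs_prob \<Psi> V a \<eta> * g \<eta>) \<partial>\<mu>)" by simp
  also have "\<dots> \<le> (\<integral>\<eta>. c\<^sup>2 * measure \<mu> (cylinder V a) * (gibbs_prob \<Psi> V b \<eta> * g \<eta>) \<partial>\<mu>)"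
  proof (rule integral_mono)
    fix \<eta>
    have "measure \<mu> (cylinder V b) * gibbs_prob \<Psi> V a \<eta> \<le> (c * gibbs_prob \<Psi> V b \<eta>) * (c * measure \<mu> (cylinder V a))"
      using c gibbs_prob_pos[OF V, THEN less_imp_le]
      by (intro mult_mono gv mult_nonneg_nonneg) auto
    from mult_right_mono[OF this g(3)]
    show "measure \<mu> (cylinder V b) * (gibbs_prob \<Psi> V a \<eta> * g \<eta>) \<le>
        c\<^sup>2 * measure \<mu> (cylinder V a) * (gibbs_prob \<Psi> V b \<eta> * g \<eta>)"
      by (simp add: power2_eq_square mult_ac)
  qed (use ip in auto)
  also have "\<dots> = c\<^sup>2 * measure \<mu> (cylinder V a) * (\<integral>\<eta>. gibbs_prob \<Psi> V b \<eta> * g \<eta> \<partial>\<mu>)" by simp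
  finally show ?thesis
    by (simp only: DLR_integral[OF \<Psi> \<mu> V g(1,2)])
qed

text \<open>
  The function \<open>tilt\<close> has nonpositive conditional mean under the two-time law of \<open>\<mu>\<close>, given
  \<open>\<sigma>\<close> and the spins outside \<open>V\<close>; its mean under the two-time law of \<open>\<nu>\<close> is positive as soon as
  \<open>\<nu>(a) / \<nu>(b)\<close> exceeds \<open>\<mu>(a) / \<mu>(b)\<close> by more than a boundary factor.
\<close>

definition tilt ::
    "('g::ab_group_add set \<Rightarrow> real) \<Rightarrow> 'g config measure \<Rightarrow> 'g set \<Rightarrow> real \<Rightarrow> 'g config \<Rightarrow> 'g config \<Rightarrow>
     'g config \<Rightarrow> 'g config \<Rightarrow> real" where
  "tilt r \<mu> V c a b s \<eta> =
     measure \<mu> (cylinder V b) * pattern_prob r V s b * indicator (cylinder V a) \<eta> -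
     c ^ 3 * measure \<mu> (cylinder V a) * pattern_prob r V s a * indicator (cylinder V b) \<eta>"

lemma tilt_local: "depends_only_on V (tilt r \<mu> V c a b s)"
  by (auto simp: depends_only_on_def tilt_def indicator_def in_cylinder_iff)

lemma tilt_local_pattern: "depends_only_on V (\<lambda>s. tilt r \<mu> V c a b s \<eta>)"
proof -
  have pp: "pattern_prob r V s \<zeta> = pattern_prob r V s' \<zeta>" if "\<forall>x\<in>V. s x = s' x" for s s' \<zeta>
    unfolding pattern_prob_def using that by (intro prod.cong) auto
  have "tilt r \<mu> V c a b s \<eta> = tilt r \<mu> V c a b s' \<eta>" if "\<forall>x\<in>V. s x = s' x" for s s'
    unfolding tilt_def by (simp only: pp[OF that])
  then show ?thesis unfolding depends_only_on_def by blast
qed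

lemma abs_tilt_le:
  assumes r: "pca_coefficients r" and \<mu>: "\<mu> \<in> config_measures" and c: "c \<ge> 1"
  shows "\<bar>tilt r \<mu> V c a b s \<eta>\<bar> \<le> c ^ 3"
proof -
  interpret prob_space \<mu> by (rule config_measuresD[OF \<mu>])
  have one: "0 \<le> measure \<mu> A * pattern_prob r V s \<zeta> * indicator B \<eta>"
    "measure \<mu> A * pattern_prob r V s \<zeta> * indicator B \<eta> \<le> 1" for A B and \<zeta> :: "'a config"
    using pattern_prob_nonneg[OF r, of V s \<zeta>] pattern_prob_le_1[OF r, of V s \<zeta>]
    by (auto simp: indicator_def intro!: mult_le_one)
  have c3: "c ^ 3 \<ge> 1" using c by simp
  have "c ^ 3 * (measure \<mu> (cylinder V a) * pattern_prob r V s a * indicator (cylinder V b) \<eta>) \<le> c ^ 3 * 1"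
    using c by (intro mult_left_mono one) auto
  moreover have "0 \<le> c ^ 3 * (measure \<mu> (cylinder V a) * pattern_prob r V s a * indicator (cylinder V b) \<eta>)"
    using c one(1) by (intro mult_nonneg_nonneg[OF _ one(1)]) auto
  ultimately show ?thesis
    using one(1)[of "cylinder V b" b "cylinder V a"] one(2)[of "cylinder V b" b "cylinder V a"] c3
    unfolding tilt_def mult.assoc by linarith
qed

text \<open>The power c^3 in \<open>tilt\<close> is the exact cost of exchanging a for b: one factor
  for the transition probability (\<open>swap\<close>) and two for the measure
  (\<open>gibbs_swap\<close>). The weight f stands for the factors of the other tiles, and must be
  nonnegative for the inequality to survive multiplication.\<close>

lemma tilt_mean_nonpos:
  fixes \<Psi> :: "'g::{ab_group_add,countable} potential"
  assumes r: "pca_coefficients r"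
    and \<Psi>: "ti_summable_potential \<Psi>" and \<mu>: "gibbs_measure \<Psi> \<mu>" and V: "finite V" and c: "c \<ge> 0"
    and cmp: "\<And>a \<eta> \<eta>'. gibbs_prob \<Psi> V a \<eta> \<le> c * gibbs_prob \<Psi> V a \<eta>'"
    and swap: "\<And>W s \<eta> a b. finite W \<Longrightarrow> V \<subseteq> W \<Longrightarrow>
      pattern_prob r W s (override_on \<eta> a V) * pattern_prob r V s b \<le>
      c * (pattern_prob r W s (override_on \<eta> b V) * pattern_prob r V s a)"
    and W: "finite W" "V \<subseteq> W"
    and f: "depends_only_on (- V) f" "f \<in> borel_measurable borel" "\<And>\<sigma>. 0 \<le> f \<sigma>" "\<And>\<sigma>. f \<sigma> \<le> B"
  shows "(\<integral>\<eta>. pattern_prob r W s \<eta> * (f \<eta> * tilt r \<mu> V c a b s \<eta>) \<partial>\<mu>) \<le> 0"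
proof -
  have cm: "\<mu> \<in> config_measures" by (rule gibbs_measure_config[OF \<mu>])
  note nn = pattern_prob_nonneg[OF r]
  have B: "B \<ge> 0" using order_trans[OF f(3) f(4)] .
  let ?E = "\<lambda>a. \<integral>\<eta>. indicator (cylinder V a) \<eta> * (f \<eta> * pattern_prob r W s \<eta>) \<partial>\<mu>"
  have iE: "integrable \<mu> (\<lambda>\<eta>. indicator (cylinder V a) \<eta> * (f \<eta> * pattern_prob r W s \<eta>))" for a
  proof (rule bounded_integrable[OF cm, where B="1 * (B * 1)"])
    show "(\<lambda>\<eta>. indicator (cylinder V a) \<eta> * (f \<eta> * pattern_prob r W s \<eta>)) \<in> borel_measurable borel"
      using V by (intro borel_measurable_times borel_measurable_indicator f(2) pattern_prob_measurable[OF r]) simp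
    show "\<bar>indicator (cylinder V a) \<eta> * (f \<eta> * pattern_prob r W s \<eta>)\<bar> \<le> 1 * (B * 1)" for \<eta>
      unfolding abs_mult using f(3,4) nn pattern_prob_le_1[OF r] B
      by (intro mult_mono mult_nonneg_nonneg) (auto simp: indicator_def)
  qed
  \<comment> \<open>Imposing b on V turns the transition probability into a function of the outside
    spins, as \<open>gibbs_swap\<close> requires; on \<open>cylinder V b\<close> nothing
    changes.\<close>
  define g where "g \<eta> = f \<eta> * pattern_prob r W s (override_on \<eta> b V)" for \<eta>
  have g: "depends_only_on (- V) g" "g \<in> borel_measurable borel" "\<And>\<sigma>. 0 \<le> g \<sigma>" "\<And>\<sigma>. g \<sigma> \<le> B * 1"
  proof -
    show "depends_only_on (- V) g"
      unfolding depends_only_on_def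
    proof (intro allI impI)
      fix \<sigma> \<sigma>' :: "'g config" assume eq: "\<forall>x\<in>- V. \<sigma> x = \<sigma>' x"
      have "override_on \<sigma> b V = override_on \<sigma>' b V" using eq by (auto simp: override_on_def)
      moreover have "f \<sigma> = f \<sigma>'" by (rule depends_only_onD[OF f(1)]) (use eq in auto)
      ultimately show "g \<sigma> = g \<sigma>'" by (simp add: g_def)
    qed
    show "g \<in> borel_measurable borel"
      unfolding g_def[abs_def]
      by (intro borel_measurable_times f(2) measurable_compose[OF override_measurable pattern_prob_measurable[OF r]])
    show "0 \<le> g \<sigma>" for \<sigma> unfolding g_def by (intro mult_nonneg_nonneg f(3) nn)
    show "g \<sigma> \<le> B * 1" for \<sigma> unfolding g_def using B by (intro mult_mono f(4) pattern_prob_le_1[OF r] nn) auto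
  qed
  have onV: "override_on \<eta> a V = \<eta>" if "\<eta> \<in> cylinder V a" for \<eta> a
    using that by (auto simp: override_on_def in_cylinder_iff fun_eq_iff)
  have ig: "integrable \<mu> (\<lambda>\<eta>. indicator (cylinder V a) \<eta> * g \<eta>)"
    by (rule bounded_integrable[OF cm, where B=B]) (use g V B in \<open>auto simp: indicator_def\<close>)
  have "measure \<mu> (cylinder V b) * pattern_prob r V s b * ?E a =
      measure \<mu> (cylinder V b) * (\<integral>\<eta>. pattern_prob r V s b * (indicator (cylinder V a) \<eta> * (f \<eta> * pattern_prob r W s \<eta>)) \<partial>\<mu>)"
    by simp
  also have "\<dots> \<le> measure \<mu> (cylinder V b) * (\<integral>\<eta>. c * pattern_prob r V s a * (indicator (cylinder V a) \<eta> * g \<eta>) \<partial>\<mu>)"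
  proof (intro mult_left_mono integral_mono)
    show "integrable \<mu> (\<lambda>\<eta>. c * pattern_prob r V s a * (indicator (cylinder V a) \<eta> * g \<eta>))"
      using ig by simp
    show "pattern_prob r V s b * (indicator (cylinder V a) \<eta> * (f \<eta> * pattern_prob r W s \<eta>))
        \<le> c * pattern_prob r V s a * (indicator (cylinder V a) \<eta> * g \<eta>)" for \<eta>
    proof (cases "\<eta> \<in> cylinder V a")
      case True
      from mult_left_mono[OF swap[OF W, of s \<eta> a b] f(3)[of \<eta>]] True
      show ?thesis by (simp add: onV[OF True] g_def mult_ac)
    qed simp
  qed (use iE in auto)
  also have "\<dots> = c * pattern_prob r V s a * (measure \<mu> (cylinder V b) * (\<integral>\<eta>. indicator (cylinder V a) \<eta> * g \<eta> \<partial>\<mu>))"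
    by simp
  also have "\<dots> \<le> c * pattern_prob r V s a *
      (c\<^sup>2 * measure \<mu> (cylinder V a) * (\<integral>\<eta>. indicator (cylinder V b) \<eta> * g \<eta> \<partial>\<mu>))"
    by (intro mult_left_mono gibbs_swap[OF \<Psi> \<mu> V c cmp g] mult_nonneg_nonneg c nn)
  also have "(\<integral>\<eta>. indicator (cylinder V b) \<eta> * g \<eta> \<partial>\<mu>) = ?E b"
    by (intro Bochner_Integration.integral_cong refl) (auto simp: g_def onV indicator_def)
  also have "c * pattern_prob r V s a * (c\<^sup>2 * measure \<mu> (cylinder V a) * ?E b) =
      c ^ 3 * measure \<mu> (cylinder V a) * pattern_prob r V s a * ?E b"
    by (simp add: power3_eq_cube power2_eq_square)
  finally have le: "measure \<mu> (cylinder V b) * pattern_prob r V s b * ?E a \<le>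
      c ^ 3 * measure \<mu> (cylinder V a) * pattern_prob r V s a * ?E b" .
  have "(\<integral>\<eta>. pattern_prob r W s \<eta> * (f \<eta> * tilt r \<mu> V c a b s \<eta>) \<partial>\<mu>) =
      (\<integral>\<eta>. measure \<mu> (cylinder V b) * pattern_prob r V s b * (indicator (cylinder V a) \<eta> * (f \<eta> * pattern_prob r W s \<eta>)) -
        c ^ 3 * measure \<mu> (cylinder V a) * pattern_prob r V s a * (indicator (cylinder V b) \<eta> * (f \<eta> * pattern_prob r W s \<eta>)) \<partial>\<mu>)"
    by (intro Bochner_Integration.integral_cong refl) (simp add: tilt_def algebra_simps)
  also have "\<dots> = measure \<mu> (cylinder V b) * pattern_prob r V s b * ?E a -
      c ^ 3 * measure \<mu> (cylinder V a) * pattern_prob r V s a * ?E b"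
    by (subst Bochner_Integration.integral_diff) (use iE in auto)
  finally show ?thesis using le by simp
qed

text \<open>One tile is removed at a time, after recentering it at V. The smallness of l keeps each
  factor between 1/2 and 3/2, so the product over the other tiles is an admissible nonnegative
  weight and the linear term l times \<open>tilt\<close> can only lower the integral.\<close>

lemma tilted_tiles:
  fixes \<Psi> :: "'g::{ab_group_add,countable} potential"
  assumes r: "pca_coefficients r"
    and \<Psi>: "ti_summable_potential \<Psi>" and \<mu>: "gibbs_measure \<Psi> \<mu>" "translation_invariant \<mu>"
    and V: "finite V" and c: "c \<ge> 1"
    and cmp: "\<And>a \<eta> \<eta>'. gibbs_prob \<Psi> V a \<eta> \<le> c * gibbs_prob \<Psi> V a \<eta>'"
    and swap: "\<And>W s \<eta> a b. finite W \<Longrightarrow> V \<subseteq> W \<Longrightarrow>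
      pattern_prob r W s (override_on \<eta> a V) * pattern_prob r V s b \<le>
      c * (pattern_prob r W s (override_on \<eta> b V) * pattern_prob r V s a)"
    and l: "l \<ge> 0" "l * c ^ 3 \<le> 1 / 2"
    and W: "finite W" and I: "finite I" "disjoint_tiles V I" "\<And>z. z \<in> I \<Longrightarrow> translate z V \<subseteq> W"
  shows "(\<integral>\<eta>. pattern_prob r W s \<eta> * (\<Prod>z\<in>I. 1 + l * tilt r \<mu> V c a b (shift z s) (shift z \<eta>)) \<partial>\<mu>)
     \<le> (\<integral>\<eta>. pattern_prob r W s \<eta> \<partial>\<mu>)"
  using I
proof (induction I rule: finite_induct)
  case (insert z I)
  have cm: "\<mu> \<in> config_measures" by (rule gibbs_measure_config[OF \<mu>(1)])
  let ?t = "\<lambda>s. tilt r \<mu> V c a b s"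
  let ?h = "\<lambda>z \<eta>. 1 + l * ?t (shift z s) (shift z \<eta>)"
  let ?f = "\<lambda>\<eta>. \<Prod>z\<in>I. ?h z \<eta>"
  have lt: "\<bar>l * ?t s' \<eta>\<bar> \<le> 1 / 2" for s' \<eta>
  proof -
    have "\<bar>l * ?t s' \<eta>\<bar> \<le> l * c ^ 3"
      unfolding abs_mult using l(1) by (intro mult_mono abs_tilt_le[OF r cm c]) auto
    then show ?thesis using l(2) by linarith
  qed
  have h: "0 \<le> ?h z \<eta>" "?h z \<eta> \<le> 2" for z \<eta>
    using lt[of "shift z s" "shift z \<eta>"] by (auto simp: abs_le_iff)
  have tm: "?t s' \<in> borel_measurable borel" for s' by (rule local_measurable[OF V tilt_local])
  have fm: "?f \<in> borel_measurable borel"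
    by (intro borel_measurable_prod borel_measurable_add borel_measurable_times borel_measurable_const
        measurable_compose[OF shift_measurable tm])
  have f0: "0 \<le> ?f \<eta>" and f2: "?f \<eta> \<le> 2 ^ card I" for \<eta>
    unfolding prod_constant[symmetric] by (intro prod_nonneg prod_mono; use h in auto)+
  have pm: "pattern_prob r W' s' \<in> borel_measurable borel" for W' s' by (rule pattern_prob_measurable[OF r])
  have i1: "integrable \<mu> (\<lambda>\<eta>. pattern_prob r W s \<eta> * ?f \<eta>)"
  proof (rule bounded_integrable[OF cm, where B="1 * 2 ^ card I"])
    show "\<bar>pattern_prob r W s \<eta> * ?f \<eta>\<bar> \<le> 1 * 2 ^ card I" for \<eta>
      unfolding abs_mult using f0 f2 pattern_prob_nonneg[OF r] pattern_prob_le_1[OF r] by (intro mult_mono) auto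
  qed (intro borel_measurable_times pm fm)
  have i2: "integrable \<mu> (\<lambda>\<eta>. pattern_prob r W s \<eta> * (?f \<eta> * ?t (shift z s) (shift z \<eta>)))"
  proof (rule bounded_integrable[OF cm, where B="1 * (2 ^ card I * c ^ 3)"])
    show "\<bar>pattern_prob r W s \<eta> * (?f \<eta> * ?t (shift z s) (shift z \<eta>))\<bar> \<le> 1 * (2 ^ card I * c ^ 3)" for \<eta>
      unfolding abs_mult
    proof (intro mult_mono)
      show "\<bar>?f \<eta>\<bar> \<le> 2 ^ card I" using f0[of \<eta>] f2[of \<eta>] by simp
      show "\<bar>?t (shift z s) (shift z \<eta>)\<bar> \<le> c ^ 3" by (rule abs_tilt_le[OF r cm c])
    qed (use pattern_prob_nonneg[OF r] pattern_prob_le_1[OF r] in auto)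
  qed (intro borel_measurable_times pm fm measurable_compose[OF shift_measurable tm])
  let ?W = "translate (- z) W"
  have tW: "translate z ?W = W" by (simp add: translate_translate)
  have "translate z V \<subseteq> W" by (rule insert.prems(2)) simp
  then have "x + z \<in> W" if "x \<in> V" for x using that by (auto simp: translate_def)
  then have VW: "V \<subseteq> ?W" by (auto simp: translate_iff)
  have "(\<integral>\<eta>. pattern_prob r W s \<eta> * (?f \<eta> * ?t (shift z s) (shift z \<eta>)) \<partial>\<mu>) =
      (\<integral>\<eta>. pattern_prob r ?W (shift z s) (shift z \<eta>) * (?f (shift (- z) (shift z \<eta>)) * ?t (shift z s) (shift z \<eta>)) \<partial>\<mu>)"
    using pattern_prob_translate[of r z ?W s] by (simp add: tW)
  also have "\<dots> = (\<integral>\<eta>. pattern_prob r ?W (shift z s) \<eta> * (?f (shift (- z) \<eta>) * ?t (shift z s) \<eta>) \<partial>\<mu>)"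
    by (rule integral_shift[OF cm \<mu>(2),
          of "\<lambda>\<eta>. pattern_prob r ?W (shift z s) \<eta> * (?f (shift (- z) \<eta>) * ?t (shift z s) \<eta>)"])
       (intro borel_measurable_times pm tm measurable_compose[OF shift_measurable fm])
  also have "\<dots> \<le> 0"
  proof (rule tilt_mean_nonpos[OF r \<Psi> \<mu>(1) V _ cmp swap _ VW, where B="2 ^ card I"])
    show "depends_only_on (- V) (\<lambda>\<eta>. ?f (shift (- z) \<eta>))"
    proof (rule shift_off_tile[OF insert.hyps(2) insert.prems(1), of ?h])
      fix z'
      have "depends_only_on V (\<lambda>\<sigma>. 1 + l * ?t (shift z' s) \<sigma>)"
        using tilt_local[of V r \<mu> c a b "shift z' s"] unfolding depends_only_on_def by metis
      from depends_only_on_shift[OF this] show "depends_only_on (translate z' V) (?h z')" .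
    qed
    show "(\<lambda>\<eta>. ?f (shift (- z) \<eta>)) \<in> borel_measurable borel"
      by (rule measurable_compose[OF shift_measurable fm])
  qed (use c f0 f2 W in auto)
  finally have neg: "(\<integral>\<eta>. pattern_prob r W s \<eta> * (?f \<eta> * ?t (shift z s) (shift z \<eta>)) \<partial>\<mu>) \<le> 0" .
  have "(\<integral>\<eta>. pattern_prob r W s \<eta> * (\<Prod>z\<in>insert z I. ?h z \<eta>) \<partial>\<mu>) =
      (\<integral>\<eta>. pattern_prob r W s \<eta> * ?f \<eta> + l * (pattern_prob r W s \<eta> * (?f \<eta> * ?t (shift z s) (shift z \<eta>))) \<partial>\<mu>)"
    using insert.hyps by (intro Bochner_Integration.integral_cong refl) (simp add: algebra_simps)
  also have "\<dots> = (\<integral>\<eta>. pattern_prob r W s \<eta> * ?f \<eta> \<partial>\<mu>) +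
      l * (\<integral>\<eta>. pattern_prob r W s \<eta> * (?f \<eta> * ?t (shift z s) (shift z \<eta>)) \<partial>\<mu>)"
    using i1 i2 by simp
  also have "\<dots> \<le> (\<integral>\<eta>. pattern_prob r W s \<eta> * ?f \<eta> \<partial>\<mu>)"
    using neg l(1) by (simp add: mult_nonneg_nonpos)
  also have "\<dots> \<le> (\<integral>\<eta>. pattern_prob r W s \<eta> \<partial>\<mu>)"
    by (rule insert.IH) (use insert.prems in \<open>auto simp: disjoint_tiles_def\<close>)
  finally show ?case .
qed simp

lemma depends_only_on_compose:
  "depends_only_on A f \<Longrightarrow> depends_only_on A (\<lambda>\<sigma>. h (f \<sigma>))"
  unfolding depends_only_on_def by metis

lemma pattern_sum_translate:
  fixes r :: "('g::ab_group_add) set \<Rightarrow> real" and f :: "'g config \<Rightarrow> real"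
  shows "(\<Sum>s\<in>translate z V \<rightarrow>\<^sub>E UNIV. pattern_prob r (translate z V) s \<eta> * f (shift z s)) =
         (\<Sum>s\<in>V \<rightarrow>\<^sub>E UNIV. pattern_prob r V s (shift z \<eta>) * f s)"
proof -
  have bij: "bij_betw (shift z) (translate z V \<rightarrow>\<^sub>E (UNIV :: bool set)) (V \<rightarrow>\<^sub>E UNIV)"
    by (rule bij_betwI[of _ _ _ "shift (- z)"])
       (auto simp: PiE_iff extensional_def shift_def translate_iff)
  show ?thesis
    unfolding pattern_prob_translate
    by (rule sum.reindex_bij_betw[OF bij, of "\<lambda>s. pattern_prob r V s (shift z \<eta>) * f s"])
qed

text \<open>Data processing for one step, with a surplus from the tiles. The two-time function X(s,
  \<eta>) is the density of \<nu>P relative to \<mu> on W at s times the tilted factors. Averaging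
  over s with the kernel gives U with \<mu>-mean at most 1. Under \<nu>, the expected log of X is
  the entropy of \<nu>P plus the surplus; by Jensen it is at most the mean of ln U, and by the
  variational principle this is at most the entropy of \<nu> on \<Lambda>. The term 2e pays for
  making U local.\<close>

lemma entropy_production_bound:
  fixes \<Psi> :: "'g::{ab_group_add,countable} potential"
  assumes r: "pca_coefficients r" and \<kappa>: "\<kappa> > 0" "\<And>x b \<eta>. \<kappa> \<le> site_prob r x b \<eta>"
    and \<Psi>: "ti_summable_potential \<Psi>" and \<mu>: "gibbs_measure \<Psi> \<mu>" "translation_invariant \<mu>"
    and stat: "pca_step r \<mu> = \<mu>"
    and \<nu>: "\<nu> \<in> config_measures" "translation_invariant \<nu>"
    and V: "finite V" and c: "c \<ge> 1"
    and cmp: "\<And>a \<eta> \<eta>'. gibbs_prob \<Psi> V a \<eta> \<le> c * gibbs_prob \<Psi> V a \<eta>'"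
    and swap: "\<And>W s \<eta> a b. finite W \<Longrightarrow> V \<subseteq> W \<Longrightarrow>
      pattern_prob r W s (override_on \<eta> a V) * pattern_prob r V s b \<le>
      c * (pattern_prob r W s (override_on \<eta> b V) * pattern_prob r V s a)"
    and l: "l \<ge> 0" "l * c ^ 3 \<le> 1 / 2"
    and W: "finite W" and \<Lambda>: "finite \<Lambda>" "W \<subseteq> \<Lambda>"
    and I: "finite I" "disjoint_tiles V I" "\<And>z. z \<in> I \<Longrightarrow> translate z V \<subseteq> W"
    and e: "\<And>s \<zeta> \<zeta>'. \<forall>x\<in>\<Lambda>. \<zeta> x = \<zeta>' x \<Longrightarrow> pattern_prob r W s \<zeta> \<le> exp e * pattern_prob r W s \<zeta>'"
  shows "pattern_entropy W (pca_step r \<nu>) \<mu> +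
      real (card I) * (\<integral>\<eta>. (\<Sum>s\<in>V \<rightarrow>\<^sub>E UNIV. pattern_prob r V s \<eta> * ln (1 + l * tilt r \<mu> V c a b s \<eta>)) \<partial>\<nu>)
      \<le> pattern_entropy \<Lambda> \<nu> \<mu> + 2 * e"
proof -
  have cm: "\<mu> \<in> config_measures" by (rule gibbs_measure_config[OF \<mu>(1)])
  interpret \<nu>: prob_space \<nu> by (rule config_measuresD[OF \<nu>(1)])
  let ?S = "W \<rightarrow>\<^sub>E (UNIV :: bool set)"
  let ?p = "\<lambda>s \<eta>. pattern_prob r W s \<eta>"
  let ?t = "\<lambda>s \<eta>. tilt r \<mu> V c a b s \<eta>"
  note pnn = pattern_prob_nonneg[OF r]
  have pm: "pattern_prob r W' s' \<in> borel_measurable borel" for W' s' by (rule pattern_prob_measurable[OF r])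
  have lt: "\<bar>l * ?t s' \<eta>\<bar> \<le> 1 / 2" for s' \<eta>
  proof -
    have "\<bar>l * ?t s' \<eta>\<bar> \<le> l * c ^ 3"
      unfolding abs_mult using l(1) by (intro mult_mono abs_tilt_le[OF r cm c]) auto
    then show ?thesis using l(2) by linarith
  qed
  have tpos: "1 + l * ?t s' \<eta> > 0" for s' \<eta> using lt[of s' \<eta>] by (auto simp: abs_le_iff)
  \<comment> \<open>By stationarity the denominator is also the law of the new pattern when the
    chain starts from \<mu>, so w is a density with respect to the second marginal of the two-time
    law.\<close>
  define w where "w s = measure (pca_step r \<nu>) (cylinder W s) / measure \<mu> (cylinder W s)" for s
  have mpos: "measure \<mu> (cylinder A s) > 0" if "finite A" for A s by (rule gibbs_cylinder_pos[OF \<Psi> \<mu>(1) that])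
  have nP: "measure (pca_step r \<nu>) (cylinder W s) = (\<integral>\<eta>. ?p s \<eta> \<partial>\<nu>)" for s
    by (rule measure_pca_step_cylinder[OF r \<nu>(1) W])
  have mP: "measure \<mu> (cylinder W s) = (\<integral>\<eta>. ?p s \<eta> \<partial>\<mu>)" for s
    using measure_pca_step_cylinder[OF r cm W, of s] by (simp add: stat)
  have wpos: "w s > 0" for s
  proof -
    have "(\<integral>\<eta>. \<kappa> ^ card W \<partial>\<nu>) \<le> (\<integral>\<eta>. ?p s \<eta> \<partial>\<nu>)"
      using \<kappa> by (intro integral_mono pattern_prob_integrable[OF r \<nu>(1)] pattern_prob_lower) auto
    then have "measure (pca_step r \<nu>) (cylinder W s) > 0"
      using zero_less_power[OF \<kappa>(1), of "card W"] \<nu>.prob_space unfolding nP by simp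
    then show ?thesis unfolding w_def using mpos[OF W] by simp
  qed
  define X where "X s \<eta> = w s * (\<Prod>z\<in>I. 1 + l * ?t (shift z s) (shift z \<eta>))" for s \<eta>
  have Xpos: "X s \<eta> > 0" for s \<eta> unfolding X_def by (intro mult_pos_pos wpos prod_pos) (use tpos in auto)
  have Xdep: "depends_only_on W (X s)" for s
  proof -
    have "depends_only_on W (\<lambda>\<eta>. \<Prod>z\<in>I. 1 + l * ?t (shift z s) (shift z \<eta>))"
    proof (rule depends_only_on_prod)
      fix z assume "z \<in> I"
      have "depends_only_on V (\<lambda>\<sigma>. 1 + l * ?t (shift z s) \<sigma>)"
        by (rule depends_only_on_compose[OF tilt_local, where h="\<lambda>x. 1 + l * x"])
      from depends_only_on_mono[OF depends_only_on_shift[OF this] I(3)[OF \<open>z \<in> I\<close>]]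
      show "depends_only_on W (\<lambda>\<eta>. 1 + l * ?t (shift z s) (shift z \<eta>))" .
    qed
    from depends_only_on_compose[OF this, where h="\<lambda>x. w s * x"] show ?thesis unfolding X_def[abs_def] .
  qed
  define U where "U \<eta> = (\<Sum>s\<in>?S. ?p s \<eta> * X s \<eta>)" for \<eta>
  \<comment> \<open>U depends on all spins through the kernel. Freezing those outside \<Lambda>
    makes it local at the price of a factor exp(e), paid once under \<nu> and once under \<mu>; X
    itself is unchanged since W lies in \<Lambda>.\<close>
  define T where "T \<eta> = override_on (\<lambda>_. True) \<eta> \<Lambda>" for \<eta> :: "'g config"
  have TX: "X s (T \<eta>) = X s \<eta>" for s \<eta>
    by (rule depends_only_onD[OF Xdep]) (use \<Lambda>(2) in \<open>auto simp: T_def override_on_def\<close>)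
  have Upos: "U \<eta> > 0" for \<eta>
    unfolding U_def by (rule sum_pos) (use W in \<open>auto intro!: mult_pos_pos Xpos pattern_prob_pos[OF \<kappa>]\<close>)
  have UT: "U \<eta> \<le> exp e * U (T \<eta>)" and TU: "U (T \<eta>) \<le> exp e * U \<eta>" for \<eta>
  proof -
    have agree: "\<forall>x\<in>\<Lambda>. \<eta> x = T \<eta> x" "\<forall>x\<in>\<Lambda>. T \<eta> x = \<eta> x" by (simp_all add: T_def override_on_def)
    have "U \<eta> \<le> (\<Sum>s\<in>?S. (exp e * ?p s (T \<eta>)) * X s \<eta>)"
      unfolding U_def by (intro sum_mono mult_right_mono e agree(1) less_imp_le[OF Xpos])
    also have "\<dots> = exp e * U (T \<eta>)" by (simp add: U_def TX sum_distrib_left mult.assoc)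
    finally show "U \<eta> \<le> exp e * U (T \<eta>)" .
    have "U (T \<eta>) \<le> (\<Sum>s\<in>?S. (exp e * ?p s \<eta>) * X s (T \<eta>))"
      unfolding U_def by (intro sum_mono mult_right_mono e agree(2) less_imp_le[OF Xpos])
    also have "\<dots> = exp e * U \<eta>" by (simp add: U_def TX sum_distrib_left mult.assoc)
    finally show "U (T \<eta>) \<le> exp e * U \<eta>" .
  qed
  have depUT: "depends_only_on \<Lambda> (\<lambda>\<eta>. ln (U (T \<eta>)))"
  proof -
    have "T \<eta> = T \<eta>'" if "\<forall>x\<in>\<Lambda>. \<eta> x = \<eta>' x" for \<eta> \<eta>'
      using that by (auto simp: T_def override_on_def)
    then have "depends_only_on \<Lambda> T" unfolding depends_only_on_def by blast
    from depends_only_on_compose[OF this, where h="\<lambda>\<eta>. ln (U \<eta>)"] show ?thesis .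
  qed
  have pX: "integrable \<mu> (\<lambda>\<eta>. ?p s \<eta> * (\<Prod>z\<in>I. 1 + l * ?t (shift z s) (shift z \<eta>)))" for s
  proof (rule bounded_integrable[OF cm, where B="1 * 2 ^ card I"])
    have tm: "?t s' \<in> borel_measurable borel" for s' by (rule local_measurable[OF V tilt_local])
    show "(\<lambda>\<eta>. ?p s \<eta> * (\<Prod>z\<in>I. 1 + l * ?t (shift z s) (shift z \<eta>))) \<in> borel_measurable borel"
      by (intro borel_measurable_times pm borel_measurable_prod borel_measurable_add borel_measurable_const
          measurable_compose[OF shift_measurable tm])
    fix \<eta>
    have "0 \<le> (\<Prod>z\<in>I. 1 + l * ?t (shift z s) (shift z \<eta>))"
      by (intro prod_nonneg less_imp_le tpos)
    moreover have "(\<Prod>z\<in>I. 1 + l * ?t (shift z s) (shift z \<eta>)) \<le> (\<Prod>z\<in>I. 2)"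
    proof (rule prod_mono)
      fix z
      show "0 \<le> 1 + l * ?t (shift z s) (shift z \<eta>) \<and> 1 + l * ?t (shift z s) (shift z \<eta>) \<le> 2"
        using lt[of "shift z s" "shift z \<eta>"] by (auto simp: abs_le_iff)
    qed
    ultimately show "\<bar>?p s \<eta> * (\<Prod>z\<in>I. 1 + l * ?t (shift z s) (shift z \<eta>))\<bar> \<le> 1 * 2 ^ card I"
      unfolding abs_mult using pnn pattern_prob_le_1[OF r] by (intro mult_mono) auto
  qed
  \<comment> \<open>The tilted factors drop out by \<open>tilted_tiles\<close>, and what remains is
    the total mass of \<nu>P on the patterns of W.\<close>
  have EU: "(\<integral>\<eta>. U \<eta> \<partial>\<mu>) \<le> 1" and iU: "integrable \<mu> U"
  proof -
    have Ueq: "U = (\<lambda>\<eta>. \<Sum>s\<in>?S. w s * (?p s \<eta> * (\<Prod>z\<in>I. 1 + l * ?t (shift z s) (shift z \<eta>))))"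
      by (simp add: U_def X_def fun_eq_iff mult_ac)
    show "integrable \<mu> U" unfolding Ueq
      by (intro Bochner_Integration.integrable_sum integrable_mult_right pX)
    have "(\<integral>\<eta>. U \<eta> \<partial>\<mu>) = (\<Sum>s\<in>?S. w s * (\<integral>\<eta>. ?p s \<eta> * (\<Prod>z\<in>I. 1 + l * ?t (shift z s) (shift z \<eta>)) \<partial>\<mu>))"
      unfolding Ueq by (subst Bochner_Integration.integral_sum) (use pX in auto)
    also have "\<dots> \<le> (\<Sum>s\<in>?S. w s * (\<integral>\<eta>. ?p s \<eta> \<partial>\<mu>))"
      by (intro sum_mono mult_left_mono tilted_tiles[OF r \<Psi> \<mu> V c cmp swap l W I] less_imp_le[OF wpos])
    also have "\<dots> = (\<Sum>s\<in>?S. measure (pca_step r \<nu>) (cylinder W s))"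
      unfolding mP[symmetric] w_def using mpos[OF W] by (intro sum.cong refl) (simp add: less_imp_neq[symmetric])
    also have "\<dots> = 1" by (rule sum_cylinder_measure[OF pca_step_config[OF r \<nu>(1)] W])
    finally show "(\<integral>\<eta>. U \<eta> \<partial>\<mu>) \<le> 1" .
  qed
  let ?G = "\<lambda>\<eta>. \<Sum>s\<in>V \<rightarrow>\<^sub>E UNIV. pattern_prob r V s \<eta> * ln (1 + l * ?t s \<eta>)"
  have lnt: "\<bar>ln (1 + l * ?t s' \<eta>)\<bar> \<le> 2" for s' \<eta>
    using lt[of s' \<eta>] abs_ln_one_plus_x_minus_x_bound[OF lt[of s' \<eta>]]
      power_mono[OF lt[of s' \<eta>], of 2] by (simp add: power2_eq_square)
  have lntm: "(\<lambda>\<eta>. ln (1 + l * ?t s' \<eta>)) \<in> borel_measurable borel" for s'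
    by (rule local_measurable[OF V depends_only_on_compose[OF tilt_local, where h="\<lambda>x. ln (1 + l * x)"]])
  have iG1: "integrable \<nu> (\<lambda>\<eta>. pattern_prob r V' s \<eta> * ln (1 + l * ?t s' (shift z \<eta>)))" for V' s s' z
  proof (rule bounded_integrable[OF \<nu>(1), where B="1 * 2"])
    show "\<bar>pattern_prob r V' s \<eta> * ln (1 + l * ?t s' (shift z \<eta>))\<bar> \<le> 1 * 2" for \<eta>
      unfolding abs_mult using pnn pattern_prob_le_1[OF r] lnt by (intro mult_mono) auto
  qed (intro borel_measurable_times pm measurable_compose[OF shift_measurable lntm])
  have Gm: "?G \<in> borel_measurable borel"
    by (intro borel_measurable_sum borel_measurable_times pm lntm)
  have tile: "(\<Sum>s\<in>?S. ?p s \<eta> * ln (1 + l * ?t (shift z s) (shift z \<eta>))) = ?G (shift z \<eta>)" if z: "z \<in> I" for z \<eta>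
  proof -
    have "depends_only_on V (\<lambda>s. ln (1 + l * ?t s (shift z \<eta>)))"
      by (rule depends_only_on_compose[OF tilt_local_pattern, where h="\<lambda>x. ln (1 + l * x)"])
    from pattern_prob_marginal[OF r W I(3)[OF z] depends_only_on_shift[OF this], of \<eta>]
    have "(\<Sum>s\<in>?S. ?p s \<eta> * ln (1 + l * ?t (shift z s) (shift z \<eta>))) =
        (\<Sum>s\<in>translate z V \<rightarrow>\<^sub>E UNIV. pattern_prob r (translate z V) s \<eta> * ln (1 + l * ?t (shift z s) (shift z \<eta>)))" .
    also have "\<dots> = ?G (shift z \<eta>)"
      by (rule pattern_sum_translate[where f="\<lambda>s. ln (1 + l * ?t s (shift z \<eta>))"])
    finally show ?thesis .
  qed
  have lnX: "(\<Sum>s\<in>?S. ?p s \<eta> * ln (X s \<eta>)) = (\<Sum>s\<in>?S. ?p s \<eta> * ln (w s)) + (\<Sum>z\<in>I. ?G (shift z \<eta>))" for \<eta>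
  proof -
    have "ln (X s \<eta>) = ln (w s) + (\<Sum>z\<in>I. ln (1 + l * ?t (shift z s) (shift z \<eta>)))" for s
    proof -
      have "ln (X s \<eta>) = ln (w s) + ln (\<Prod>z\<in>I. 1 + l * ?t (shift z s) (shift z \<eta>))"
        unfolding X_def by (rule ln_mult_pos[OF wpos]) (rule prod_pos, rule tpos)
      also have "ln (\<Prod>z\<in>I. 1 + l * ?t (shift z s) (shift z \<eta>)) = (\<Sum>z\<in>I. ln (1 + l * ?t (shift z s) (shift z \<eta>)))"
        by (rule ln_prod) (use I(1) less_imp_neq[OF tpos] tpos in auto)
      finally show ?thesis .
    qed
    then have "(\<Sum>s\<in>?S. ?p s \<eta> * ln (X s \<eta>)) = (\<Sum>s\<in>?S. ?p s \<eta> * ln (w s)) +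
        (\<Sum>s\<in>?S. \<Sum>z\<in>I. ?p s \<eta> * ln (1 + l * ?t (shift z s) (shift z \<eta>)))"
      by (simp add: distrib_left sum.distrib sum_distrib_left)
    also have "(\<Sum>s\<in>?S. \<Sum>z\<in>I. ?p s \<eta> * ln (1 + l * ?t (shift z s) (shift z \<eta>))) = (\<Sum>z\<in>I. ?G (shift z \<eta>))"
      by (subst sum.swap) (simp add: tile)
    finally show ?thesis .
  qed
  have iw: "integrable \<nu> (\<lambda>\<eta>. ?p s \<eta> * ln (w s))" for s
    using pattern_prob_integrable[OF r \<nu>(1), of W s] by simp
  have iG: "integrable \<nu> (\<lambda>\<eta>. ?G (shift z \<eta>))" for z
  proof (rule bounded_integrable[OF \<nu>(1) measurable_compose[OF shift_measurable Gm], where B="\<Sum>s\<in>V \<rightarrow>\<^sub>E (UNIV :: bool set). 1 * 2"])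
    fix \<eta>
    show "\<bar>?G (shift z \<eta>)\<bar> \<le> (\<Sum>s\<in>V \<rightarrow>\<^sub>E (UNIV :: bool set). 1 * 2)"
      by (rule order_trans[OF sum_abs sum_mono], unfold abs_mult)
         (use pnn pattern_prob_le_1[OF r] lnt in \<open>intro mult_mono, auto\<close>)
  qed
  have "pattern_entropy W (pca_step r \<nu>) \<mu> + real (card I) * (\<integral>\<eta>. ?G \<eta> \<partial>\<nu>) =
      (\<integral>\<eta>. (\<Sum>s\<in>?S. ?p s \<eta> * ln (w s)) + (\<Sum>z\<in>I. ?G (shift z \<eta>)) \<partial>\<nu>)"
  proof -
    have "(\<integral>\<eta>. (\<Sum>s\<in>?S. ?p s \<eta> * ln (w s)) \<partial>\<nu>) = pattern_entropy W (pca_step r \<nu>) \<mu>"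
      by (subst Bochner_Integration.integral_sum) (use iw in \<open>auto simp: pattern_entropy_def nP w_def\<close>)
    moreover have "(\<integral>\<eta>. (\<Sum>z\<in>I. ?G (shift z \<eta>)) \<partial>\<nu>) = real (card I) * (\<integral>\<eta>. ?G \<eta> \<partial>\<nu>)"
      by (subst Bochner_Integration.integral_sum[OF iG]) (simp add: integral_shift[OF \<nu> Gm])
    moreover have "integrable \<nu> (\<lambda>\<eta>. \<Sum>s\<in>?S. ?p s \<eta> * ln (w s))" "integrable \<nu> (\<lambda>\<eta>. \<Sum>z\<in>I. ?G (shift z \<eta>))"
      by (intro Bochner_Integration.integrable_sum iw iG)+
    ultimately show ?thesis by simp
  qed
  also have "\<dots> \<le> (\<integral>\<eta>. e + ln (U (T \<eta>)) \<partial>\<nu>)"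
  proof (rule integral_mono)
    show "integrable \<nu> (\<lambda>\<eta>. (\<Sum>s\<in>?S. ?p s \<eta> * ln (w s)) + (\<Sum>z\<in>I. ?G (shift z \<eta>)))"
      by (intro Bochner_Integration.integrable_add Bochner_Integration.integrable_sum iw iG)
    show "integrable \<nu> (\<lambda>\<eta>. e + ln (U (T \<eta>)))"
      using local_integrable[OF \<nu>(1) \<Lambda>(1) depUT] by simp
    fix \<eta>
    have "(\<Sum>s\<in>?S. ?p s \<eta> * ln (w s)) + (\<Sum>z\<in>I. ?G (shift z \<eta>)) = (\<Sum>s\<in>?S. ?p s \<eta> * ln (X s \<eta>))"
      by (rule lnX[symmetric])
    also have "\<dots> \<le> ln (\<Sum>s\<in>?S. ?p s \<eta> * exp (ln (X s \<eta>)))"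
      by (rule jensen_exp_sum) (use W pnn sum_pattern_prob[OF r W] in auto)
    also have "\<dots> = ln (U \<eta>)" by (simp add: U_def Xpos)
    also have "\<dots> \<le> ln (exp e * U (T \<eta>))"
      using UT[of \<eta>] Upos by (subst ln_le_cancel_iff) auto
    also have "\<dots> = e + ln (U (T \<eta>))" using Upos[of "T \<eta>"] by (simp add: ln_mult)
    finally show "(\<Sum>s\<in>?S. ?p s \<eta> * ln (w s)) + (\<Sum>z\<in>I. ?G (shift z \<eta>)) \<le> e + ln (U (T \<eta>))" .
  qed
  also have "\<dots> = e + (\<integral>\<eta>. ln (U (T \<eta>)) \<partial>\<nu>)"
    using local_integrable[OF \<nu>(1) \<Lambda>(1) depUT] \<nu>.prob_space by simp
  also have "\<dots> \<le> e + (pattern_entropy \<Lambda> \<nu> \<mu> + ln (\<integral>\<eta>. exp (ln (U (T \<eta>))) \<partial>\<mu>))"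
    by (intro add_left_mono variational_bound_real[OF cm \<nu>(1) \<Lambda>(1) depUT])
       (use mpos[OF \<Lambda>(1)] in \<open>auto simp: less_imp_neq[symmetric]\<close>)
  also have "\<dots> \<le> e + (pattern_entropy \<Lambda> \<nu> \<mu> + e)"
  proof (intro add_left_mono)
    have "(\<integral>\<eta>. exp (ln (U (T \<eta>))) \<partial>\<mu>) \<le> (\<integral>\<eta>. exp e * U \<eta> \<partial>\<mu>)"
    proof (rule integral_mono)
      show "integrable \<mu> (\<lambda>\<eta>. exp (ln (U (T \<eta>))))"
        by (rule local_integrable[OF cm \<Lambda>(1)]) (rule depends_only_on_compose[OF depUT])
    qed (use iU TU Upos in auto)
    also have "\<dots> \<le> exp e * 1" using EU by simp
    finally have le: "(\<integral>\<eta>. exp (ln (U (T \<eta>))) \<partial>\<mu>) \<le> exp e" by simp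
    have "0 < (\<integral>\<eta>. exp (ln (U (T \<eta>))) \<partial>\<mu>)"
    proof -
      have "(\<integral>\<eta>. exp (ln (U (T \<eta>))) \<partial>\<mu>) = (\<Sum>\<xi>\<in>\<Lambda> \<rightarrow>\<^sub>E UNIV. measure \<mu> (cylinder \<Lambda> \<xi>) * exp (ln (U (T \<xi>))))"
        by (rule integral_local[OF cm \<Lambda>(1)]) (rule depends_only_on_compose[OF depUT])
      also have "\<dots> > 0" by (rule sum_pos) (use \<Lambda>(1) mpos[OF \<Lambda>(1)] in auto)
      finally show ?thesis .
    qed
    then show "ln (\<integral>\<eta>. exp (ln (U (T \<eta>))) \<partial>\<mu>) \<le> e" using le by (metis exp_gt_zero ln_exp ln_le_cancel_iff)
  qed
  finally show ?thesis by simp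
qed

text \<open>Freezing the spins outside V in the kernel costs c in the positive term and c in the
  negative one, which together with the c^3 of \<open>tilt\<close> makes c^5. Then each pattern s
  contributes the product of its transition probabilities from a and from b times the same positive
  gap.\<close>

lemma tilt_mean_pos:
  fixes r :: "('g::{ab_group_add,countable}) set \<Rightarrow> real"
  assumes r: "pca_coefficients r" and \<kappa>: "\<kappa> > 0" "\<And>x b \<eta>. \<kappa> \<le> site_prob r x b \<eta>"
    and \<nu>: "\<nu> \<in> config_measures" and V: "finite V" and c: "c \<ge> 1"
    and bd: "\<And>s \<zeta> \<zeta>'. \<forall>x\<in>V. \<zeta> x = \<zeta>' x \<Longrightarrow> pattern_prob r V s \<zeta> \<le> c * pattern_prob r V s \<zeta>'"
    and gap: "c ^ 5 * (measure \<nu> (cylinder V b) * measure \<mu> (cylinder V a)) < measure \<nu> (cylinder V a) * measure \<mu> (cylinder V b)"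
  shows "0 < (\<integral>\<eta>. (\<Sum>s\<in>V \<rightarrow>\<^sub>E UNIV. pattern_prob r V s \<eta> * tilt r \<mu> V c a b s \<eta>) \<partial>\<nu>)"
proof -
  let ?p = "pattern_prob r V"
  let ?na = "measure \<nu> (cylinder V a)" and ?nb = "measure \<nu> (cylinder V b)"
  let ?ma = "measure \<mu> (cylinder V a)" and ?mb = "measure \<mu> (cylinder V b)"
  note pnn = pattern_prob_nonneg[OF r]
  have ii: "integrable \<nu> (\<lambda>\<eta>. indicator (cylinder V a) \<eta> * ?p s \<eta>)" for a s
  proof (rule bounded_integrable[OF \<nu>, where B=1])
    show "(\<lambda>\<eta>. indicator (cylinder V a) \<eta> * ?p s \<eta>) \<in> borel_measurable borel"
      using V by (intro borel_measurable_times borel_measurable_indicator pattern_prob_measurable[OF r]) simp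
  qed (use pnn pattern_prob_le_1[OF r] in \<open>auto simp: indicator_def\<close>)
  have ic: "integrable \<nu> (indicator (cylinder V a) :: _ \<Rightarrow> real)" for a
    by (rule bounded_integrable[OF \<nu>, where B=1]) (use V in \<open>auto simp: indicator_def\<close>)
  have low: "?p s a * ?na \<le> c * (\<integral>\<eta>. indicator (cylinder V a) \<eta> * ?p s \<eta> \<partial>\<nu>)" for s
  proof -
    have "(\<integral>\<eta>. ?p s a * indicator (cylinder V a) \<eta> \<partial>\<nu>) \<le> (\<integral>\<eta>. c * (indicator (cylinder V a) \<eta> * ?p s \<eta>) \<partial>\<nu>)"
    proof (rule integral_mono)
      show "?p s a * indicator (cylinder V a) \<eta> \<le> c * (indicator (cylinder V a) \<eta> * ?p s \<eta>)" for \<eta>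
        using bd[of a \<eta> s] by (auto simp: indicator_def in_cylinder_iff)
    qed (use ii ic in auto)
    then show ?thesis by (simp add: config_measuresD(3)[OF \<nu>])
  qed
  have up: "(\<integral>\<eta>. indicator (cylinder V b) \<eta> * ?p s \<eta> \<partial>\<nu>) \<le> c * (?p s b * ?nb)" for s
  proof -
    have "(\<integral>\<eta>. indicator (cylinder V b) \<eta> * ?p s \<eta> \<partial>\<nu>) \<le> (\<integral>\<eta>. c * ?p s b * indicator (cylinder V b) \<eta> \<partial>\<nu>)"
    proof (rule integral_mono)
      show "indicator (cylinder V b) \<eta> * ?p s \<eta> \<le> c * ?p s b * indicator (cylinder V b) \<eta>" for \<eta>
        using bd[of \<eta> b s] by (auto simp: indicator_def in_cylinder_iff)
    qed (use ii ic in auto)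
    then show ?thesis by (simp add: config_measuresD(3)[OF \<nu>] mult.assoc)
  qed
  let ?E = "\<integral>\<eta>. (\<Sum>s\<in>V \<rightarrow>\<^sub>E UNIV. ?p s \<eta> * tilt r \<mu> V c a b s \<eta>) \<partial>\<nu>"
  have "?E = (\<integral>\<eta>. (\<Sum>s\<in>V \<rightarrow>\<^sub>E UNIV. ?mb * ?p s b * (indicator (cylinder V a) \<eta> * ?p s \<eta>) -
      c ^ 3 * ?ma * ?p s a * (indicator (cylinder V b) \<eta> * ?p s \<eta>)) \<partial>\<nu>)"
    by (intro Bochner_Integration.integral_cong sum.cong refl) (simp add: tilt_def algebra_simps)
  also have "\<dots> = (\<Sum>s\<in>V \<rightarrow>\<^sub>E UNIV. ?mb * ?p s b * (\<integral>\<eta>. indicator (cylinder V a) \<eta> * ?p s \<eta> \<partial>\<nu>) -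
      c ^ 3 * ?ma * ?p s a * (\<integral>\<eta>. indicator (cylinder V b) \<eta> * ?p s \<eta> \<partial>\<nu>))"
    by (subst Bochner_Integration.integral_sum) (use ii in auto)
  finally have E: "c * ?E = (\<Sum>s\<in>V \<rightarrow>\<^sub>E UNIV. ?mb * ?p s b * (c * (\<integral>\<eta>. indicator (cylinder V a) \<eta> * ?p s \<eta> \<partial>\<nu>)) -
      c ^ 4 * ?ma * ?p s a * (\<integral>\<eta>. indicator (cylinder V b) \<eta> * ?p s \<eta> \<partial>\<nu>))"
    by (simp only: sum_distrib_left right_diff_distrib power_numeral_reduce mult_ac) (simp add: eval_nat_numeral mult_ac)
  have "0 < (\<Sum>s\<in>V \<rightarrow>\<^sub>E UNIV. (?p s a * ?p s b) * (?na * ?mb - c ^ 5 * (?nb * ?ma)))"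
  proof (rule sum_pos)
    fix s
    show "0 < (?p s a * ?p s b) * (?na * ?mb - c ^ 5 * (?nb * ?ma))"
      using gap by (intro mult_pos_pos pattern_prob_pos[OF \<kappa>]) auto
  qed (use V in auto)
  also have "\<dots> = (\<Sum>s\<in>V \<rightarrow>\<^sub>E UNIV. ?mb * ?p s b * (?p s a * ?na) - c ^ 4 * ?ma * ?p s a * (c * (?p s b * ?nb)))"
    by (intro sum.cong refl) (simp add: right_diff_distrib eval_nat_numeral mult_ac)
  also have "\<dots> \<le> c * ?E"
    unfolding E using c
    by (intro sum_mono diff_mono mult_left_mono low up mult_nonneg_nonneg pnn) auto
  finally have "0 < c * ?E" .
  then show ?thesis using c by (simp add: zero_less_mult_iff)
qed

proposition zero_production_dominated:
  fixes \<Psi> :: "(int^'d::finite) potential"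
  assumes r: "pca_coefficients r" and \<kappa>: "\<kappa> > 0" "\<And>x b \<eta>. \<kappa> \<le> site_prob r x b \<eta>"
    and tails: "\<forall>e>0. \<exists>C. finite C \<and> (\<forall>F \<eta> s b b'. finite F \<longrightarrow> F \<inter> C = {} \<longrightarrow>
       pattern_prob r F s (\<eta>(0 := b)) \<le> exp e * pattern_prob r F s (\<eta>(0 := b')))"
    and \<Psi>: "ti_summable_potential \<Psi>" and \<mu>: "gibbs_measure \<Psi> \<mu>" "translation_invariant \<mu>"
    and stat: "pca_step r \<mu> = \<mu>"
    and \<nu>: "\<nu> \<in> config_measures" "translation_invariant \<nu>"
    and L: "(\<lambda>n. pattern_entropy (cube n) \<nu> \<mu> / cube_size TYPE('d) n) \<longlonglongrightarrow> L"
      "(\<lambda>n. pattern_entropy (cube n) (pca_step r \<nu>) \<mu> / cube_size TYPE('d) n) \<longlonglongrightarrow> L"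
    and d: "d > 0"
  shows "eventually (\<lambda>n. \<forall>a. measure \<nu> (cylinder (cube n) a) \<le>
        exp (d * cube_size TYPE('d) n) * measure \<mu> (cylinder (cube n) a)) sequentially"
proof -
  have cm: "\<mu> \<in> config_measures" by (rule gibbs_measure_config[OF \<mu>(1)])
  note cpos = cube_size_pos[where 'd='d]
  \<comment> \<open>Five boundary factors enter \<open>tilt_mean_pos\<close>; each gets a fifth of
    the exponent.\<close>
  have d5: "d / 5 > 0" using d by simp
  from gibbs_prob_cube_uniform[OF \<Psi> d5] pattern_swap[OF r \<kappa> tails d5] cube_pattern_boundary[OF r \<kappa> d5]
  show ?thesis
  proof eventually_elim
    case (elim k)
    let ?V = "cube k :: (int^'d) set" and ?ck = "cube_size TYPE('d) k"
    define c where "c = exp (d / 5 * ?ck)"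
    have c: "c \<ge> 1" using d by (simp add: c_def)
    have c5: "c ^ 5 = exp (d * ?ck)" by (simp add: c_def exp_of_nat_mult[symmetric])
    have cmp: "gibbs_prob \<Psi> ?V a \<eta> \<le> c * gibbs_prob \<Psi> ?V a \<eta>'" for a \<eta> \<eta>'
      using elim(1) unfolding c_def by blast
    have swap: "pattern_prob r W s (override_on \<eta> a ?V) * pattern_prob r ?V s b \<le>
        c * (pattern_prob r W s (override_on \<eta> b ?V) * pattern_prob r ?V s a)"
      if "finite W" "?V \<subseteq> W" for W s \<eta> a b
      using elim(2) that unfolding c_def by blast
    have bd: "pattern_prob r ?V s \<zeta> \<le> c * pattern_prob r ?V s \<zeta>'" if "\<forall>x\<in>?V. \<zeta> x = \<zeta>' x" for s \<zeta> \<zeta>'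
      using elim(3) that unfolding c_def by blast
    have ratio: "measure \<nu> (cylinder ?V a) * measure \<mu> (cylinder ?V b) \<le>
        c ^ 5 * (measure \<nu> (cylinder ?V b) * measure \<mu> (cylinder ?V a))" for a b
    proof (rule ccontr)
      assume "\<not> ?thesis"
      then have gap: "c ^ 5 * (measure \<nu> (cylinder ?V b) * measure \<mu> (cylinder ?V a)) <
          measure \<nu> (cylinder ?V a) * measure \<mu> (cylinder ?V b)" by simp
      define E where "E = (\<integral>\<eta>. (\<Sum>s\<in>?V \<rightarrow>\<^sub>E UNIV. pattern_prob r ?V s \<eta> * tilt r \<mu> ?V c a b s \<eta>) \<partial>\<nu>)"
      have E: "E > 0" unfolding E_def by (rule tilt_mean_pos[OF r \<kappa> \<nu>(1) finite_cube c bd gap])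
      define l where "l = min (1 / (2 * c ^ 3)) (E / (4 * c ^ 6))"
      have cp: "c ^ 3 > 0" "c ^ 6 > 0" using c by auto
      have l: "l > 0" "l * c ^ 3 \<le> 1 / 2" "l * (2 * c ^ 6) \<le> E / 2"
      proof -
        show "l > 0" using E cp by (simp add: l_def)
        have "l * c ^ 3 \<le> 1 / (2 * c ^ 3) * c ^ 3" using cp by (intro mult_right_mono) (auto simp: l_def)
        then show "l * c ^ 3 \<le> 1 / 2" using cp by simp
        have "l * (2 * c ^ 6) \<le> E / (4 * c ^ 6) * (2 * c ^ 6)" using cp by (intro mult_right_mono) (auto simp: l_def)
        then show "l * (2 * c ^ 6) \<le> E / 2" using cp by simp
      qed
      define G where "G \<eta> = (\<Sum>s\<in>?V \<rightarrow>\<^sub>E UNIV. pattern_prob r ?V s \<eta> * ln (1 + l * tilt r \<mu> ?V c a b s \<eta>))" for \<eta>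
      define g where "g = (\<integral>\<eta>. G \<eta> \<partial>\<nu>)"
      have g: "g > 0"
      proof -
        interpret \<nu>: prob_space \<nu> by (rule config_measuresD[OF \<nu>(1)])
        let ?S = "?V \<rightarrow>\<^sub>E (UNIV :: bool set)"
        let ?t = "\<lambda>s \<eta>. tilt r \<mu> ?V c a b s \<eta>"
        have lt: "\<bar>l * ?t s \<eta>\<bar> \<le> l * c ^ 3" for s \<eta>
          unfolding abs_mult using l(1) by (intro mult_mono abs_tilt_le[OF r cm c]) auto
        have half: "\<bar>l * ?t s \<eta>\<bar> \<le> 1 / 2" for s \<eta> using lt[of s \<eta>] l(2) by linarith
        have ln_lower: "l * ?t s \<eta> - 2 * (l * c ^ 3)\<^sup>2 \<le> ln (1 + l * ?t s \<eta>)" for s \<eta>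
        proof -
          have "(l * ?t s \<eta>)\<^sup>2 \<le> (l * c ^ 3)\<^sup>2"
            using power_mono[OF lt[of s \<eta>], of 2] by simp
          then show ?thesis using abs_ln_one_plus_x_minus_x_bound[OF half[of s \<eta>]] by linarith
        qed
        have pt: "depends_only_on ?V (\<lambda>\<eta>. ?t s \<eta>)" for s by (rule tilt_local)
        have pl: "depends_only_on ?V (\<lambda>\<eta>. ln (1 + l * ?t s \<eta>))" for s
          by (rule depends_only_on_compose[OF pt, where h="\<lambda>x. ln (1 + l * x)"])
        have ip: "integrable \<nu> (\<lambda>\<eta>. pattern_prob r ?V s \<eta> * f \<eta>)"
          if f: "depends_only_on ?V f" for s and f :: "(int^'d) config \<Rightarrow> real"
        proof -
          obtain B where B: "\<And>\<sigma>. \<bar>f \<sigma>\<bar> \<le> B" using local_bounded[OF finite_cube f] by blast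
          show ?thesis
          proof (rule bounded_integrable[OF \<nu>(1), where B="1 * B"])
            show "\<bar>pattern_prob r ?V s \<eta> * f \<eta>\<bar> \<le> 1 * B" for \<eta>
              unfolding abs_mult using B pattern_prob_nonneg[OF r] pattern_prob_le_1[OF r] by (intro mult_mono) auto
          qed (intro borel_measurable_times pattern_prob_measurable[OF r] local_measurable[OF finite_cube f])
        qed
        have iE: "integrable \<nu> (\<lambda>\<eta>. \<Sum>s\<in>?S. pattern_prob r ?V s \<eta> * ?t s \<eta>)"
          by (intro Bochner_Integration.integrable_sum ip pt)
        have "l * E - 2 * (l * c ^ 3)\<^sup>2 = (\<integral>\<eta>. l * (\<Sum>s\<in>?S. pattern_prob r ?V s \<eta> * ?t s \<eta>) - 2 * (l * c ^ 3)\<^sup>2 \<partial>\<nu>)"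
          using iE \<nu>.prob_space by (simp add: E_def)
        also have "\<dots> \<le> g"
          unfolding g_def
        proof (rule integral_mono)
          show "integrable \<nu> G" unfolding G_def[abs_def] by (intro Bochner_Integration.integrable_sum ip pl)
          show "integrable \<nu> (\<lambda>\<eta>. l * (\<Sum>s\<in>?S. pattern_prob r ?V s \<eta> * ?t s \<eta>) - 2 * (l * c ^ 3)\<^sup>2)"
            using iE by simp
          fix \<eta>
          have "l * (\<Sum>s\<in>?S. pattern_prob r ?V s \<eta> * ?t s \<eta>) - 2 * (l * c ^ 3)\<^sup>2 =
              l * (\<Sum>s\<in>?S. pattern_prob r ?V s \<eta> * ?t s \<eta>) - 2 * (l * c ^ 3)\<^sup>2 * (\<Sum>s\<in>?S. pattern_prob r ?V s \<eta>)"
            by (simp add: sum_pattern_prob[OF r finite_cube])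
          also have "\<dots> = (\<Sum>s\<in>?S. pattern_prob r ?V s \<eta> * (l * ?t s \<eta> - 2 * (l * c ^ 3)\<^sup>2))"
            by (simp add: sum_distrib_left sum_subtractf[symmetric] right_diff_distrib mult_ac)
          also have "\<dots> \<le> G \<eta>"
            unfolding G_def by (intro sum_mono mult_left_mono ln_lower pattern_prob_nonneg[OF r])
          finally show "l * (\<Sum>s\<in>?S. pattern_prob r ?V s \<eta> * ?t s \<eta>) - 2 * (l * c ^ 3)\<^sup>2 \<le> G \<eta>" .
        qed
        finally have "l * E - 2 * (l * c ^ 3)\<^sup>2 \<le> g" .
        moreover have "2 * (l * c ^ 3)\<^sup>2 = l * (l * (2 * c ^ 6))"
          by (simp add: power2_eq_square eval_nat_numeral mult_ac)
        moreover have "l * (l * (2 * c ^ 6)) \<le> l * (E / 2)" using l by (intro mult_left_mono) auto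
        moreover have "l * (E / 2) > 0" using l(1) E by simp
        ultimately show "g > 0" by simp
      qed
      \<comment> \<open>Chosen so that the localization error 2e/\<kappa> per site is half of the
        gain g/|V| per site. It may depend on k, since k is fixed before n grows.\<close>
      define e where "e = \<kappa> * g / (4 * ?ck)"
      have e: "e > 0" using \<kappa>(1) g cpos[of k] unfolding e_def by (intro divide_pos_pos mult_pos_pos) auto
      have e\<kappa>: "2 * (e / \<kappa>) = g / ?ck / 2" using \<kappa>(1) by (simp add: e_def)
      obtain m where m: "\<And>x b \<eta> \<eta>'. (\<And>a. a \<in> cube m \<Longrightarrow> \<eta> (a + x) = \<eta>' (a + x)) \<Longrightarrow>
          \<bar>site_prob r x b \<eta> - site_prob r x b \<eta>'\<bar> \<le> e"
        using site_prob_cube_modulus[OF r e] by metis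
      let ?u = "\<lambda>n. pattern_entropy (cube n) \<nu> \<mu> / cube_size TYPE('d) n"
      let ?u' = "\<lambda>n. pattern_entropy (cube n) (pca_step r \<nu>) \<mu> / cube_size TYPE('d) n"
      let ?N = "\<lambda>n. real (card (tile_centers k n :: (int^'d) set))"
      \<comment> \<open>The production bound per site: the number of tiles enters as the covered
        fraction of the cube times the gain per site.\<close>
      have "?u' n + (?N n * ?ck / cube_size TYPE('d) n) * (g / ?ck) \<le>
          ?u (n + m) * (cube_size TYPE('d) (n + m) / cube_size TYPE('d) n) + 2 * (e / \<kappa>)" if n: "n \<ge> k" for n
      proof -
        let ?c = "cube_size TYPE('d) n"
        have close: "pattern_prob r (cube n) s \<zeta> \<le> exp (?c * (e / \<kappa>)) * pattern_prob r (cube n) s \<zeta>'"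
          if eq: "\<forall>x\<in>cube (n + m). \<zeta> x = \<zeta>' x" for s \<zeta> \<zeta>'
        proof (rule pattern_prob_ratio[OF \<kappa> finite_cube])
          fix y :: "int^'d" assume y: "y \<in> cube n"
          show "\<bar>site_prob r y (s y) \<zeta> - site_prob r y (s y) \<zeta>'\<bar> \<le> e"
          proof (rule m)
            fix a :: "int^'d" assume "a \<in> cube m"
            then have "a + y \<in> cube (n + m)" using cube_add[OF _ y, of a m] by (simp add: add.commute)
            then show "\<zeta> (a + y) = \<zeta>' (a + y)" using eq by simp
          qed
        qed
        have sub: "cube n \<subseteq> (cube (n + m) :: (int^'d) set)" by (rule cube_mono) simp
        have "pattern_entropy (cube n) (pca_step r \<nu>) \<mu> + ?N n * g \<le>
            pattern_entropy (cube (n + m)) \<nu> \<mu> + 2 * (?c * (e / \<kappa>))"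
          unfolding g_def G_def
          by (rule entropy_production_bound[OF r \<kappa> \<Psi> \<mu> stat \<nu> finite_cube c cmp swap less_imp_le[OF l(1)] l(2)
                finite_cube finite_cube sub finite_tile_centers tile_centers_disjoint tile_subset_cube[OF n] close])
        then have "(pattern_entropy (cube n) (pca_step r \<nu>) \<mu> + ?N n * g) / ?c \<le>
            (pattern_entropy (cube (n + m)) \<nu> \<mu> + 2 * (?c * (e / \<kappa>))) / ?c"
          using cpos[of n] by (intro divide_right_mono) auto
        moreover have "(pattern_entropy (cube n) (pca_step r \<nu>) \<mu> + ?N n * g) / ?c =
            ?u' n + (?N n * ?ck / ?c) * (g / ?ck)"
        proof -
          have "(x + y * g) / C = x / C + (y * K / C) * (g / K)" if "K \<noteq> 0" for x y C K :: real
            using that by (simp add: add_divide_distrib)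
          then show ?thesis using cpos[of k] by (metis less_irrefl)
        qed
        moreover have "(pattern_entropy (cube (n + m)) \<nu> \<mu> + 2 * (?c * (e / \<kappa>))) / ?c =
            ?u (n + m) * (cube_size TYPE('d) (n + m) / ?c) + 2 * (e / \<kappa>)"
        proof -
          have "(x + 2 * (C * y)) / C = x / K * (K / C) + 2 * y" if "C \<noteq> 0" "K \<noteq> 0" for x y C K :: real
            using that by (simp add: add_divide_distrib)
          then show ?thesis using cpos[of n] cpos[of "n + m"] by (metis less_irrefl)
        qed
        ultimately show ?thesis by linarith
      qed
      then have ev: "eventually (\<lambda>n. ?u' n + (?N n * ?ck / cube_size TYPE('d) n) * (g / ?ck) \<le>
          ?u (n + m) * (cube_size TYPE('d) (n + m) / cube_size TYPE('d) n) + 2 * (e / \<kappa>)) sequentially"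
        by (rule eventually_sequentiallyI)
      \<comment> \<open>In the limit coverage and volume ratio tend to 1 and both entropies to L, so
        the whole gain would have to fit into an error of half its size.\<close>
      have "L + 1 * (g / ?ck) \<le> L * 1 + 2 * (e / \<kappa>)"
      proof (rule tendsto_le[OF _ _ _ ev])
        show "(\<lambda>n. ?u' n + (?N n * ?ck / cube_size TYPE('d) n) * (g / ?ck)) \<longlonglongrightarrow> L + 1 * (g / ?ck)"
          by (intro tendsto_add L(2) tendsto_mult tile_density tendsto_const)
        show "(\<lambda>n. ?u (n + m) * (cube_size TYPE('d) (n + m) / cube_size TYPE('d) n) + 2 * (e / \<kappa>)) \<longlonglongrightarrow> L * 1 + 2 * (e / \<kappa>)"
          by (intro tendsto_add tendsto_mult LIMSEQ_ignore_initial_segment[OF L(1)] cube_size_ratio tendsto_const)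
      qed simp
      moreover have "g / ?ck > 0" using g cpos[of k] by (intro divide_pos_pos)
      ultimately show False unfolding e\<kappa> by simp
    qed
    show ?case
    proof
      fix a
      \<comment> \<open>Summing the bound on ratios over b removes b and leaves domination of \<nu>
        by \<mu>.\<close>
      have "measure \<nu> (cylinder ?V a) = (\<Sum>b\<in>?V \<rightarrow>\<^sub>E UNIV. measure \<nu> (cylinder ?V a) * measure \<mu> (cylinder ?V b))"
        by (simp add: sum_distrib_left[symmetric] sum_cylinder_measure[OF cm])
      also have "\<dots> \<le> (\<Sum>b\<in>?V \<rightarrow>\<^sub>E UNIV. c ^ 5 * (measure \<nu> (cylinder ?V b) * measure \<mu> (cylinder ?V a)))"
        by (intro sum_mono ratio)
      also have "\<dots> = c ^ 5 * measure \<mu> (cylinder ?V a)"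
        by (simp add: sum_distrib_left[symmetric] sum_distrib_right[symmetric] sum_cylinder_measure[OF \<nu>(1)])
      finally show "measure \<nu> (cylinder ?V a) \<le> exp (d * ?ck) * measure \<mu> (cylinder ?V a)" by (simp add: c5)
    qed
  qed
qed

lemma zero_production_unique:
  fixes r :: "(int^'d::finite) set \<Rightarrow> real" and \<Phi> :: "((int^'d) \<times> int) potential"
  assumes r: "pca_coefficients r" and \<Phi>: "ti_summable_potential \<Phi>"
    and path: "path_space_law r \<mu> M" and M: "gibbs_measure \<Phi> M"
    and \<mu>: "\<mu> \<in> stationary_ti_measures r"
    and \<Psi>: "ti_summable_potential \<Psi>" and gibbs: "gibbs_measure \<Psi> \<mu>"
    and gcb: "GCB C \<mu>" "C > 0"
    and \<nu>: "\<nu> \<in> config_measures" "translation_invariant \<nu>"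
    and zero: "relative_entropy_density \<nu> \<mu> = relative_entropy_density (pca_step r \<nu>) \<mu>"
  shows "\<nu> = \<mu>"
proof -
  have st: "\<mu> \<in> config_measures" "pca_step r \<mu> = \<mu>" "translation_invariant \<mu>"
    using \<mu> by (auto simp: stationary_ti_measures_def)
  obtain \<kappa> where \<kappa>: "\<kappa> > 0" "\<And>x b \<eta>. \<kappa> \<le> site_prob r x b \<eta>"
    using rates_bounded_below[OF r path \<Phi> M] by blast
  have tails: "\<forall>e>0. \<exists>C. finite C \<and> (\<forall>F \<eta> s b b'. finite F \<longrightarrow> F \<inter> C = {} \<longrightarrow>
       pattern_prob r F s (\<eta>(0 := b)) \<le> exp e * pattern_prob r F s (\<eta>(0 := b')))"
  proof (intro allI impI)
    fix e :: real assume e: "e > 0"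
    show "\<exists>C. finite C \<and> (\<forall>F \<eta> s b b'. finite F \<longrightarrow> F \<inter> C = {} \<longrightarrow>
       pattern_prob r F s (\<eta>(0 := b)) \<le> exp e * pattern_prob r F s (\<eta>(0 := b')))"
    proof (rule influence_tail[OF r path \<Phi> M \<kappa> e])
      fix C assume C: "finite C" "\<And>F \<eta> s b b'. finite F \<Longrightarrow> F \<inter> C = {} \<Longrightarrow>
        pattern_prob r F s (\<eta>(0 := b)) \<le> exp e * pattern_prob r F s (\<eta>(0 := b'))"
      show ?thesis by (intro exI[of _ C] conjI allI impI C)
    qed
  qed
  have low: "\<kappa> ^ card (cube n :: (int^'d) set) \<le> measure \<mu> (cylinder (cube n) a)" for n a
  proof -
    interpret prob_space \<mu> by (rule config_measuresD[OF st(1)])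
    have "(\<integral>\<eta>. \<kappa> ^ card (cube n :: (int^'d) set) \<partial>\<mu>) \<le> (\<integral>\<eta>. pattern_prob r (cube n) a \<eta> \<partial>\<mu>)"
      using \<kappa> by (intro integral_mono pattern_prob_integrable[OF r st(1)] pattern_prob_lower) auto
    then show ?thesis
      using measure_pca_step_cylinder[OF r st(1) finite_cube, of n a] prob_space by (simp add: st(2))
  qed
  \<comment> \<open>Both densities are genuine limits, so the hypothesis on the two
    \<open>lim\<close> values becomes an equality of real numbers.\<close>
  obtain L where L: "(\<lambda>n. pattern_entropy (cube n) \<nu> \<mu> / cube_size TYPE('d) n) \<longlonglongrightarrow> L"
    "relative_entropy_density \<nu> \<mu> = ereal L"
    by (rule entropy_density_exists[OF \<Psi> gibbs st(3) \<nu> \<kappa>(1) low])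
  obtain L' where L': "(\<lambda>n. pattern_entropy (cube n) (pca_step r \<nu>) \<mu> / cube_size TYPE('d) n) \<longlonglongrightarrow> L'"
    "relative_entropy_density (pca_step r \<nu>) \<mu> = ereal L'"
    by (rule entropy_density_exists[OF \<Psi> gibbs st(3) pca_step_config[OF r \<nu>(1)]
          pca_step_translation_invariant[OF r \<nu>] \<kappa>(1) low])
  have "L' = L" using zero L(2) L'(2) by simp
  note dom = zero_production_dominated[OF r \<kappa> tails \<Psi> gibbs st(3) st(2) \<nu> L(1) L'(1)[unfolded \<open>L' = L\<close>]]
  have "variationally_close \<nu> \<mu>"
    by (rule variationally_closeI[OF st(1) \<nu>(1) liminf_entropy_le_0[OF st(1) \<nu>(1) dom]])
  then show ?thesis
    by (rule GCB_unique[OF st(1,3) \<nu> gcb(1) less_imp_le[OF gcb(2)]])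
qed

theorem theorem4p2:
  fixes r :: "(int^'d::finite) set \<Rightarrow> real"
  assumes pca: "pca_coefficients r"
    and path_gibbs: "\<exists>\<Phi> :: ((int^'d) \<times> int) potential. ti_summable_potential \<Phi> \<and>
          (\<forall>\<nu>\<in>stationary_ti_measures r. \<exists>M. path_space_law r \<nu> M \<and> gibbs_measure \<Phi> M)"
  shows "(non_degenerate r \<longrightarrow>
           (\<forall>\<mu>\<in>config_measures. \<forall>\<mu>'\<in>config_measures.
              translation_invariant \<mu> \<and> translation_invariant \<mu>' \<and> \<mu> \<noteq> \<mu>' \<and>
              convergent (entropy_per_site \<mu> \<mu>') \<and> relative_entropy_density \<mu> \<mu>' = 0 \<longrightarrow>
              (\<forall>n. \<forall>C\<ge>0. \<not> GCB C ((pca_step r ^^ n) \<mu>'))))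
       \<and> (\<forall>\<nu>\<in>stationary_ti_measures r. \<forall>\<nu>'\<in>stationary_ti_measures r.
            \<nu>' \<noteq> \<nu> \<and> (\<exists>C>0. GCB C \<nu>) \<longrightarrow>
              lower_relative_entropy_density \<nu>' \<nu> > 0 \<and>
              \<not> (\<exists>\<Psi>. ti_summable_potential \<Psi> \<and> gibbs_measure \<Psi> \<nu> \<and> gibbs_measure \<Psi> \<nu>'))
       \<and> (\<forall>\<mu>\<in>stationary_ti_measures r.
            (\<exists>\<Psi>. ti_summable_potential \<Psi> \<and> gibbs_measure \<Psi> \<mu>) \<and> (\<exists>C>0. GCB C \<mu>) \<longrightarrow>
              (\<forall>\<nu>\<in>config_measures. translation_invariant \<nu> \<and>
                 relative_entropy_density \<nu> \<mu> = relative_entropy_density (pca_step r \<nu>) \<mu> \<longrightarrow> \<nu> = \<mu>) \<and>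
              stationary_ti_measures r = {\<mu>})"
proof (intro conjI)
  show "non_degenerate r \<longrightarrow>
           (\<forall>\<mu>\<in>config_measures. \<forall>\<mu>'\<in>config_measures.
              translation_invariant \<mu> \<and> translation_invariant \<mu>' \<and> \<mu> \<noteq> \<mu>' \<and>
              convergent (entropy_per_site \<mu> \<mu>') \<and> relative_entropy_density \<mu> \<mu>' = 0 \<longrightarrow>
              (\<forall>n. \<forall>C\<ge>0. \<not> GCB C ((pca_step r ^^ n) \<mu>')))"
  proof (intro impI ballI allI, elim conjE)
    fix \<mu> \<mu>' :: "(int^'d) config measure" and n C
    assume nd: "non_degenerate r" and \<mu>: "\<mu> \<in> config_measures" "translation_invariant \<mu>"
      and \<mu>': "\<mu>' \<in> config_measures" "translation_invariant \<mu>'" and neq: "\<mu> \<noteq> \<mu>'" and C: "(0::real) \<le> C"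
      and conv: "convergent (entropy_per_site \<mu> \<mu>')" and zero: "relative_entropy_density \<mu> \<mu>' = 0"
    \<comment> \<open>Convergence is what turns the value of \<open>lim\<close> into a limit, and
      hence into a liminf.\<close>
    have "entropy_per_site \<mu> \<mu>' \<longlonglongrightarrow> 0"
      using conv zero unfolding convergent_LIMSEQ_iff relative_entropy_density_def by simp
    then have "liminf (entropy_per_site \<mu> \<mu>') = 0"
      by (intro lim_imp_Liminf) simp_all
    then show "\<not> GCB C ((pca_step r ^^ n) \<mu>')"
      by (intro zero_entropy_no_GCB[OF pca nd \<mu>' \<mu> neq _ C]) simp
  qed
next
  show "\<forall>\<nu>\<in>stationary_ti_measures r. \<forall>\<nu>'\<in>stationary_ti_measures r.
            \<nu>' \<noteq> \<nu> \<and> (\<exists>C>0. GCB C \<nu>) \<longrightarrow>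
              lower_relative_entropy_density \<nu>' \<nu> > 0 \<and>
              \<not> (\<exists>\<Psi>. ti_summable_potential \<Psi> \<and> gibbs_measure \<Psi> \<nu> \<and> gibbs_measure \<Psi> \<nu>')"
  proof (intro ballI impI, elim conjE exE)
    fix \<nu> \<nu>' :: "(int^'d) config measure" and C
    assume \<nu>: "\<nu> \<in> stationary_ti_measures r" and \<nu>': "\<nu>' \<in> stationary_ti_measures r"
      and neq: "\<nu>' \<noteq> \<nu>" and C: "0 < C" "GCB C \<nu>"
    have m: "\<nu> \<in> config_measures" "translation_invariant \<nu>" "\<nu>' \<in> config_measures" "translation_invariant \<nu>'"
      using \<nu> \<nu>' by (auto simp: stationary_ti_measures_def)
    have pos: "\<not> liminf (entropy_per_site \<nu>' \<nu>) \<le> 0"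
      using GCB_unique[OF m C(2) less_imp_le[OF C(1)] variationally_closeI[OF m(1,3)]] neq by blast
    have "lower_relative_entropy_density \<nu>' \<nu> > 0"
      using pos by (simp add: lower_relative_entropy_density_def not_le)
    moreover have "\<not> (\<exists>\<Psi>. ti_summable_potential \<Psi> \<and> gibbs_measure \<Psi> \<nu> \<and> gibbs_measure \<Psi> \<nu>')"
      using pos common_potential_entropy by metis
    ultimately show "lower_relative_entropy_density \<nu>' \<nu> > 0 \<and>
        \<not> (\<exists>\<Psi>. ti_summable_potential \<Psi> \<and> gibbs_measure \<Psi> \<nu> \<and> gibbs_measure \<Psi> \<nu>')" by blast
  qed
next
  show "\<forall>\<mu>\<in>stationary_ti_measures r.
            (\<exists>\<Psi>. ti_summable_potential \<Psi> \<and> gibbs_measure \<Psi> \<mu>) \<and> (\<exists>C>0. GCB C \<mu>) \<longrightarrow>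
              (\<forall>\<nu>\<in>config_measures. translation_invariant \<nu> \<and>
                 relative_entropy_density \<nu> \<mu> = relative_entropy_density (pca_step r \<nu>) \<mu> \<longrightarrow> \<nu> = \<mu>) \<and>
              stationary_ti_measures r = {\<mu>}"
  proof (intro ballI impI, elim conjE exE)
    fix \<mu> \<Psi> C
    assume \<mu>: "\<mu> \<in> stationary_ti_measures r" and \<Psi>: "ti_summable_potential \<Psi>" "gibbs_measure \<Psi> \<mu>"
      and C: "0 < C" "GCB C \<mu>"
    obtain \<Phi> M where \<Phi>: "ti_summable_potential \<Phi>" "path_space_law r \<mu> M" "gibbs_measure \<Phi> M"
      using path_gibbs \<mu> by blast
    have unique: "\<nu> = \<mu>" if "\<nu> \<in> config_measures" "translation_invariant \<nu>"
        "relative_entropy_density \<nu> \<mu> = relative_entropy_density (pca_step r \<nu>) \<mu>" for \<nu>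
      by (rule zero_production_unique[OF pca \<Phi> \<mu> \<Psi> C(2,1) that])
    \<comment> \<open>A stationary measure is unchanged by the step, so its entropy production
      vanishes trivially.\<close>
    have "\<nu> = \<mu>" if "\<nu> \<in> stationary_ti_measures r" for \<nu>
      using that by (intro unique) (auto simp: stationary_ti_measures_def)
    then show "(\<forall>\<nu>\<in>config_measures. translation_invariant \<nu> \<and>
                 relative_entropy_density \<nu> \<mu> = relative_entropy_density (pca_step r \<nu>) \<mu> \<longrightarrow> \<nu> = \<mu>) \<and>
              stationary_ti_measures r = {\<mu>}"
      using unique \<mu> by blast
  qed
qed

end
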